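(* Let $s_1,s_2\in\overline{\mathbf R_\flat}$, $s=(s_2,s_1)$, $W=\mathbf C^{d_2}\times\mathbf C^{d_1}$, and for $K\in\widehat{\mathcal A}_0'(W)$ let $T_K:\mathcal A_0(\mathbf C^{d_1})\to\mathcal A_0'(\mathbf C^{d_2})$ be the kernel operator with kernel $K$. Then the mappings $K\mapsto T_K$ $$\widehat{\mathcal A}_s(W)\to\mathcal L(\mathcal A_{s_1}'(\mathbf C^{d_1}),\mathcal A_{s_2}(\mathbf C^{d_2})),\qquad \widehat{\mathcal A}_s'(W)\to\mathcal L(\mathcal A_{s_1}(\mathbf C^{d_1}),\mathcal A_{s_2}'(\mathbf C^{d_2})),$$ $$\widehat{\mathcal B}_s(W)\to\mathcal L(\mathcal A_{s_1}(\mathbf C^{d_1}),\mathcal A_{s_2}(\mathbf C^{d_2})),\qquad \widehat{\mathcal B}_s^\star(W)\to\mathcal L(\mathcal A_{s_1}'(\mathbf C^{d_1}),\mathcal A_{s_2}'(\mathbf C^{d_2}))$$ are isomorphisms (where $T_K$ is understood as its unique continuous linear extension from $\mathcal A_0(\mathbf C^{d_1})$ to the indicated space). The same holds true with $\widehat{\mathcal A}_{0,s},\widehat{\mathcal B}_{0,s},\mathcal A_{0,s_1},\mathcal A_{0,s_2}$ in place of $\widehat{\mathcal A}_{s},\widehat{\mathcal B}_{s},\mathcal A_{s_1},\mathcal A_{s_2}$, respectively, at each occurrence.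
   Context: **Indices and weights.** $\mathbf N=\{0,1,2,\dots\}$. $\overline{\mathbf R_\flat}=[0,\infty)\cup\{\flat_\sigma:\sigma>0\}$, where the $\flat_\sigma$ are formal symbols, ordered so that $x_1<\flat_{\sigma_1}<\flat_{\sigma_2}<x_2$ whenever $x_1<\frac12\le x_2$ and $\sigma_1<\sigma_2$. For $r>0$ and a multi-index $\alpha$: $\vartheta_{r,s}(\alpha)=e^{r|\alpha|^{1/(2s)}}$ if $s\in(0,\infty)$; $\vartheta_{r,s}(\alpha)=r^{|\alpha|}(\alpha!)^{1/(2\sigma)}$ if $s=\flat_\sigma$; $\vartheta_{r,0}(\alpha)=1$ if $|\alpha|\le r$ and $=\infty$ if $|\alpha|>r$. Conventions: $a/\infty=0$ for all $a\in(0,\infty]$, $\infty\cdot0=0$. For a countable index set $\Lambda$ and $\omega:\Lambda\to[0,\infty]$, $\ell_{[\omega]}(\Lambda)$ is the set of $c:\Lambda\to\mathbf C$ with $\|c\,\omega\|_{\ell^p(\Lambda)}<\infty$, with this (quasi-/semi-)norm, $p\in(0,\infty]$ fixed (the limit spaces below do not depend on $p$). **One-index spaces.** $\ell_s(\mathbf N^d)=\operatorname{ind\,lim}_{r>0}\ell_{[\vartheta_{r,s}]}$, $\ell_s^\star=\operatorname{proj\,lim}_{r>0}\ell_{[1/\vartheta_{r,s}]}$, and for $s>0$, $\ell_{0,s}=\operatorname{proj\,lim}_{r>0}\ell_{[\vartheta_{r,s}]}$, $\ell_{0,s}^\star=\operatorname{ind\,lim}_{r>0}\ell_{[1/\vartheta_{r,s}]}$;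 for $s=0$, $\ell_{0,0}=\ell_{0,0}^\star=\{0\}$. Let $e_\alpha(z)=z^\alpha/\sqrt{\alpha!}$. $\mathcal A_s(\mathbf C^d)$, $\mathcal A_s'(\mathbf C^d)$, $\mathcal A_{0,s}(\mathbf C^d)$, $\mathcal A_{0,s}'(\mathbf C^d)$ are the spaces of formal power series $F=\sum_\alpha c(F;\alpha)e_\alpha$ with coefficient sequence in $\ell_s,\ell_s^\star,\ell_{0,s},\ell_{0,s}^\star$ respectively, with the transported topologies. In particular $\mathcal A_0$ is the space of polynomials and $\mathcal A_0'$ the space of all formal power series. **Two-index spaces.** Let $\Lambda=\mathbf N^{d_2}\times\mathbf N^{d_1}\ni\alpha=(\alpha_2,\alpha_1)$, $\vartheta_r(\alpha)=\vartheta_{r,s_2}(\alpha_2)\vartheta_{r,s_1}(\alpha_1)$, $\omega_{r_2,r_1}(\alpha)=\vartheta_{r_2,s_2}(\alpha_2)/\vartheta_{r_1,s_1}(\alpha_1)$, $\omega^\star_{r_2,r_1}(\alpha)=\vartheta_{r_1,s_1}(\alpha_1)/\vartheta_{r_2,s_2}(\alpha_2)$. With all limits over positive parameters and $s=(s_2,s_1)$: $\ell_{\mathcal A,s}=\operatorname{ind\,lim}_r\ell_{[\vartheta_r]}$, $\ell_{\mathcal A,s}^\star=\operatorname{proj\,lim}_r\ell_{[1/\vartheta_r]}$, $\ell_{\mathcal A,0,s}=\operatorname{proj\,lim}_r\ell_{[\vartheta_r]}$, $\ell_{\mathcal A,0,s}^\star=\operatorname{ind\,lim}_r\ell_{[1/\vartheta_r]}$;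 $\ell_{\mathcal B,s}=\operatorname{proj\,lim}_{r_1}\operatorname{ind\,lim}_{r_2}\ell_{[\omega_{r_2,r_1}]}$, $\ell_{\mathcal B,s}^\star=\operatorname{proj\,lim}_{r_2}\operatorname{ind\,lim}_{r_1}\ell_{[\omega^\star_{r_2,r_1}]}$, $\ell_{\mathcal B,0,s}=\operatorname{proj\,lim}_{r_2}\operatorname{ind\,lim}_{r_1}\ell_{[\omega_{r_2,r_1}]}$, $\ell_{\mathcal B,0,s}^\star=\operatorname{proj\,lim}_{r_1}\operatorname{ind\,lim}_{r_2}\ell_{[\omega^\star_{r_2,r_1}]}$. If $s_1=0$ or $s_2=0$, the four spaces with a subscript "$0,s$" are by definition $\{0\}$. As sets, projective/inductive limits are intersections/unions. $\widehat{\mathcal A}_s(W)$, $\widehat{\mathcal A}_s'(W)$, $\widehat{\mathcal B}_s(W)$, $\widehat{\mathcal B}_s^\star(W)$, $\widehat{\mathcal A}_{0,s}(W)$, $\widehat{\mathcal A}_{0,s}'(W)$, $\widehat{\mathcal B}_{0,s}(W)$, $\widehat{\mathcal B}_{0,s}^\star(W)$ are the spaces of formal series $K(z_2,z_1)=\sum c(K;\alpha_2,\alpha_1)e_{\alpha_2}(z_2)e_{\alpha_1}(\overline{z_1})$ with coefficients in $\ell_{\mathcal A,s},\ell_{\mathcal A,s}^\star,\ell_{\mathcal B,s},\ell_{\mathcal B,s}^\star,\ell_{\mathcal A,0,s},\ell_{\mathcal A,0,s}^\star,\ell_{\mathcal B,0,s},\ell_{\mathcal B,0,s}^\star$, respectively.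 $\widehat{\mathcal A}_0'(W)$ is the space of all such formal series. **Kernel operators.** $T_KF=\sum_{\alpha_2}\big(\sum_{\alpha_1}c(K;\alpha_2,\alpha_1)c(F;\alpha_1)\big)e_{\alpha_2}$ for $F\in\mathcal A_0(\mathbf C^{d_1})$; equivalently $T_KF(z_2)=\pi^{-d_1}\int_{\mathbf C^{d_1}}K(z_2,z_1)F(z_1)e^{-|z_1|^2}\,d\lambda(z_1)$ when the integral makes sense. $\mathcal L(V_1,V_2)$ is the vector space of continuous linear maps $V_1\to V_2$; "isomorphism" means linear bijection.
   Formalization: The kernel spaces A_s(W) and A'_s(W) are defined with independent parameters r_2, r_1 > 0 in the two weight factors instead of a common r; this changes them only when exactly one of s_1, s_2 is 0, where the common-r union is not a vector space and the claim fails. *)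

theory Defs
  imports "HOL-Analysis.Analysis"
begin

section \<open>Indices and weights\<close>

text \<open>\<open>Flat \<sigma>\<close> is the formal symbol $\flat_\sigma$. The type also contains junk (negative
  numbers, \<open>Flat \<sigma>\<close> with \<open>\<sigma> \<le> 0\<close>), which \<open>R_flat_bar\<close> removes.\<close>

datatype flat_index = Num real | Flat real

definition R_flat_bar :: "flat_index set"
  where "R_flat_bar = Num ` {0..} \<union> Flat ` {0<..}"

type_synonym 'd midx = "'d \<Rightarrow> nat"

definition mabs :: "('d::finite) midx \<Rightarrow> nat"
  where "mabs \<alpha> = (\<Sum>i\<in>UNIV. \<alpha> i)"

definition mfact :: "('d::finite) midx \<Rightarrow> real"
  where "mfact \<alpha> = (\<Prod>i\<in>UNIV. fact (\<alpha> i))"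

fun weight :: "real \<Rightarrow> flat_index \<Rightarrow> ('d::finite) midx \<Rightarrow> ennreal"
  where
    "weight r (Num s) \<alpha> =
       (if s = 0 then (if real (mabs \<alpha>) \<le> r then 1 else top)
        else ennreal (exp (r * real (mabs \<alpha>) powr (1 / (2 * s)))))"
  | "weight r (Flat \<sigma>) \<alpha> = ennreal (r ^ mabs \<alpha> * mfact \<alpha> powr (1 / (2 * \<sigma>)))"

section \<open>Weighted sequence spaces\<close>

text \<open>Arithmetic in \<^typ>\<open>ennreal\<close> follows the conventions \<open>a / \<infinity> = 0\<close> (also for \<open>a = \<infinity>\<close>)
  and \<open>\<infinity> * 0 = 0\<close>.\<close>

lemma "a / top = (0::ennreal)" "top * 0 = (0::ennreal)"
  by simp_all

text \<open>Used for positive exponents only.\<close>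

definition epowr :: "ennreal \<Rightarrow> real \<Rightarrow> ennreal"
  where "epowr x a = (if x = top then top else ennreal (enn2real x powr a))"

definition lp_norm :: "ennreal \<Rightarrow> ('i \<Rightarrow> ennreal) \<Rightarrow> ennreal"
  where "lp_norm p f =
    (if p = top then (SUP i. f i)
     else epowr (\<integral>\<^sup>+ i. epowr (f i) (enn2real p) \<partial>count_space UNIV) (1 / enn2real p))"

definition wnorm :: "ennreal \<Rightarrow> ('i \<Rightarrow> ennreal) \<Rightarrow> ('i \<Rightarrow> complex) \<Rightarrow> ennreal"
  where "wnorm p \<omega> c = lp_norm p (\<lambda>i. ennreal (cmod (c i)) * \<omega> i)"

definition ell :: "ennreal \<Rightarrow> ('i \<Rightarrow> ennreal) \<Rightarrow> ('i \<Rightarrow> complex) set"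
  where "ell p \<omega> = {c. wnorm p \<omega> c < top}"

definition ell_top :: "ennreal \<Rightarrow> ('i \<Rightarrow> ennreal) \<Rightarrow> ('i \<Rightarrow> complex) topology"
  where "ell_top p \<omega> = topology (\<lambda>U. U \<subseteq> ell p \<omega> \<and>
    (\<forall>x\<in>U. \<exists>\<epsilon>>0. \<forall>y\<in>ell p \<omega>. wnorm p \<omega> (\<lambda>i. y i - x i) < ennreal \<epsilon> \<longrightarrow> y \<in> U))"

lemma less_ennreal_min: "x < ennreal (min a b) \<longleftrightarrow> x < ennreal a \<and> x < ennreal b"
  using ennreal_leI[of a b] ennreal_leI[of b a] by (cases "a \<le> b") (auto simp: min_def)

lemma istopology_ell_top:
  "istopology (\<lambda>U. U \<subseteq> ell p \<omega> \<and>
    (\<forall>x\<in>U. \<exists>\<epsilon>>0. \<forall>y\<in>ell p \<omega>. wnorm p \<omega> (\<lambda>i. y i - x i) < ennreal \<epsilon> \<longrightarrow> y \<in> U))"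
  (is "istopology (\<lambda>U. U \<subseteq> ?E \<and> (\<forall>x\<in>U. \<exists>\<epsilon>>0. ?B U x \<epsilon>))")
  unfolding istopology_def
proof (rule conjI; intro allI impI)
  fix S T
  assume S: "S \<subseteq> ?E \<and> (\<forall>x\<in>S. \<exists>\<epsilon>>0. ?B S x \<epsilon>)" and T: "T \<subseteq> ?E \<and> (\<forall>x\<in>T. \<exists>\<epsilon>>0. ?B T x \<epsilon>)"
  show "S \<inter> T \<subseteq> ?E \<and> (\<forall>x\<in>S \<inter> T. \<exists>\<epsilon>>0. ?B (S \<inter> T) x \<epsilon>)"
  proof (rule conjI)
    show "\<forall>x\<in>S \<inter> T. \<exists>\<epsilon>>0. ?B (S \<inter> T) x \<epsilon>"
    proof
      fix x assume "x \<in> S \<inter> T"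
      then obtain a b where "a > 0" "?B S x a" "b > 0" "?B T x b"
        using S T by blast
      then show "\<exists>\<epsilon>>0. ?B (S \<inter> T) x \<epsilon>"
        by (intro exI[of _ "min a b"]) (auto simp: less_ennreal_min)
    qed
  qed (use S in blast)
next
  fix \<K> assume K: "\<forall>K\<in>\<K>. K \<subseteq> ?E \<and> (\<forall>x\<in>K. \<exists>\<epsilon>>0. ?B K x \<epsilon>)"
  show "\<Union>\<K> \<subseteq> ?E \<and> (\<forall>x\<in>\<Union>\<K>. \<exists>\<epsilon>>0. ?B (\<Union>\<K>) x \<epsilon>)"
  proof (intro conjI ballI)
    show "\<Union>\<K> \<subseteq> ?E" using K by blast
  next
    fix x assume "x \<in> \<Union>\<K>"
    then obtain K' where K': "K' \<in> \<K>" "x \<in> K'" by blast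
    then obtain \<epsilon> where "\<epsilon> > 0" "?B K' x \<epsilon>" using K by blast
    then show "\<exists>\<epsilon>>0. ?B (\<Union>\<K>) x \<epsilon>" using K'(1) by blast
  qed
qed

text \<open>The projective limit carries the initial topology of the inclusions into the spaces
  \<open>ell p (\<omega> r)\<close>, \<open>r > 0\<close>.\<close>

definition projlim :: "ennreal \<Rightarrow> (real \<Rightarrow> 'i \<Rightarrow> ennreal) \<Rightarrow> ('i \<Rightarrow> complex) topology"
  where "projlim p \<omega> = topology_generated_by
    {(\<Inter>r\<in>{0<..}. ell p (\<omega> r)) \<inter> V | r V. r > 0 \<and> openin (ell_top p (\<omega> r)) V}"

definition abs_convex :: "('i \<Rightarrow> complex) set \<Rightarrow> bool"
  where "abs_convex V \<longleftrightarrow>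
    (\<forall>x\<in>V. \<forall>y\<in>V. \<forall>a b. cmod a + cmod b \<le> 1 \<longrightarrow> (\<lambda>i. a * x i + b * y i) \<in> V)"

text \<open>The inductive limit is the locally convex one: its zero neighbourhoods are generated by the
  absolutely convex subsets of the union that meet every step \<open>ell p (\<omega> r)\<close> in a zero
  neighbourhood of that step. Only used for families of steps that are totally ordered by
  inclusion, so that the union is a vector space.\<close>

definition indlim_nbhd :: "ennreal \<Rightarrow> (real \<Rightarrow> 'i \<Rightarrow> ennreal) \<Rightarrow> ('i \<Rightarrow> complex) set \<Rightarrow> bool"
  where "indlim_nbhd p \<omega> V \<longleftrightarrow>
    V \<subseteq> (\<Union>r\<in>{0<..}. ell p (\<omega> r)) \<and> abs_convex V \<and>
    (\<forall>r>0. \<exists>\<epsilon>>0. {x. wnorm p (\<omega> r) x < ennreal \<epsilon>} \<subseteq> V)"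

definition indlim :: "ennreal \<Rightarrow> (real \<Rightarrow> 'i \<Rightarrow> ennreal) \<Rightarrow> ('i \<Rightarrow> complex) topology"
  where "indlim p \<omega> = topology (\<lambda>U. U \<subseteq> (\<Union>r\<in>{0<..}. ell p (\<omega> r)) \<and>
    (\<forall>x\<in>U. \<exists>V. indlim_nbhd p \<omega> V \<and> (\<forall>v\<in>V. (\<lambda>i. x i + v i) \<in> U)))"

lemma indlim_nbhd_Int:
  assumes V: "indlim_nbhd p \<omega> V" and W: "indlim_nbhd p \<omega> W"
  shows "indlim_nbhd p \<omega> (V \<inter> W)"
  unfolding indlim_nbhd_def
proof (intro conjI allI impI)
  show "V \<inter> W \<subseteq> (\<Union>r\<in>{0<..}. ell p (\<omega> r))"
    using V unfolding indlim_nbhd_def by blast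
  have "abs_convex V" "abs_convex W"
    using V W unfolding indlim_nbhd_def by simp_all
  then show "abs_convex (V \<inter> W)"
    unfolding abs_convex_def by blast
  fix r :: real assume "r > 0"
  obtain a where a: "a > 0" "{x. wnorm p (\<omega> r) x < ennreal a} \<subseteq> V"
    using V \<open>r > 0\<close> unfolding indlim_nbhd_def by blast
  obtain b where b: "b > 0" "{x. wnorm p (\<omega> r) x < ennreal b} \<subseteq> W"
    using W \<open>r > 0\<close> unfolding indlim_nbhd_def by blast
  have "{x. wnorm p (\<omega> r) x < ennreal (min a b)} \<subseteq> V \<inter> W"
    using a(2) b(2) unfolding less_ennreal_min by blast
  then show "\<exists>\<epsilon>>0. {x. wnorm p (\<omega> r) x < ennreal \<epsilon>} \<subseteq> V \<inter> W"
    using a(1) b(1) by (intro exI[of _ "min a b"]) simp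
qed

lemma istopology_indlim:
  "istopology (\<lambda>U. U \<subseteq> (\<Union>r\<in>{0<..}. ell p (\<omega> r)) \<and>
    (\<forall>x\<in>U. \<exists>V. indlim_nbhd p \<omega> V \<and> (\<forall>v\<in>V. (\<lambda>i. x i + v i) \<in> U)))"
  (is "istopology (\<lambda>U. U \<subseteq> ?E \<and> (\<forall>x\<in>U. \<exists>V. ?B U x V))")
  unfolding istopology_def
proof (rule conjI; intro allI impI)
  fix S T
  assume S: "S \<subseteq> ?E \<and> (\<forall>x\<in>S. \<exists>V. ?B S x V)" and T: "T \<subseteq> ?E \<and> (\<forall>x\<in>T. \<exists>V. ?B T x V)"
  show "S \<inter> T \<subseteq> ?E \<and> (\<forall>x\<in>S \<inter> T. \<exists>V. ?B (S \<inter> T) x V)"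
  proof (rule conjI)
    show "\<forall>x\<in>S \<inter> T. \<exists>V. ?B (S \<inter> T) x V"
    proof
      fix x assume "x \<in> S \<inter> T"
      then obtain V W where "?B S x V" "?B T x W"
        using S T by blast
      then show "\<exists>V. ?B (S \<inter> T) x V"
        by (intro exI[of _ "V \<inter> W"]) (auto intro: indlim_nbhd_Int)
    qed
  qed (use S in blast)
next
  fix \<K> assume K: "\<forall>K\<in>\<K>. K \<subseteq> ?E \<and> (\<forall>x\<in>K. \<exists>V. ?B K x V)"
  show "\<Union>\<K> \<subseteq> ?E \<and> (\<forall>x\<in>\<Union>\<K>. \<exists>V. ?B (\<Union>\<K>) x V)"
  proof (intro conjI ballI)
    show "\<Union>\<K> \<subseteq> ?E" using K by blast
  next
    fix x assume "x \<in> \<Union>\<K>"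
    then obtain K' where K': "K' \<in> \<K>" "x \<in> K'" by blast
    then obtain V where "?B K' x V" using K by blast
    then show "\<exists>V. ?B (\<Union>\<K>) x V" using K'(1) by blast
  qed
qed

section \<open>One-index spaces\<close>

definition ell_s :: "ennreal \<Rightarrow> flat_index \<Rightarrow> (('d::finite) midx \<Rightarrow> complex) topology"
  where "ell_s p s = indlim p (\<lambda>r. weight r s)"

definition ell_s_star :: "ennreal \<Rightarrow> flat_index \<Rightarrow> (('d::finite) midx \<Rightarrow> complex) topology"
  where "ell_s_star p s = projlim p (\<lambda>r \<alpha>. 1 / weight r s \<alpha>)"

definition ell_0s :: "ennreal \<Rightarrow> flat_index \<Rightarrow> (('d::finite) midx \<Rightarrow> complex) topology"
  where "ell_0s p s =
    (if s = Num 0 then discrete_topology {\<lambda>_. 0} else projlim p (\<lambda>r. weight r s))"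

definition ell_0s_star :: "ennreal \<Rightarrow> flat_index \<Rightarrow> (('d::finite) midx \<Rightarrow> complex) topology"
  where "ell_0s_star p s =
    (if s = Num 0 then discrete_topology {\<lambda>_. 0} else indlim p (\<lambda>r \<alpha>. 1 / weight r s \<alpha>))"

text \<open>A formal power series is the function mapping \<open>\<alpha>\<close> to its coefficient at \<open>z\<^sup>\<alpha>\<close>.
  \<open>coeff_e F \<alpha>\<close> is $c(F;\alpha)$, the coefficient with respect to
  \<open>basis_e \<alpha> = z\<^sup>\<alpha> / sqrt (\<alpha>!)\<close>.\<close>

type_synonym 'd fser = "'d midx \<Rightarrow> complex"

definition basis_e :: "('d::finite) midx \<Rightarrow> 'd fser"
  where "basis_e \<alpha> = (\<lambda>\<beta>. if \<beta> = \<alpha> then complex_of_real (1 / sqrt (mfact \<alpha>)) else 0)"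

definition coeff_e :: "('d::finite) fser \<Rightarrow> 'd midx \<Rightarrow> complex"
  where "coeff_e F \<alpha> = complex_of_real (sqrt (mfact \<alpha>)) * F \<alpha>"

definition series_e :: "(('d::finite) midx \<Rightarrow> complex) \<Rightarrow> 'd fser"
  where "series_e c = (\<lambda>\<beta>. \<Sum>\<^sub>\<infinity>\<alpha>. c \<alpha> * basis_e \<alpha> \<beta>)"

lemma mfact_pos: "mfact \<alpha> > 0"
  by (simp add: mfact_def prod_pos)

lemma mfact_nz: "mfact \<alpha> \<noteq> 0"
  using mfact_pos[of \<alpha>] by simp

lemma series_e_eq: "series_e c \<beta> = c \<beta> / complex_of_real (sqrt (mfact \<beta>))"
proof -
  have "series_e c \<beta> = (\<Sum>\<^sub>\<infinity>\<alpha>\<in>{\<beta>}. c \<alpha> * basis_e \<alpha> \<beta>)"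
    unfolding series_e_def by (rule infsum_cong_neutral) (auto simp: basis_e_def)
  then show ?thesis by (simp add: basis_e_def)
qed

lemma series_e_coeff_e: "series_e (coeff_e F) = F"
  using mfact_pos by (auto simp: fun_eq_iff series_e_eq coeff_e_def mfact_nz)

lemma coeff_e_series_e: "coeff_e (series_e c) = c"
  using mfact_pos by (auto simp: fun_eq_iff series_e_eq coeff_e_def mfact_nz)

definition A_s :: "ennreal \<Rightarrow> flat_index \<Rightarrow> ('d::finite) fser topology"
  where "A_s p s = pullback_topology UNIV coeff_e (ell_s p s)"

definition A_s' :: "ennreal \<Rightarrow> flat_index \<Rightarrow> ('d::finite) fser topology"
  where "A_s' p s = pullback_topology UNIV coeff_e (ell_s_star p s)"

definition A_0s :: "ennreal \<Rightarrow> flat_index \<Rightarrow> ('d::finite) fser topology"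
  where "A_0s p s = pullback_topology UNIV coeff_e (ell_0s p s)"

definition A_0s' :: "ennreal \<Rightarrow> flat_index \<Rightarrow> ('d::finite) fser topology"
  where "A_0s' p s = pullback_topology UNIV coeff_e (ell_0s_star p s)"

section \<open>Two-index spaces\<close>

definition w_prod :: "flat_index \<Rightarrow> flat_index \<Rightarrow> real \<Rightarrow> real \<Rightarrow>
    ('d2::finite) midx \<times> ('d1::finite) midx \<Rightarrow> ennreal"
  where "w_prod s2 s1 r2 r1 = (\<lambda>(\<alpha>2, \<alpha>1). weight r2 s2 \<alpha>2 * weight r1 s1 \<alpha>1)"

definition w_quot :: "flat_index \<Rightarrow> flat_index \<Rightarrow> real \<Rightarrow> real \<Rightarrow>
    ('d2::finite) midx \<times> ('d1::finite) midx \<Rightarrow> ennreal"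
  where "w_quot s2 s1 r2 r1 = (\<lambda>(\<alpha>2, \<alpha>1). weight r2 s2 \<alpha>2 / weight r1 s1 \<alpha>1)"

definition w_quot_star :: "flat_index \<Rightarrow> flat_index \<Rightarrow> real \<Rightarrow> real \<Rightarrow>
    ('d2::finite) midx \<times> ('d1::finite) midx \<Rightarrow> ennreal"
  where "w_quot_star s2 s1 r2 r1 = (\<lambda>(\<alpha>2, \<alpha>1). weight r1 s1 \<alpha>1 / weight r2 s2 \<alpha>2)"

text \<open>\<open>ell_A\<close> and \<open>ell_A_star\<close> use independent parameters for the two factors instead of a common
  \<open>r\<close>. This makes no difference when \<open>s\<^sub>1\<close> and \<open>s\<^sub>2\<close> are both zero or both nonzero (lemmas
  \<open>ell_A_one_parameter\<close> and \<open>ell_A_star_one_parameter\<close> below). If exactly one of them is zero, the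
  weights with a common \<open>r\<close> are not monotone in \<open>r\<close>, as \<open>weight r (Num 0)\<close> decreases with \<open>r\<close> while
  all other weights increase; their union is not even a vector space (lemma
  \<open>one_parameter_union_not_closed\<close>), so it is not the inductive limit.\<close>

definition ell_A :: "ennreal \<Rightarrow> flat_index \<Rightarrow> flat_index \<Rightarrow>
    (('d2::finite) midx \<times> ('d1::finite) midx \<Rightarrow> complex) set"
  where "ell_A p s2 s1 = (\<Union>r2\<in>{0<..}. \<Union>r1\<in>{0<..}. ell p (w_prod s2 s1 r2 r1))"

definition ell_A_star :: "ennreal \<Rightarrow> flat_index \<Rightarrow> flat_index \<Rightarrow>
    (('d2::finite) midx \<times> ('d1::finite) midx \<Rightarrow> complex) set"
  where "ell_A_star p s2 s1 =
    (\<Inter>r2\<in>{0<..}. \<Inter>r1\<in>{0<..}. ell p (\<lambda>\<alpha>. 1 / w_prod s2 s1 r2 r1 \<alpha>))"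

definition ell_A0 :: "ennreal \<Rightarrow> flat_index \<Rightarrow> flat_index \<Rightarrow>
    (('d2::finite) midx \<times> ('d1::finite) midx \<Rightarrow> complex) set"
  where "ell_A0 p s2 s1 =
    (if s1 = Num 0 \<or> s2 = Num 0 then {\<lambda>_. 0} else (\<Inter>r\<in>{0<..}. ell p (w_prod s2 s1 r r)))"

definition ell_A0_star :: "ennreal \<Rightarrow> flat_index \<Rightarrow> flat_index \<Rightarrow>
    (('d2::finite) midx \<times> ('d1::finite) midx \<Rightarrow> complex) set"
  where "ell_A0_star p s2 s1 =
    (if s1 = Num 0 \<or> s2 = Num 0 then {\<lambda>_. 0}
     else (\<Union>r\<in>{0<..}. ell p (\<lambda>\<alpha>. 1 / w_prod s2 s1 r r \<alpha>)))"

definition ell_B :: "ennreal \<Rightarrow> flat_index \<Rightarrow> flat_index \<Rightarrow>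
    (('d2::finite) midx \<times> ('d1::finite) midx \<Rightarrow> complex) set"
  where "ell_B p s2 s1 = (\<Inter>r1\<in>{0<..}. \<Union>r2\<in>{0<..}. ell p (w_quot s2 s1 r2 r1))"

definition ell_B_star :: "ennreal \<Rightarrow> flat_index \<Rightarrow> flat_index \<Rightarrow>
    (('d2::finite) midx \<times> ('d1::finite) midx \<Rightarrow> complex) set"
  where "ell_B_star p s2 s1 = (\<Inter>r2\<in>{0<..}. \<Union>r1\<in>{0<..}. ell p (w_quot_star s2 s1 r2 r1))"

definition ell_B0 :: "ennreal \<Rightarrow> flat_index \<Rightarrow> flat_index \<Rightarrow>
    (('d2::finite) midx \<times> ('d1::finite) midx \<Rightarrow> complex) set"
  where "ell_B0 p s2 s1 =
    (if s1 = Num 0 \<or> s2 = Num 0 then {\<lambda>_. 0}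
     else (\<Inter>r2\<in>{0<..}. \<Union>r1\<in>{0<..}. ell p (w_quot s2 s1 r2 r1)))"

definition ell_B0_star :: "ennreal \<Rightarrow> flat_index \<Rightarrow> flat_index \<Rightarrow>
    (('d2::finite) midx \<times> ('d1::finite) midx \<Rightarrow> complex) set"
  where "ell_B0_star p s2 s1 =
    (if s1 = Num 0 \<or> s2 = Num 0 then {\<lambda>_. 0}
     else (\<Inter>r1\<in>{0<..}. \<Union>r2\<in>{0<..}. ell p (w_quot_star s2 s1 r2 r1)))"

subsection \<open>Common and independent parameters\<close>

lemma inverse_antimono_ennreal: "x \<le> y \<Longrightarrow> inverse y \<le> inverse (x :: ennreal)"
  unfolding less_eq_ennreal.rep_eq inverse_ennreal.rep_eq
  by (rule ereal_inverse_antimono) simp_all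

lemma epowr_mono: "x \<le> y \<Longrightarrow> a \<ge> 0 \<Longrightarrow> epowr x a \<le> epowr y a"
  by (auto simp: epowr_def top_unique enn2real_mono less_top intro!: ennreal_leI powr_mono2)

lemma ell_antimono:
  assumes "\<And>i. \<omega> i \<le> \<omega>' i"
  shows "ell p \<omega>' \<subseteq> ell p \<omega>"
proof -
  have "wnorm p \<omega> c \<le> wnorm p \<omega>' c" for c
    unfolding wnorm_def lp_norm_def
    by (auto intro!: SUP_mono' epowr_mono nn_integral_mono mult_left_mono assms)
  then show ?thesis
    unfolding ell_def by (auto intro: le_less_trans)
qed

lemma weight_mono:
  assumes "0 < r" "r \<le> r'" "s \<in> R_flat_bar" "s \<noteq> Num 0"
  shows "weight r s \<alpha> \<le> weight r' s \<alpha>"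
  using assms
  by (cases s)
     (auto simp: R_flat_bar_def intro!: ennreal_leI mult_right_mono power_mono)

lemma weight_zero_antimono: "r \<le> r' \<Longrightarrow> weight r' (Num 0) \<alpha> \<le> weight r (Num 0) \<alpha>"
  by auto

lemma weight_common_parameter:
  assumes "s1 \<in> R_flat_bar" "s2 \<in> R_flat_bar" "s1 = Num 0 \<longleftrightarrow> s2 = Num 0" "0 < r1" "0 < r2"
  shows "\<exists>r>0. \<forall>\<alpha> :: ('d2::finite) midx \<times> ('d1::finite) midx.
    w_prod s2 s1 r r \<alpha> \<le> w_prod s2 s1 r2 r1 \<alpha>"
proof (cases "s1 = Num 0")
  case True
  then have "w_prod s2 s1 (max r1 r2) (max r1 r2) \<alpha> \<le> w_prod s2 s1 r2 r1 \<alpha>"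
    for \<alpha> :: "'d2 midx \<times> 'd1 midx"
    using assms unfolding w_prod_def
    by (auto simp del: weight.simps split: prod.split intro!: mult_mono weight_zero_antimono)
  then show ?thesis using assms by (intro exI[of _ "max r1 r2"]) auto
next
  case False
  then have "w_prod s2 s1 (min r1 r2) (min r1 r2) \<alpha> \<le> w_prod s2 s1 r2 r1 \<alpha>"
    for \<alpha> :: "'d2 midx \<times> 'd1 midx"
    using assms unfolding w_prod_def
    by (auto simp del: weight.simps split: prod.split intro!: mult_mono weight_mono)
  then show ?thesis using assms by (intro exI[of _ "min r1 r2"]) auto
qed

lemma ell_A_one_parameter:
  assumes "s1 \<in> R_flat_bar" "s2 \<in> R_flat_bar" "s1 = Num 0 \<longleftrightarrow> s2 = Num 0"
  shows "(ell_A p s2 s1 :: (('d2::finite) midx \<times> ('d1::finite) midx \<Rightarrow> complex) set) =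
    (\<Union>r\<in>{0<..}. ell p (w_prod s2 s1 r r))"
proof
  show "(ell_A p s2 s1 :: ('d2 midx \<times> 'd1 midx \<Rightarrow> complex) set) \<subseteq> (\<Union>r\<in>{0<..}. ell p (w_prod s2 s1 r r))"
  proof
    fix c :: "'d2 midx \<times> 'd1 midx \<Rightarrow> complex" assume "c \<in> ell_A p s2 s1"
    then obtain r2 r1 where r: "0 < r2" "0 < r1" "c \<in> ell p (w_prod s2 s1 r2 r1)"
      unfolding ell_A_def by auto
    obtain r where "0 < r" "\<And>\<alpha> :: 'd2 midx \<times> 'd1 midx. w_prod s2 s1 r r \<alpha> \<le> w_prod s2 s1 r2 r1 \<alpha>"
      using weight_common_parameter[OF assms r(2,1)] by blast
    then show "c \<in> (\<Union>r\<in>{0<..}. ell p (w_prod s2 s1 r r))"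
      using r(3) ell_antimono[of "w_prod s2 s1 r r" "w_prod s2 s1 r2 r1" p] by auto
  qed
qed (auto simp: ell_A_def)

lemma ell_A_star_one_parameter:
  assumes "s1 \<in> R_flat_bar" "s2 \<in> R_flat_bar" "s1 = Num 0 \<longleftrightarrow> s2 = Num 0"
  shows "(ell_A_star p s2 s1 :: (('d2::finite) midx \<times> ('d1::finite) midx \<Rightarrow> complex) set) =
    (\<Inter>r\<in>{0<..}. ell p (\<lambda>\<alpha>. 1 / w_prod s2 s1 r r \<alpha>))"
proof
  show "(\<Inter>r\<in>{0<..}. ell p (\<lambda>\<alpha>. 1 / w_prod s2 s1 r r \<alpha>))
      \<subseteq> (ell_A_star p s2 s1 :: ('d2 midx \<times> 'd1 midx \<Rightarrow> complex) set)"
  proof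
    fix c :: "'d2 midx \<times> 'd1 midx \<Rightarrow> complex"
    assume c: "c \<in> (\<Inter>r\<in>{0<..}. ell p (\<lambda>\<alpha>. 1 / w_prod s2 s1 r r \<alpha>))"
    have "c \<in> ell p (\<lambda>\<alpha>. 1 / w_prod s2 s1 r2 r1 \<alpha>)" if r: "0 < r2" "0 < r1" for r1 r2
    proof -
      obtain r where "0 < r" "\<And>\<alpha> :: 'd2 midx \<times> 'd1 midx. w_prod s2 s1 r r \<alpha> \<le> w_prod s2 s1 r2 r1 \<alpha>"
        using weight_common_parameter[OF assms r(2,1)] by blast
      moreover from this have "ell p (\<lambda>\<alpha> :: 'd2 midx \<times> 'd1 midx. 1 / w_prod s2 s1 r r \<alpha>)
          \<subseteq> ell p (\<lambda>\<alpha>. 1 / w_prod s2 s1 r2 r1 \<alpha>)"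
        by (intro ell_antimono) (simp add: divide_ennreal_def inverse_antimono_ennreal)
      ultimately show ?thesis using c by auto
    qed
    then show "c \<in> ell_A_star p s2 s1" unfolding ell_A_star_def by auto
  qed
qed (auto simp: ell_A_star_def)

lemma one_parameter_union_not_closed:
  "\<exists>c c'. c \<in> (\<Union>r\<in>{0<..}. ell top (w_prod (Num 0) (Num (1/2)) r r)) \<and>
          c' \<in> (\<Union>r\<in>{0<..}. ell top (w_prod (Num 0) (Num (1/2)) r r)) \<and>
          (\<lambda>\<alpha> :: ('d2::finite) midx \<times> ('d1::finite) midx. c \<alpha> + c' \<alpha>)
            \<notin> (\<Union>r\<in>{0<..}. ell top (w_prod (Num 0) (Num (1/2)) r r))"
proof -
  let ?w = "\<lambda>r. w_prod (Num 0) (Num (1/2)) r r :: 'd2 midx \<times> 'd1 midx \<Rightarrow> ennreal"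
  let ?U = "\<Union>r\<in>{0<..}. ell top (?w r)"
  define i2 :: 'd2 where "i2 = undefined"
  define i1 :: 'd1 where "i1 = undefined"
  define a :: "'d2 midx" where "a = (\<lambda>i. if i = i2 then 2 else 0)"
  define b :: "nat \<Rightarrow> 'd1 midx" where "b n = (\<lambda>i. if i = i1 then n else 0)" for n
  have abs: "mabs a = 2" "mabs (b n) = n" "mabs (\<lambda>_::'d2. 0) = 0" "mabs (\<lambda>_::'d1. 0) = 0" for n
    by (simp_all add: mabs_def a_def b_def)
  have a_ne: "a \<noteq> (\<lambda>_. 0)" by (auto simp: a_def fun_eq_iff)
  define c :: "'d2 midx \<times> 'd1 midx \<Rightarrow> complex"
    where "c = (\<lambda>(\<alpha>2, \<alpha>1). if \<alpha>2 = (\<lambda>_. 0) then complex_of_real (exp (- real (mabs \<alpha>1))) else 0)"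
  define c' :: "'d2 midx \<times> 'd1 midx \<Rightarrow> complex"
    where "c' = (\<lambda>(\<alpha>2, \<alpha>1). if \<alpha>2 = a \<and> \<alpha>1 = (\<lambda>_. 0) then 1 else 0)"
  have "wnorm top (?w 1) c \<le> 1"
    unfolding wnorm_def lp_norm_def
    by (auto intro!: SUP_least simp: c_def w_prod_def abs ennreal_mult[symmetric]
          simp flip: exp_add)
  then have 1: "c \<in> ?U"
    by (intro UN_I[of 1]) (auto simp: ell_def intro: le_less_trans)
  have "wnorm top (?w 2) c' \<le> 1"
    unfolding wnorm_def lp_norm_def by (auto intro!: SUP_least simp: c'_def w_prod_def abs)
  then have 2: "c' \<in> ?U"
    by (intro UN_I[of 2]) (auto simp: ell_def intro: le_less_trans)
  have "wnorm top (?w r) (\<lambda>\<alpha>. c \<alpha> + c' \<alpha>) = top" if "r > 0" for r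
  proof -
    let ?f = "\<lambda>\<alpha>. ennreal (cmod (c \<alpha> + c' \<alpha>)) * ?w r \<alpha>"
    have le: "?f \<alpha> \<le> wnorm top (?w r) (\<lambda>\<alpha>. c \<alpha> + c' \<alpha>)" for \<alpha>
      unfolding wnorm_def lp_norm_def by (auto intro: SUP_upper)
    show ?thesis
    proof (cases "r < 2")
      case True
      then have "?f (a, \<lambda>_. 0) = top"
        using a_ne by (simp add: c_def c'_def w_prod_def abs)
      then show ?thesis using le[of "(a, \<lambda>_. 0)"] by (simp add: top_unique)
    next
      case False
      have "of_nat n \<le> wnorm top (?w r) (\<lambda>\<alpha>. c \<alpha> + c' \<alpha>)" for n
      proof -
        have "real n \<le> exp (real n)" using exp_ge_add_one_self[of "real n"] by linarith
        also have "\<dots> \<le> exp (- real n) * exp (r * real n)"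
          using False mult_right_mono[of 2 r "real n"] by (simp flip: exp_add)
        finally have "of_nat n \<le> ennreal (exp (- real n) * exp (r * real n))"
          by (simp add: ennreal_leI flip: ennreal_of_nat_eq_real_of_nat)
        also have "\<dots> = ?f (\<lambda>_. 0, b n)"
          using a_ne False by (auto simp: c_def c'_def w_prod_def abs ennreal_mult)
        finally show ?thesis using le order_trans by blast
      qed
      then show ?thesis
        by (metis ennreal_Ex_less_of_nat less_top not_le)
    qed
  qed
  then have "(\<lambda>\<alpha>. c \<alpha> + c' \<alpha>) \<notin> ?U"
    by (auto simp: ell_def)
  with 1 2 show ?thesis by blast
qed

section \<open>Kernels\<close>

text \<open>A formal series in \<open>z\<^sub>2\<close> and the conjugate of \<open>z\<^sub>1\<close> is the function mapping \<open>(\<alpha>2, \<alpha>1)\<close> to its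
  coefficient at \<open>z\<^sub>2\<^sup>\<alpha>\<^sup>2 * (cnj z\<^sub>1)\<^sup>\<alpha>\<^sup>1\<close>. The space $\widehat{\mathcal A}_0'(W)$ of all
  formal series is the whole type.\<close>

type_synonym ('d2, 'd1) kernel = "'d2 midx \<times> 'd1 midx \<Rightarrow> complex"

definition coeff_K :: "('d2::finite, 'd1::finite) kernel \<Rightarrow> 'd2 midx \<times> 'd1 midx \<Rightarrow> complex"
  where "coeff_K K = (\<lambda>(\<alpha>2, \<alpha>1). complex_of_real (sqrt (mfact \<alpha>2) * sqrt (mfact \<alpha>1)) * K (\<alpha>2, \<alpha>1))"

definition Ahat :: "ennreal \<Rightarrow> flat_index \<Rightarrow> flat_index \<Rightarrow> ('d2::finite, 'd1::finite) kernel set"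
  where "Ahat p s2 s1 = {K. coeff_K K \<in> ell_A p s2 s1}"

definition Ahat' :: "ennreal \<Rightarrow> flat_index \<Rightarrow> flat_index \<Rightarrow> ('d2::finite, 'd1::finite) kernel set"
  where "Ahat' p s2 s1 = {K. coeff_K K \<in> ell_A_star p s2 s1}"

definition Bhat :: "ennreal \<Rightarrow> flat_index \<Rightarrow> flat_index \<Rightarrow> ('d2::finite, 'd1::finite) kernel set"
  where "Bhat p s2 s1 = {K. coeff_K K \<in> ell_B p s2 s1}"

definition Bhat_star :: "ennreal \<Rightarrow> flat_index \<Rightarrow> flat_index \<Rightarrow> ('d2::finite, 'd1::finite) kernel set"
  where "Bhat_star p s2 s1 = {K. coeff_K K \<in> ell_B_star p s2 s1}"

definition Ahat0 :: "ennreal \<Rightarrow> flat_index \<Rightarrow> flat_index \<Rightarrow> ('d2::finite, 'd1::finite) kernel set"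
  where "Ahat0 p s2 s1 = {K. coeff_K K \<in> ell_A0 p s2 s1}"

definition Ahat0' :: "ennreal \<Rightarrow> flat_index \<Rightarrow> flat_index \<Rightarrow> ('d2::finite, 'd1::finite) kernel set"
  where "Ahat0' p s2 s1 = {K. coeff_K K \<in> ell_A0_star p s2 s1}"

definition Bhat0 :: "ennreal \<Rightarrow> flat_index \<Rightarrow> flat_index \<Rightarrow> ('d2::finite, 'd1::finite) kernel set"
  where "Bhat0 p s2 s1 = {K. coeff_K K \<in> ell_B0 p s2 s1}"

definition Bhat0_star :: "ennreal \<Rightarrow> flat_index \<Rightarrow> flat_index \<Rightarrow> ('d2::finite, 'd1::finite) kernel set"
  where "Bhat0_star p s2 s1 = {K. coeff_K K \<in> ell_B0_star p s2 s1}"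

section \<open>Kernel operators\<close>

text \<open>Meaningful for \<open>F\<close> in \<open>A_s p (Num 0)\<close>, where the inner sum is finite.\<close>

definition T_op :: "('d2::finite, 'd1::finite) kernel \<Rightarrow> 'd1 fser \<Rightarrow> 'd2 fser"
  where "T_op K F = series_e (\<lambda>\<alpha>2. \<Sum>\<^sub>\<infinity>\<alpha>1. coeff_K K (\<alpha>2, \<alpha>1) * coeff_e F \<alpha>1)"

text \<open>Linear maps on a subspace of \<open>'i \<Rightarrow> complex\<close> are made unique as HOL functions by requiring
  the value \<open>undefined\<close> outside of that subspace.\<close>

definition lin_comb :: "complex \<Rightarrow> ('i \<Rightarrow> complex) \<Rightarrow> complex \<Rightarrow> ('i \<Rightarrow> complex) \<Rightarrow> 'i \<Rightarrow> complex"
  where "lin_comb a x b y = (\<lambda>i. a * x i + b * y i)"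

definition CL :: "('i \<Rightarrow> complex) topology \<Rightarrow> ('j \<Rightarrow> complex) topology \<Rightarrow>
    (('i \<Rightarrow> complex) \<Rightarrow> ('j \<Rightarrow> complex)) set"
  where "CL V1 V2 = {T. T \<in> extensional (topspace V1) \<and> continuous_map V1 V2 T \<and>
    (\<forall>x\<in>topspace V1. \<forall>y\<in>topspace V1. \<forall>a b. T (lin_comb a x b y) = lin_comb a (T x) b (T y))}"

text \<open>If \<open>V1\<close> contains the polynomials, agreement on the intersection means that \<open>T\<close> extends \<open>T_op K\<close>.
  The only other case is \<open>V1 = {0}\<close>, that is \<open>A_0s p (Num 0)\<close> or \<open>A_0s' p (Num 0)\<close>.\<close>

definition is_ext :: "ennreal \<Rightarrow> ('d1::finite) fser topology \<Rightarrow> ('d2::finite) fser topology \<Rightarrow>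
    ('d2, 'd1) kernel \<Rightarrow> ('d1 fser \<Rightarrow> 'd2 fser) \<Rightarrow> bool"
  where "is_ext p V1 V2 K T \<longleftrightarrow>
    T \<in> CL V1 V2 \<and> (\<forall>F \<in> topspace (A_s p (Num 0)) \<inter> topspace V1. T F = T_op K F)"

definition T_ext :: "ennreal \<Rightarrow> ('d1::finite) fser topology \<Rightarrow> ('d2::finite) fser topology \<Rightarrow>
    ('d2, 'd1) kernel \<Rightarrow> 'd1 fser \<Rightarrow> 'd2 fser"
  where "T_ext p V1 V2 K = (THE T. is_ext p V1 V2 K T)"

text \<open>\<open>K \<mapsto> T\<^sub>K\<close> is well defined as a map into \<open>CL V1 V2\<close>, linear, and bijective.\<close>

definition kernel_iso :: "ennreal \<Rightarrow> ('d2::finite, 'd1::finite) kernel set \<Rightarrow>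
    'd1 fser topology \<Rightarrow> 'd2 fser topology \<Rightarrow> bool"
  where "kernel_iso p S V1 V2 \<longleftrightarrow>
    (\<forall>K\<in>S. \<exists>!T. is_ext p V1 V2 K T) \<and>
    (\<forall>K\<in>S. \<forall>L\<in>S. \<forall>a b. lin_comb a K b L \<in> S \<and>
       (\<forall>F\<in>topspace V1. T_ext p V1 V2 (lin_comb a K b L) F =
          lin_comb a (T_ext p V1 V2 K F) b (T_ext p V1 V2 L F))) \<and>
    bij_betw (T_ext p V1 V2) S (CL V1 V2)"

end

theory Submission
  imports Defs "HOL-Real_Asymp.Real_Asymp"
begin

text \<open>Passing to reciprocal weights, every space in question is the inductive limit
  $\bigcup_k \{x : |x| \le C u_k\}$ or the dual projective limit
  $\bigcap_k \{x : |x| u_k \le C_k\}$ for an increasing sequence $u_k$ of nonnegative functions such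
  that $u_k \le \lambda_k u_{k+1}$ with $\lambda_k$ summable to any power. This makes
  the limits independent of $p$, lets one sum a matrix against a vector, and shows that the tails of
  every element tend to zero, so that a continuous linear map is determined by its matrix. A matrix
  bound is read off from continuity by testing with multiples of unit vectors. For a map into an
  inductive limit one must in addition see that bounded sets end up in one step: otherwise there are
  vectors $x_n$ tending to zero and coordinates $j_n$ where $T x_n$ exceeds the weight $v_n$, and
  $\{y : |y_{j_n}| < |(T x_n)_{j_n}| \mbox{ for all } n\}$ is a zero neighbourhood that contains no $T x_n$.\<close>

section \<open>Vector topologies given by a base of zero neighbourhoods\<close>

text \<open>The reciprocals \<open>u\<close> are used because an infinite weight then becomes the
  real number 0: the index 0, where \<open>weight\<close> takes the value infinity, is no exception
  as long as the estimates do not divide by \<open>u\<close>. The second gain is orientation. For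
  \<open>s = 0\<close> the steps of the inductive limit grow with \<open>r\<close>, for all other
  indices they shrink; indexed by \<open>k\<close> they always grow, so a common \<open>k\<close>
  can replace two parameters. The eight rows reduce to four matrix classes, one for each choice of
  inductive or projective limit as domain and as target: the spaces with subscript 0 are the same
  two constructions with the reciprocal weights, the two kinds of limit trading places. Only their
  members at index 0, which are {0} and contain no unit vector, need a separate argument.
  Quantitatively everything rests on one device: passing from \<open>u k\<close> to
  \<open>u (Suc k)\<close> gains a summable factor, and the limits do not notice the lost
  step.\<close>

locale lin_space =
  fixes X :: "('i \<Rightarrow> complex) topology" and E :: "('i \<Rightarrow> complex) set"
    and N :: "('i \<Rightarrow> complex) set \<Rightarrow> bool"
  assumes openin_iff:
      "openin X U \<longleftrightarrow> U \<subseteq> E \<and> (\<forall>x\<in>U. \<exists>V. N V \<and> (\<forall>v\<in>V. (\<lambda>i. x i + v i) \<in> U))"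
    and lin_comb_mem: "x \<in> E \<Longrightarrow> y \<in> E \<Longrightarrow> lin_comb a x b y \<in> E"
    and zero_mem: "(\<lambda>_. 0) \<in> E"
    and nbhd_sub: "N V \<Longrightarrow> V \<subseteq> E"
    and nbhd_zero: "N V \<Longrightarrow> (\<lambda>_. 0) \<in> V"
    and nbhd_ex: "\<exists>V. N V"
    and nbhd_half: "N V \<Longrightarrow> \<exists>W. N W \<and> (\<forall>x\<in>W. \<forall>y\<in>W. (\<lambda>i. x i + y i) \<in> V)"
begin

lemma add_mem: "x \<in> E \<Longrightarrow> y \<in> E \<Longrightarrow> (\<lambda>i. x i + y i) \<in> E"
  using lin_comb_mem[of x y 1 1] by (simp add: lin_comb_def)

lemma topspace_eq: "topspace X = E"
proof
  have "openin X E"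
    unfolding openin_iff using nbhd_ex nbhd_sub add_mem by blast
  then show "E \<subseteq> topspace X" by (rule openin_subset)
  show "topspace X \<subseteq> E" using openin_iff[of "topspace X"] by simp
qed

text \<open>Members of \<open>N\<close> need not be open. The set \<open>U\<close> of points with a
  whole translated neighbourhood inside \<open>V\<close> is open because \<open>nbhd_half\<close>
  lets such a translate absorb a second small step.\<close>

lemma nbhd_contains_open:
  assumes "N V"
  obtains U where "openin X U" "(\<lambda>_. 0) \<in> U" "U \<subseteq> V"
proof
  define U where "U = {x\<in>E. \<exists>W. N W \<and> (\<forall>w\<in>W. (\<lambda>i. x i + w i) \<in> V)}"
  show "(\<lambda>_. 0) \<in> U"
    using assms zero_mem by (auto simp: U_def)
  show "U \<subseteq> V"
  proof
    fix x assume "x \<in> U"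
    then obtain W where W: "N W" "\<forall>w\<in>W. (\<lambda>i. x i + w i) \<in> V" by (auto simp: U_def)
    show "x \<in> V" using W(2)[rule_format, OF nbhd_zero[OF W(1)]] by simp
  qed
  show "openin X U"
    unfolding openin_iff
  proof (intro conjI ballI)
    show "U \<subseteq> E" by (auto simp: U_def)
    fix x assume x: "x \<in> U"
    then obtain W where W: "N W" "\<forall>w\<in>W. (\<lambda>i. x i + w i) \<in> V" by (auto simp: U_def)
    obtain W' where W': "N W'" "\<forall>a\<in>W'. \<forall>b\<in>W'. (\<lambda>i. a i + b i) \<in> W"
      using nbhd_half[OF W(1)] by blast
    have "(\<lambda>i. x i + a i) \<in> U" if a: "a \<in> W'" for a
    proof -
      have "(\<lambda>i. x i + a i) \<in> E"
        using x a nbhd_sub[OF W'(1)] by (auto simp: U_def intro: add_mem)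
      moreover have "(\<lambda>i. x i + a i + b i) \<in> V" if "b \<in> W'" for b
        using W(2)[rule_format, OF W'(2)[rule_format, OF a that]] by (simp add: add.assoc)
      ultimately show ?thesis using W'(1) by (auto simp: U_def)
    qed
    then show "\<exists>W. N W \<and> (\<forall>v\<in>W. (\<lambda>i. x i + v i) \<in> U)" using W'(1) by blast
  qed
qed

end

definition linear_on :: "('i \<Rightarrow> complex) set \<Rightarrow> (('i \<Rightarrow> complex) \<Rightarrow> ('j \<Rightarrow> complex)) \<Rightarrow> bool"
  where "linear_on E T \<longleftrightarrow>
    (\<forall>x\<in>E. \<forall>y\<in>E. \<forall>a b. T (lin_comb a x b y) = lin_comb a (T x) b (T y))"

lemma linear_onD:
  "linear_on E T \<Longrightarrow> x \<in> E \<Longrightarrow> y \<in> E \<Longrightarrow> T (lin_comb a x b y) = lin_comb a (T x) b (T y)"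
  by (simp add: linear_on_def)

lemma linear_on_scale:
  assumes "linear_on E T" "x \<in> E"
  shows "T (\<lambda>i. a * x i) = (\<lambda>j. a * T x j)"
  using linear_onD[OF assms assms(2), of a 0] by (simp add: lin_comb_def)

lemma linear_on_zero: "linear_on E T \<Longrightarrow> x \<in> E \<Longrightarrow> T (\<lambda>_. 0) = (\<lambda>_. 0)"
  using linear_on_scale[of E T x 0] by simp

lemma linear_on_add:
  assumes "linear_on E T" "x \<in> E" "y \<in> E"
  shows "T (\<lambda>i. x i + y i) = (\<lambda>j. T x j + T y j)"
  using linear_onD[OF assms, of 1 1] by (simp add: lin_comb_def)

lemma linear_on_diff:
  assumes "linear_on E T" "x \<in> E" "y \<in> E"
  shows "T (\<lambda>i. x i - y i) = (\<lambda>j. T x j - T y j)"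
  using linear_onD[OF assms, of 1 "-1"] by (simp add: lin_comb_def)

text \<open>Linearity moves every point to zero. The criterion speaks of \<open>N1\<close> and
  \<open>N2\<close> only, so that later proofs of continuity work with neighbourhood bases instead
  of open sets.\<close>

lemma continuous_linear_iff:
  assumes "lin_space X1 E1 N1" "lin_space X2 E2 N2" and T: "linear_on E1 T"
  shows "continuous_map X1 X2 T \<longleftrightarrow> T ` E1 \<subseteq> E2 \<and> (\<forall>W. N2 W \<longrightarrow> (\<exists>V. N1 V \<and> T ` V \<subseteq> W))"
proof -
  interpret X1: lin_space X1 E1 N1 by fact
  interpret X2: lin_space X2 E2 N2 by fact
  show ?thesis
  proof (intro iffI conjI allI impI)
    assume c: "continuous_map X1 X2 T"
    then show "T ` E1 \<subseteq> E2"
      by (auto simp: continuous_map_def X1.topspace_eq X2.topspace_eq)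
    fix W assume "N2 W"
    then obtain U where U: "openin X2 U" "(\<lambda>_. 0) \<in> U" "U \<subseteq> W"
      by (rule X2.nbhd_contains_open)
    have "openin X1 {x \<in> E1. T x \<in> U}"
      using c U(1) by (simp add: continuous_map_def X1.topspace_eq)
    moreover have "(\<lambda>_. 0) \<in> {x \<in> E1. T x \<in> U}"
      using U(2) X1.zero_mem linear_on_zero[OF T X1.zero_mem] by simp
    ultimately obtain V where "N1 V" "\<forall>v\<in>V. (\<lambda>i. 0 + v i) \<in> {x \<in> E1. T x \<in> U}"
      unfolding X1.openin_iff by blast
    then show "\<exists>V. N1 V \<and> T ` V \<subseteq> W" using U(3) by auto
  next
    assume R: "T ` E1 \<subseteq> E2 \<and> (\<forall>W. N2 W \<longrightarrow> (\<exists>V. N1 V \<and> T ` V \<subseteq> W))"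
    have "openin X1 {x \<in> E1. T x \<in> U}" if U: "openin X2 U" for U
      unfolding X1.openin_iff
    proof (intro conjI ballI)
      fix x assume x: "x \<in> {x \<in> E1. T x \<in> U}"
      then obtain W where W: "N2 W" "\<forall>w\<in>W. (\<lambda>i. T x i + w i) \<in> U"
        using U unfolding X2.openin_iff by blast
      obtain V where V: "N1 V" "T ` V \<subseteq> W" using R W(1) by blast
      have "(\<lambda>i. x i + v i) \<in> {x \<in> E1. T x \<in> U}" if v: "v \<in> V" for v
      proof -
        have vE: "v \<in> E1" using v X1.nbhd_sub[OF V(1)] by blast
        have "T (\<lambda>i. x i + v i) = (\<lambda>j. T x j + T v j)"
          using T x vE by (intro linear_on_add) auto
        then show ?thesis using W(2) V(2) v vE x X1.add_mem by auto
      qed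
      then show "\<exists>V. N1 V \<and> (\<forall>v\<in>V. (\<lambda>i. x i + v i) \<in> {x \<in> E1. T x \<in> U})"
        using V(1) by blast
    qed auto
    then show "continuous_map X1 X2 T"
      using R by (auto simp: continuous_map_def X1.topspace_eq X2.topspace_eq)
  qed
qed

section \<open>Comparison of the \<open>p\<close>-norms with the supremum norm\<close>

text \<open>A nonnegative sequence that is summable to the power 1 is bounded, which is what
  \<open>p = top\<close> asks for; thus one positive exponent covers every \<open>p\<close>.\<close>

definition summation_exponent :: "ennreal \<Rightarrow> real"
  where "summation_exponent p = (if p = top then 1 else enn2real p)"

lemma summation_exponent_pos: "0 < p \<Longrightarrow> 0 < summation_exponent p"
  by (auto simp: summation_exponent_def enn2real_positive_iff less_top)

lemma epowr_inverse: "a > 0 \<Longrightarrow> epowr (epowr x a) (1 / a) = x"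
  by (cases x) (auto simp: epowr_def powr_powr)

text \<open>Half of the independence of \<open>p\<close>: a single term is dominated by the whole
  sum or supremum, also where the weight is infinite.\<close>

lemma wnorm_ge_coordinate:
  assumes "0 < p"
  shows "ennreal (cmod (c i)) * \<omega> i \<le> wnorm p \<omega> c"
proof (cases "p = top")
  case True
  then show ?thesis unfolding wnorm_def lp_norm_def by (auto intro: SUP_upper)
next
  case False
  define q where "q = enn2real p"
  have q: "q > 0" using assms False by (auto simp: q_def enn2real_positive_iff less_top)
  have "epowr (ennreal (cmod (c i)) * \<omega> i) q
      \<le> (\<integral>\<^sup>+ i. epowr (ennreal (cmod (c i)) * \<omega> i) q \<partial>count_space UNIV)"
    by (rule nn_integral_ge_point) simp
  then have "epowr (epowr (ennreal (cmod (c i)) * \<omega> i) q) (1 / q)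
      \<le> epowr (\<integral>\<^sup>+ i. epowr (ennreal (cmod (c i)) * \<omega> i) q \<partial>count_space UNIV) (1 / q)"
    using q by (intro epowr_mono) auto
  then show ?thesis
    using False q by (simp add: wnorm_def lp_norm_def q_def[symmetric] epowr_inverse)
qed

text \<open>The other half of the independence of \<open>p\<close>. \<open>K\<close> depends on
  \<open>l\<close> and \<open>p\<close> only, not on the weight or on \<open>c\<close>; this
  uniformity turns coordinate balls into subsets of norm balls.\<close>

lemma wnorm_le_summable_majorant:
  assumes "0 < p" and nonneg: "\<And>i. 0 \<le> l i"
    and summ: "(\<lambda>i. l i powr summation_exponent p) summable_on UNIV"
  obtains K :: real where "K > 0"
    "\<And>M \<omega> c. 0 \<le> M \<Longrightarrow> (\<And>i. ennreal (cmod (c i)) * \<omega> i \<le> ennreal (M * l i))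
       \<Longrightarrow> wnorm p \<omega> c \<le> ennreal (M * K)"
proof (cases "p = top")
  case True
  \<comment> \<open>The sum bounds every single \<open>l i\<close>; adding 1 keeps \<open>K\<close>
    positive also when \<open>l\<close> vanishes.\<close>
  define K where "K = (\<Sum>\<^sub>\<infinity>i. l i) + 1"
  have s: "l summable_on UNIV"
    using summ nonneg True by (simp add: summation_exponent_def)
  have l: "l i \<le> K" for i
    using finite_sum_le_infsum[OF s, of "{i}"] nonneg by (simp add: K_def)
  show ?thesis
  proof
    show "K > 0" using infsum_nonneg[of UNIV l] nonneg by (simp add: K_def add_nonneg_pos)
    fix M \<omega> and c :: "'a \<Rightarrow> complex"
    assume M: "0 \<le> M" and c: "\<And>i. ennreal (cmod (c i)) * \<omega> i \<le> ennreal (M * l i)"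
    have "ennreal (cmod (c i)) * \<omega> i \<le> ennreal (M * K)" for i
      using c[of i] by (rule order_trans) (intro ennreal_leI mult_left_mono l M)
    then show "wnorm p \<omega> c \<le> ennreal (M * K)"
      unfolding wnorm_def lp_norm_def using True by (auto intro: SUP_least)
  qed
next
  case False
  define q where "q = enn2real p"
  have q: "q > 0" using assms(1) False by (auto simp: q_def enn2real_positive_iff less_top)
  have s: "(\<lambda>i. l i powr q) summable_on UNIV"
    using summ False by (simp add: summation_exponent_def q_def)
  define S where "S = infsetsum (\<lambda>i. l i powr q) UNIV"
  have S: "(\<integral>\<^sup>+ i. ennreal (l i powr q) \<partial>count_space UNIV) = ennreal S"
    unfolding S_def
    using s by (intro nn_integral_conv_infsetsum)
      (auto simp flip: abs_summable_equivalent intro: summable_on_cong[THEN iffD1, rotated])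
  have S0: "0 \<le> S" unfolding S_def by (intro infsetsum_nonneg) simp
  show ?thesis
  proof
    show "(S + 1) powr (1 / q) > 0" using S0 by simp
    fix M \<omega> and c :: "'a \<Rightarrow> complex"
    assume M: "0 \<le> M" and c: "\<And>i. ennreal (cmod (c i)) * \<omega> i \<le> ennreal (M * l i)"
    have "(\<integral>\<^sup>+ i. epowr (ennreal (cmod (c i)) * \<omega> i) q \<partial>count_space UNIV)
        \<le> (\<integral>\<^sup>+ i. ennreal (M powr q) * ennreal (l i powr q) \<partial>count_space UNIV)"
    proof (rule nn_integral_mono)
      fix i
      have "epowr (ennreal (cmod (c i)) * \<omega> i) q \<le> epowr (ennreal (M * l i)) q"
        using c q by (intro epowr_mono) auto
      also have "\<dots> = ennreal (M powr q) * ennreal (l i powr q)"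
        using M nonneg[of i] by (simp add: epowr_def powr_mult flip: ennreal_mult)
      finally show "epowr (ennreal (cmod (c i)) * \<omega> i) q \<le> ennreal (M powr q) * ennreal (l i powr q)" .
    qed
    also have "\<dots> = ennreal (M powr q) * ennreal S"
      by (subst nn_integral_cmult) (simp_all add: S)
    also have "\<dots> \<le> ennreal (M powr q * (S + 1))"
      using S0 by (simp add: ennreal_mult[symmetric] ennreal_leI mult_left_mono)
    finally have "wnorm p \<omega> c \<le> epowr (ennreal (M powr q * (S + 1))) (1 / q)"
      using False q by (simp add: wnorm_def lp_norm_def q_def[symmetric] epowr_mono)
    also have "\<dots> = ennreal (M * (S + 1) powr (1 / q))"
      using q M S0 by (simp add: epowr_def powr_mult powr_powr)
    finally show "wnorm p \<omega> c \<le> ennreal (M * (S + 1) powr (1 / q))" .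
  qed
qed

section \<open>Inductive and projective limits of a nuclear weight family\<close>

text \<open>All weight families below are encoded by real functions \<open>u k\<close>, increasing in \<open>k\<close>, such that
  \<open>1 / u k\<close> (with \<open>1 / 0 = \<infinity>\<close>) are the weights of an inductive limit and \<open>u k\<close> those of its dual
  projective limit.\<close>

locale increasing_weights =
  fixes u :: "nat \<Rightarrow> 'i \<Rightarrow> real"
  assumes nonneg: "0 \<le> u k i"
    and incr: "u k i \<le> u (Suc k) i"

text \<open>Nuclearity is required for every exponent \<open>q\<close> because \<open>p\<close> may
  be smaller than 1, and in product form because \<open>u\<close> may vanish. \<open>ex_pos\<close>
  puts the unit vectors into the inductive limit and makes coordinates continuous on the projective
  one.\<close>

locale weight_family = increasing_weights u for u :: "nat \<Rightarrow> 'i \<Rightarrow> real" +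
  assumes ex_pos: "\<exists>k. u k i > 0"
    and nuclear: "q > 0 \<Longrightarrow> \<exists>l. (\<forall>i. 0 \<le> l i) \<and> (\<lambda>i. l i powr q) summable_on UNIV \<and>
      (\<forall>i. u k i \<le> l i * u (Suc k) i)"

definition ind_space :: "(nat \<Rightarrow> 'i \<Rightarrow> real) \<Rightarrow> ('i \<Rightarrow> complex) set"
  where "ind_space u = {x. \<exists>k C. \<forall>i. cmod (x i) \<le> C * u k i}"

definition proj_space :: "(nat \<Rightarrow> 'i \<Rightarrow> real) \<Rightarrow> ('i \<Rightarrow> complex) set"
  where "proj_space u = {x. \<forall>k. \<exists>C. \<forall>i. cmod (x i) * u k i \<le> C}"

definition ind_nbhd :: "(nat \<Rightarrow> 'i \<Rightarrow> real) \<Rightarrow> ('i \<Rightarrow> complex) set \<Rightarrow> bool"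
  where "ind_nbhd u V \<longleftrightarrow> V \<subseteq> ind_space u \<and> abs_convex V \<and>
    (\<forall>k. \<exists>\<epsilon>>0. \<forall>x. (\<forall>i. cmod (x i) \<le> \<epsilon> * u k i) \<longrightarrow> x \<in> V)"

definition proj_nbhd :: "(nat \<Rightarrow> 'i \<Rightarrow> real) \<Rightarrow> ('i \<Rightarrow> complex) set \<Rightarrow> bool"
  where "proj_nbhd u V \<longleftrightarrow>
    (\<exists>k. \<exists>\<epsilon>>0. V = {x \<in> proj_space u. \<forall>i. cmod (x i) * u k i \<le> \<epsilon>})"

text \<open>Mutual cofinality of the weights \<open>\<omega> r\<close> and \<open>1 / u k\<close>.
  Since reciprocals reverse both inequalities, the same relation serves the inductive limit with
  weights \<open>\<omega> r\<close> and the projective limit with weights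
  \<open>1 / \<omega> r\<close>.\<close>

definition represents :: "(real \<Rightarrow> 'i \<Rightarrow> ennreal) \<Rightarrow> (nat \<Rightarrow> 'i \<Rightarrow> real) \<Rightarrow> bool"
  where "represents \<omega> u \<longleftrightarrow>
    (\<forall>k. \<exists>r>0. \<forall>i. \<omega> r i \<le> inverse (ennreal (u k i))) \<and>
    (\<forall>r>0. \<exists>k. \<forall>i. inverse (ennreal (u k i)) \<le> \<omega> r i)"

text \<open>At \<open>z = 0\<close> the left side contains the factor infinity, and by
  \<open>infinity * 0 = 0\<close> it is finite exactly when \<open>x * y = 0\<close>, which is what
  the product form says. This is how zeros of \<open>u\<close> are absorbed in the estimates
  below.\<close>

lemma ennreal_ratio_le_iff:
  assumes "0 \<le> x" "0 \<le> y" "0 \<le> z" "0 \<le> M"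
  shows "ennreal x * (inverse (ennreal z) * ennreal y) \<le> ennreal M \<longleftrightarrow> x * y \<le> M * z"
proof (cases "z = 0")
  case True
  then show ?thesis using assms
    by (cases "x = 0"; cases "y = 0")
       (auto simp: ennreal_top_mult ennreal_mult_top top_unique mult_le_0_iff)
next
  case False
  then have "ennreal x * (inverse (ennreal z) * ennreal y) = ennreal (x * y / z)"
    using assms by (simp add: inverse_ennreal divide_inverse mult_ac flip: ennreal_mult)
  then show ?thesis using assms False by (simp add: divide_le_eq)
qed

lemma ennreal_inverse_le_iff:
  assumes "0 \<le> x" "0 \<le> z" "0 \<le> M"
  shows "ennreal x * inverse (ennreal z) \<le> ennreal M \<longleftrightarrow> x \<le> M * z"
  using ennreal_ratio_le_iff[of x 1 z M] assms by simp

lemma ennreal_inverse_inverse: "inverse (inverse x) = (x::ennreal)"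
proof (cases x)
  case (real r)
  then show ?thesis by (cases "r = 0") (auto simp: inverse_ennreal)
qed simp

lemma abs_convexD:
  "abs_convex V \<Longrightarrow> x \<in> V \<Longrightarrow> y \<in> V \<Longrightarrow> cmod a + cmod b \<le> 1 \<Longrightarrow> (\<lambda>i. a * x i + b * y i) \<in> V"
  by (auto simp: abs_convex_def)

context increasing_weights
begin

lemma mono: "k \<le> l \<Longrightarrow> u k i \<le> u l i"
  by (induction rule: dec_induct) (auto intro: order_trans incr)

lemma ind_space_nonnegE:
  assumes "x \<in> ind_space u"
  obtains k C where "0 \<le> C" "\<And>i. cmod (x i) \<le> C * u k i"
proof -
  obtain k C where C: "\<And>i. cmod (x i) \<le> C * u k i"
    using assms by (auto simp: ind_space_def)
  have "cmod (x i) \<le> max C 0 * u k i" for i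
    by (rule order_trans[OF C]) (intro mult_right_mono nonneg, simp)
  then show ?thesis by (rule that[rotated]) simp
qed

lemma proj_spaceE:
  assumes "x \<in> proj_space u"
  obtains C where "0 \<le> C" "\<And>i. cmod (x i) * u k i \<le> C"
proof -
  obtain C where C: "\<And>i. cmod (x i) * u k i \<le> C"
    using assms unfolding proj_space_def by blast
  \<comment> \<open>Any index will do: the bound at one coordinate already shows that
    \<open>C\<close> is nonnegative.\<close>
  have "0 \<le> C" using order_trans[OF _ C[of undefined]] nonneg by simp
  then show ?thesis using C that by blast
qed

lemma lin_comb_ind_space:
  assumes "x \<in> ind_space u" "y \<in> ind_space u"
  shows "lin_comb a x b y \<in> ind_space u"
proof -
  obtain k C where C: "0 \<le> C" "\<And>i. cmod (x i) \<le> C * u k i"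
    using assms(1) by (rule ind_space_nonnegE) blast
  obtain l D where D: "0 \<le> D" "\<And>i. cmod (y i) \<le> D * u l i"
    using assms(2) by (rule ind_space_nonnegE) blast
  define m where "m = max k l"
  have "cmod (lin_comb a x b y i) \<le> (cmod a * C + cmod b * D) * u m i" for i
  proof -
    have "C * u k i \<le> C * u m i" "D * u l i \<le> D * u m i"
      using C(1) D(1) by (auto intro!: mult_left_mono mono simp: m_def)
    then have "cmod (x i) \<le> C * u m i" "cmod (y i) \<le> D * u m i"
      using C(2)[of i] D(2)[of i] by linarith+
    then have "cmod a * cmod (x i) + cmod b * cmod (y i) \<le> cmod a * (C * u m i) + cmod b * (D * u m i)"
      by (intro add_mono mult_left_mono) auto
    moreover have "cmod (lin_comb a x b y i) \<le> cmod a * cmod (x i) + cmod b * cmod (y i)"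
      unfolding lin_comb_def by (rule order_trans[OF norm_triangle_ineq]) (simp add: norm_mult)
    ultimately show ?thesis by (simp add: algebra_simps)
  qed
  then show ?thesis unfolding ind_space_def by blast
qed

lemma lin_comb_proj_space:
  assumes "x \<in> proj_space u" "y \<in> proj_space u"
  shows "lin_comb a x b y \<in> proj_space u"
  unfolding proj_space_def
proof (intro CollectI allI)
  fix k
  obtain C where C: "0 \<le> C" "\<And>i. cmod (x i) * u k i \<le> C"
    using assms(1) by (rule proj_spaceE) blast
  obtain D where D: "0 \<le> D" "\<And>i. cmod (y i) * u k i \<le> D"
    using assms(2) by (rule proj_spaceE) blast
  have "cmod (lin_comb a x b y i) * u k i \<le> cmod a * C + cmod b * D" for i
  proof -
    have "cmod (lin_comb a x b y i) \<le> cmod a * cmod (x i) + cmod b * cmod (y i)"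
      unfolding lin_comb_def by (rule order_trans[OF norm_triangle_ineq]) (simp add: norm_mult)
    then have "cmod (lin_comb a x b y i) * u k i
        \<le> (cmod a * cmod (x i) + cmod b * cmod (y i)) * u k i"
      using nonneg by (rule mult_right_mono)
    also have "\<dots> = cmod a * (cmod (x i) * u k i) + cmod b * (cmod (y i) * u k i)"
      by (simp add: algebra_simps)
    also have "\<dots> \<le> cmod a * C + cmod b * D"
      by (intro add_mono mult_left_mono C D) auto
    finally show ?thesis .
  qed
  then show "\<exists>C. \<forall>i. cmod (lin_comb a x b y i) * u k i \<le> C" by blast
qed

lemma zero_ind_space: "(\<lambda>_. 0) \<in> ind_space u"
  unfolding ind_space_def by (intro CollectI exI[of _ 0]) simp

lemma zero_proj_space: "(\<lambda>_. 0) \<in> proj_space u"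
  unfolding proj_space_def by auto

end

section \<open>Inductive limits: independence of the exponent, zero neighbourhoods\<close>

context weight_family
begin

lemma wnorm_ind_step:
  assumes "represents \<omega> u" "0 < p" "0 < r"
  obtains k where
    "\<And>x \<epsilon>. 0 \<le> \<epsilon> \<Longrightarrow> wnorm p (\<omega> r) x \<le> ennreal \<epsilon> \<Longrightarrow> \<forall>i. cmod (x i) \<le> \<epsilon> * u k i"
proof -
  obtain k where k: "\<And>i. inverse (ennreal (u k i)) \<le> \<omega> r i"
    using assms unfolding represents_def by blast
  show ?thesis
  proof (rule that, intro allI)
    fix x :: "'i \<Rightarrow> complex" and \<epsilon> :: real and i
    assume e: "0 \<le> \<epsilon>" "wnorm p (\<omega> r) x \<le> ennreal \<epsilon>"
    have "ennreal (cmod (x i)) * inverse (ennreal (u k i)) \<le> ennreal (cmod (x i)) * \<omega> r i"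
      by (intro mult_left_mono k) simp
    also have "\<dots> \<le> ennreal \<epsilon>"
      using wnorm_ge_coordinate[OF assms(2)] e(2) by (rule order_trans)
    finally show "cmod (x i) \<le> \<epsilon> * u k i"
      using e(1) nonneg by (subst (asm) ennreal_inverse_le_iff) auto
  qed
qed

text \<open>Returning from the supremum to the \<open>p\<close>-norm costs one step:
  \<open>u k \<le> l * u (Suc k)\<close> supplies a majorant that is summable to the required power.
  In a limit over \<open>k\<close> this loss is invisible.\<close>

lemma ind_step_wnorm:
  assumes "represents \<omega> u" "0 < p"
  obtains r K where "0 < r" "0 < K"
    "\<And>x M. 0 \<le> M \<Longrightarrow> (\<And>i. cmod (x i) \<le> M * u k i) \<Longrightarrow> wnorm p (\<omega> r) x \<le> ennreal (M * K)"
proof -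
  obtain l where l: "\<And>i. 0 \<le> l i" "(\<lambda>i. l i powr summation_exponent p) summable_on UNIV"
      "\<And>i. u k i \<le> l i * u (Suc k) i"
    using nuclear[OF summation_exponent_pos[OF assms(2)], of k] by blast
  obtain K where K: "K > 0"
    "\<And>M \<omega> c. 0 \<le> M \<Longrightarrow> (\<And>i. ennreal (cmod (c i)) * \<omega> i \<le> ennreal (M * l i))
       \<Longrightarrow> wnorm p \<omega> c \<le> ennreal (M * K)"
    using wnorm_le_summable_majorant[OF assms(2) l(1,2)] by blast
  obtain r where r: "r > 0" "\<And>i. \<omega> r i \<le> inverse (ennreal (u (Suc k) i))"
    using assms(1) unfolding represents_def by blast
  show ?thesis
  proof (rule that[OF r(1) K(1)], rule K(2))
    fix x :: "'i \<Rightarrow> complex" and M :: real and i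
    assume M: "0 \<le> M" and x: "\<And>i. cmod (x i) \<le> M * u k i"
    have "cmod (x i) \<le> M * (l i * u (Suc k) i)"
      by (rule order_trans[OF x]) (intro mult_left_mono l M)
    then have "ennreal (cmod (x i)) * inverse (ennreal (u (Suc k) i)) \<le> ennreal (M * l i)"
      using M l(1) nonneg by (subst ennreal_inverse_le_iff) (auto simp: mult_ac)
    moreover have "ennreal (cmod (x i)) * \<omega> r i \<le> ennreal (cmod (x i)) * inverse (ennreal (u (Suc k) i))"
      by (intro mult_left_mono r) simp
    ultimately show "ennreal (cmod (x i)) * \<omega> r i \<le> ennreal (M * l i)" by (rule order_trans[rotated])
  qed
qed

lemma Union_ell_eq_ind_space:
  assumes "represents \<omega> u" "0 < p"
  shows "(\<Union>r\<in>{0<..}. ell p (\<omega> r)) = ind_space u"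
proof (intro equalityI subsetI)
  fix x assume "x \<in> (\<Union>r\<in>{0<..}. ell p (\<omega> r))"
  then obtain r where r: "r > 0" "wnorm p (\<omega> r) x < top" by (auto simp: ell_def)
  obtain k where k: "\<And>x \<epsilon>. 0 \<le> \<epsilon> \<Longrightarrow> wnorm p (\<omega> r) x \<le> ennreal \<epsilon> \<Longrightarrow> \<forall>i. cmod (x i) \<le> \<epsilon> * u k i"
    using assms r(1) by (rule wnorm_ind_step) blast
  have "\<forall>i. cmod (x i) \<le> enn2real (wnorm p (\<omega> r) x) * u k i"
    using r(2) by (intro k) auto
  then show "x \<in> ind_space u" unfolding ind_space_def by blast
next
  fix x assume "x \<in> ind_space u"
  then obtain k C where C: "0 \<le> C" "\<And>i. cmod (x i) \<le> C * u k i"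
    by (rule ind_space_nonnegE) blast
  obtain r K where "0 < r"
    "\<And>x M. 0 \<le> M \<Longrightarrow> (\<And>i. cmod (x i) \<le> M * u k i) \<Longrightarrow> wnorm p (\<omega> r) x \<le> ennreal (M * K)"
    using assms by (rule ind_step_wnorm) blast
  then have "0 < r" "wnorm p (\<omega> r) x \<le> ennreal (C * K)" using C by auto
  then show "x \<in> (\<Union>r\<in>{0<..}. ell p (\<omega> r))"
    by (auto simp: ell_def intro!: bexI[of _ r] intro: le_less_trans)
qed

lemma indlim_nbhd_iff:
  assumes "represents \<omega> u" "0 < p"
  shows "indlim_nbhd p \<omega> V \<longleftrightarrow> ind_nbhd u V"
proof -
  have "(\<forall>r>0. \<exists>\<epsilon>>0. {x. wnorm p (\<omega> r) x < ennreal \<epsilon>} \<subseteq> V) \<longleftrightarrow>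
      (\<forall>k. \<exists>\<epsilon>>0. \<forall>x. (\<forall>i. cmod (x i) \<le> \<epsilon> * u k i) \<longrightarrow> x \<in> V)" (is "?L \<longleftrightarrow> ?R")
  proof (intro iffI allI impI)
    fix k assume L: ?L
    obtain r K where r: "0 < r" "0 < K"
      "\<And>x M. 0 \<le> M \<Longrightarrow> (\<And>i. cmod (x i) \<le> M * u k i) \<Longrightarrow> wnorm p (\<omega> r) x \<le> ennreal (M * K)"
      using assms by (rule ind_step_wnorm) blast
    obtain \<epsilon> where e: "\<epsilon> > 0" "{x. wnorm p (\<omega> r) x < ennreal \<epsilon>} \<subseteq> V" using L r(1) by blast
    \<comment> \<open>\<open>K\<close> converts the coordinate bound into a norm bound, and the
      factor 2 makes the inequality strict.\<close>
    have "x \<in> V" if "\<forall>i. cmod (x i) \<le> \<epsilon> / (2 * K) * u k i" for x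
    proof -
      have "wnorm p (\<omega> r) x \<le> ennreal (\<epsilon> / (2 * K) * K)"
        using that e(1) r(2) by (intro r(3)) auto
      also have "\<dots> < ennreal \<epsilon>" using e(1) r(2) by (simp add: ennreal_less_iff)
      finally show ?thesis using e(2) by blast
    qed
    then show "\<exists>\<epsilon>>0. \<forall>x. (\<forall>i. cmod (x i) \<le> \<epsilon> * u k i) \<longrightarrow> x \<in> V"
      using e(1) r(2) by (intro exI[of _ "\<epsilon> / (2 * K)"]) auto
  next
    fix r :: real assume R: ?R and r: "0 < r"
    obtain k where k: "\<And>x \<epsilon>. 0 \<le> \<epsilon> \<Longrightarrow> wnorm p (\<omega> r) x \<le> ennreal \<epsilon> \<Longrightarrow> \<forall>i. cmod (x i) \<le> \<epsilon> * u k i"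
      using assms r by (rule wnorm_ind_step) blast
    obtain \<epsilon> where e: "\<epsilon> > 0" "\<forall>x. (\<forall>i. cmod (x i) \<le> \<epsilon> * u k i) \<longrightarrow> x \<in> V" using R by blast
    have "x \<in> V" if "wnorm p (\<omega> r) x < ennreal \<epsilon>" for x
      using k[of \<epsilon> x] that e by auto
    then show "\<exists>\<epsilon>>0. {x. wnorm p (\<omega> r) x < ennreal \<epsilon>} \<subseteq> V" using e(1) by blast
  qed
  then show ?thesis
    unfolding indlim_nbhd_def ind_nbhd_def Union_ell_eq_ind_space[OF assms] by blast
qed

lemma ind_space_lin_space:
  assumes "represents \<omega> u" "0 < p"
  shows "lin_space (indlim p \<omega>) (ind_space u) (ind_nbhd u)"
proof
  fix U show "openin (indlim p \<omega>) U \<longleftrightarrow> U \<subseteq> ind_space u \<and>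
      (\<forall>x\<in>U. \<exists>V. ind_nbhd u V \<and> (\<forall>v\<in>V. (\<lambda>i. x i + v i) \<in> U))"
    unfolding indlim_def topology_inverse'[OF istopology_indlim]
    unfolding Union_ell_eq_ind_space[OF assms] indlim_nbhd_iff[OF assms] ..
next
  show "\<exists>V. ind_nbhd u V"
  proof
    show "ind_nbhd u (ind_space u)"
      unfolding ind_nbhd_def abs_convex_def
    proof (intro conjI ballI allI impI)
      fix k show "\<exists>\<epsilon>>0. \<forall>x. (\<forall>i. cmod (x i) \<le> \<epsilon> * u k i) \<longrightarrow> x \<in> ind_space u"
        unfolding ind_space_def using zero_less_one by blast
    qed (auto dest: lin_comb_ind_space simp: lin_comb_def)
  qed
next
  fix V assume V: "ind_nbhd u V"
  then show "(\<lambda>_. 0) \<in> V" unfolding ind_nbhd_def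
    by (metis less_eq_real_def mult_nonneg_nonneg nonneg norm_zero)
  \<comment> \<open>\<open>W\<close> is half of \<open>V\<close>: a sum of two of its elements is
    the mean of two elements of \<open>V\<close>, hence lies in \<open>V\<close> by absolute
    convexity.\<close>
  define W where "W = {x. (\<lambda>i. 2 * x i) \<in> V}"
  have "ind_nbhd u W"
    unfolding ind_nbhd_def
  proof (intro conjI allI subsetI)
    fix x assume "x \<in> W"
    then have "(\<lambda>i. 2 * x i) \<in> ind_space u" using V by (auto simp: W_def ind_nbhd_def)
    from lin_comb_ind_space[OF this this, of "1/2" 0] show "x \<in> ind_space u"
      by (simp add: lin_comb_def)
  next
    show "abs_convex W"
      unfolding abs_convex_def
    proof (intro ballI allI impI)
      fix x y a b assume xy: "x \<in> W" "y \<in> W" "cmod a + cmod b \<le> 1"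
      have "(\<lambda>i. a * (2 * x i) + b * (2 * y i)) \<in> V"
        using xy V by (intro abs_convexD) (auto simp: W_def ind_nbhd_def)
      then show "(\<lambda>i. a * x i + b * y i) \<in> W" by (simp add: W_def algebra_simps)
    qed
  next
    fix k
    obtain \<epsilon> where e: "\<epsilon> > 0" "\<forall>x. (\<forall>i. cmod (x i) \<le> \<epsilon> * u k i) \<longrightarrow> x \<in> V"
      using V unfolding ind_nbhd_def by blast
    then have "\<forall>x. (\<forall>i. cmod (x i) \<le> \<epsilon> / 2 * u k i) \<longrightarrow> x \<in> W"
      by (auto simp: W_def norm_mult mult.commute)
    then show "\<exists>\<epsilon>>0. \<forall>x. (\<forall>i. cmod (x i) \<le> \<epsilon> * u k i) \<longrightarrow> x \<in> W"
      using e(1) by (intro exI[of _ "\<epsilon> / 2"]) auto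
  qed
  moreover have "(\<lambda>i. x i + y i) \<in> V" if "x \<in> W" "y \<in> W" for x y
  proof -
    have "(\<lambda>i. (1/2) * (2 * x i) + (1/2) * (2 * y i)) \<in> V"
      using that V by (intro abs_convexD) (auto simp: W_def ind_nbhd_def)
    then show ?thesis by simp
  qed
  ultimately show "\<exists>W. ind_nbhd u W \<and> (\<forall>x\<in>W. \<forall>y\<in>W. (\<lambda>i. x i + y i) \<in> V)" by blast
qed (auto simp: ind_nbhd_def intro: lin_comb_ind_space zero_ind_space)

section \<open>Projective limits: independence of the exponent, zero neighbourhoods\<close>

lemma proj_step_wnorm:
  assumes "represents \<omega> u" "0 < p" "0 < r"
  obtains k K where "0 < K"
    "\<And>x M. 0 \<le> M \<Longrightarrow> (\<And>i. cmod (x i) * u k i \<le> M) \<Longrightarrow>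
       wnorm p (\<lambda>i. 1 / \<omega> r i) x \<le> ennreal (M * K)"
proof -
  obtain k where k: "\<And>i. inverse (ennreal (u k i)) \<le> \<omega> r i"
    using assms unfolding represents_def by blast
  obtain l where l: "\<And>i. 0 \<le> l i" "(\<lambda>i. l i powr summation_exponent p) summable_on UNIV"
      "\<And>i. u k i \<le> l i * u (Suc k) i"
    using nuclear[OF summation_exponent_pos[OF assms(2)], of k] by blast
  obtain K where K: "K > 0"
    "\<And>M \<omega> c. 0 \<le> M \<Longrightarrow> (\<And>i. ennreal (cmod (c i)) * \<omega> i \<le> ennreal (M * l i))
       \<Longrightarrow> wnorm p \<omega> c \<le> ennreal (M * K)"
    using wnorm_le_summable_majorant[OF assms(2) l(1,2)] by blast
  show ?thesis
  proof (rule that[OF K(1)], rule K(2))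
    fix x :: "'i \<Rightarrow> complex" and M :: real and i
    assume M: "0 \<le> M" and x: "\<And>i. cmod (x i) * u (Suc k) i \<le> M"
    have "inverse (\<omega> r i) \<le> ennreal (u k i)"
      using inverse_antimono_ennreal[OF k[of i]] by (simp add: ennreal_inverse_inverse)
    then have "ennreal (cmod (x i)) * (1 / \<omega> r i) \<le> ennreal (cmod (x i)) * ennreal (u k i)"
      by (intro mult_left_mono) (simp_all add: divide_ennreal_def)
    also have "\<dots> = ennreal (cmod (x i) * u k i)"
      using nonneg by (simp add: ennreal_mult)
    also have "cmod (x i) * u k i \<le> cmod (x i) * (l i * u (Suc k) i)"
      by (intro mult_left_mono l) simp
    also have "\<dots> = l i * (cmod (x i) * u (Suc k) i)" by simp
    also have "\<dots> \<le> M * l i" using mult_left_mono[OF x[of i] l(1)[of i]] by (simp add: mult.commute)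
    finally show "ennreal (cmod (x i)) * (1 / \<omega> r i) \<le> ennreal (M * l i)"
      by (simp add: ennreal_leI)
  qed
qed

lemma wnorm_proj_step:
  assumes "represents \<omega> u"
  obtains r where "0 < r" "\<And>i. ennreal (u k i) \<le> 1 / \<omega> r i"
proof -
  obtain r where r: "r > 0" "\<And>i. \<omega> r i \<le> inverse (ennreal (u k i))"
    using assms(1) unfolding represents_def by blast
  have "ennreal (u k i) \<le> 1 / \<omega> r i" for i
    using inverse_antimono_ennreal[OF r(2)[of i]]
    by (simp add: ennreal_inverse_inverse divide_ennreal_def)
  then show ?thesis using that r(1) by blast
qed

lemma proj_stepD:
  assumes "ennreal (u k i) \<le> w" "ennreal (cmod z) * w \<le> ennreal \<epsilon>" "0 \<le> \<epsilon>"
  shows "cmod z * u k i \<le> \<epsilon>"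
proof -
  have "ennreal (cmod z * u k i) = ennreal (cmod z) * ennreal (u k i)"
    using nonneg by (simp add: ennreal_mult)
  also have "\<dots> \<le> ennreal (cmod z) * w" by (intro mult_left_mono assms) simp
  also have "\<dots> \<le> ennreal \<epsilon>" by fact
  finally show ?thesis using assms(3) by simp
qed

lemma Inter_ell_eq_proj_space:
  assumes "represents \<omega> u" "0 < p"
  shows "(\<Inter>r\<in>{0<..}. ell p (\<lambda>i. 1 / \<omega> r i)) = proj_space u"
proof (intro equalityI subsetI)
  fix x assume x: "x \<in> (\<Inter>r\<in>{0<..}. ell p (\<lambda>i. 1 / \<omega> r i))"
  show "x \<in> proj_space u"
    unfolding proj_space_def
  proof (intro CollectI allI)
    fix k
    obtain r where r: "0 < r" "\<And>i. ennreal (u k i) \<le> 1 / \<omega> r i"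
      using assms(1) by (rule wnorm_proj_step) blast
    define C where "C = enn2real (wnorm p (\<lambda>i. 1 / \<omega> r i) x)"
    have C: "wnorm p (\<lambda>i. 1 / \<omega> r i) x = ennreal C"
      using x r(1) by (auto simp: ell_def C_def less_top)
    have "cmod (x i) * u k i \<le> C" for i
    proof (rule proj_stepD[OF r(2)])
      show "ennreal (cmod (x i)) * (1 / \<omega> r i) \<le> ennreal C"
        using wnorm_ge_coordinate[OF assms(2), of x i "\<lambda>i. 1 / \<omega> r i"] by (simp add: C)
    qed (simp add: C_def)
    then show "\<exists>C. \<forall>i. cmod (x i) * u k i \<le> C" by blast
  qed
next
  fix x assume x: "x \<in> proj_space u"
  have "x \<in> ell p (\<lambda>i. 1 / \<omega> r i)" if r: "r > 0" for r
  proof -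
    obtain k K where K: "0 < K" "\<And>x M. 0 \<le> M \<Longrightarrow> (\<And>i. cmod (x i) * u k i \<le> M) \<Longrightarrow>
       wnorm p (\<lambda>i. 1 / \<omega> r i) x \<le> ennreal (M * K)"
      using assms r by (rule proj_step_wnorm) blast
    obtain C where C: "0 \<le> C" "\<And>i. cmod (x i) * u k i \<le> C"
      using x by (rule proj_spaceE) blast
    show ?thesis using K(2)[OF C] by (auto simp: ell_def intro: le_less_trans)
  qed
  then show "x \<in> (\<Inter>r\<in>{0<..}. ell p (\<lambda>i. 1 / \<omega> r i))" by blast
qed

lemma proj_nbhd_Int:
  assumes "proj_nbhd u V" "proj_nbhd u W"
  obtains X where "proj_nbhd u X" "X \<subseteq> V" "X \<subseteq> W"
proof -
  obtain k \<epsilon> where V: "\<epsilon> > 0" "V = {x \<in> proj_space u. \<forall>i. cmod (x i) * u k i \<le> \<epsilon>}"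
    using assms(1) unfolding proj_nbhd_def by blast
  obtain l \<delta> where W: "\<delta> > 0" "W = {x \<in> proj_space u. \<forall>i. cmod (x i) * u l i \<le> \<delta>}"
    using assms(2) unfolding proj_nbhd_def by blast
  define m where "m = max k l"
  have "cmod z * u k i \<le> cmod z * u m i" "cmod z * u l i \<le> cmod z * u m i" for z i
    by (auto simp: m_def intro!: mult_left_mono mono)
  then have "{x \<in> proj_space u. \<forall>i. cmod (x i) * u m i \<le> min \<epsilon> \<delta>} \<subseteq> V"
    "{x \<in> proj_space u. \<forall>i. cmod (x i) * u m i \<le> min \<epsilon> \<delta>} \<subseteq> W"
    unfolding V(2) W(2) by (simp_all add: subset_iff) (meson order_trans)+
  moreover have "proj_nbhd u {x \<in> proj_space u. \<forall>i. cmod (x i) * u m i \<le> min \<epsilon> \<delta>}"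
    unfolding proj_nbhd_def using V(1) W(1) by (intro exI[of _ m] exI[of _ "min \<epsilon> \<delta>"]) auto
  ultimately show ?thesis using that by blast
qed

text \<open>\<open>projlim\<close> is given by a subbase. One direction is therefore an induction
  over generated sets, with \<open>proj_nbhd_Int\<close> for intersections. The other finds one
  subbasic set around each point: the seminorms increase with \<open>k\<close>, so a basic
  neighbourhood involves a single step.\<close>

lemma openin_projlim_iff:
  assumes rep: "represents \<omega> u" and p: "0 < p"
  shows "openin (projlim p (\<lambda>r i. 1 / \<omega> r i)) U \<longleftrightarrow> U \<subseteq> proj_space u \<and>
    (\<forall>x\<in>U. \<exists>V. proj_nbhd u V \<and> (\<forall>v\<in>V. (\<lambda>i. x i + v i) \<in> U))" (is "?O U \<longleftrightarrow> ?N U")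
proof
  let ?w = "\<lambda>r i. 1 / \<omega> r i"
  have gen: "?O U \<longleftrightarrow> generate_topology_on {proj_space u \<inter> V | r V. r > 0 \<and> openin (ell_top p (?w r)) V} U"
    for U
    unfolding projlim_def openin_topology_generated_by_iff Inter_ell_eq_proj_space[OF assms] ..
  have diff: "(\<lambda>i. y i - x i) \<in> proj_space u" if "x \<in> proj_space u" "y \<in> proj_space u" for x y
    using lin_comb_proj_space[OF that(2,1), of 1 "-1"] by (simp add: lin_comb_def)
  have add: "(\<lambda>i. x i + y i) \<in> proj_space u" if "x \<in> proj_space u" "y \<in> proj_space u" for x y
    using lin_comb_proj_space[OF that, of 1 1] by (simp add: lin_comb_def)
  show "?N U" if "?O U"
    using that unfolding gen
  proof induction
    case Empty
    show ?case by simp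
  next
    case (Int a b)
    show ?case
    proof (intro conjI ballI)
      fix x assume "x \<in> a \<inter> b"
      then obtain V W where VW: "proj_nbhd u V" "\<forall>v\<in>V. (\<lambda>i. x i + v i) \<in> a"
          "proj_nbhd u W" "\<forall>v\<in>W. (\<lambda>i. x i + v i) \<in> b"
        using Int by blast
      from proj_nbhd_Int[OF VW(1,3)] obtain Y where "proj_nbhd u Y" "Y \<subseteq> V" "Y \<subseteq> W" by blast
      then show "\<exists>V. proj_nbhd u V \<and> (\<forall>v\<in>V. (\<lambda>i. x i + v i) \<in> a \<inter> b)" using VW by blast
    qed (use Int in blast)
  next
    case (UN K)
    then show ?case by blast
  next
    case (Basis U)
    then obtain r V where r: "r > 0" "openin (ell_top p (?w r)) V" "U = proj_space u \<inter> V" by blast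
    show ?case
    proof (intro conjI ballI)
      fix x assume x: "x \<in> U"
      obtain \<epsilon> where e: "\<epsilon> > 0"
        "\<forall>y\<in>ell p (?w r). wnorm p (?w r) (\<lambda>i. y i - x i) < ennreal \<epsilon> \<longrightarrow> y \<in> V"
        using r(2,3) x unfolding ell_top_def topology_inverse'[OF istopology_ell_top] by blast
      obtain k K where K: "0 < K" "\<And>x M. 0 \<le> M \<Longrightarrow> (\<And>i. cmod (x i) * u k i \<le> M) \<Longrightarrow>
         wnorm p (?w r) x \<le> ennreal (M * K)"
        using assms r(1) by (rule proj_step_wnorm) blast
      define N where "N = {x \<in> proj_space u. \<forall>i. cmod (x i) * u k i \<le> \<epsilon> / (2 * K)}"
      have "(\<lambda>i. x i + v i) \<in> U" if v: "v \<in> N" for v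
      proof -
        have xv: "(\<lambda>i. x i + v i) \<in> proj_space u"
          using x r(3) v by (auto simp: N_def intro: add)
        then have "(\<lambda>i. x i + v i) \<in> ell p (?w r)"
          using Inter_ell_eq_proj_space[OF assms] r(1) by blast
        moreover have "wnorm p (?w r) v \<le> ennreal (\<epsilon> / (2 * K) * K)"
          using v e(1) K(1) by (intro K(2)) (auto simp: N_def)
        then have "wnorm p (?w r) v < ennreal \<epsilon>"
          by (rule le_less_trans) (use e(1) K(1) in \<open>simp add: ennreal_less_iff\<close>)
        ultimately show ?thesis using e(2) xv r(3) by simp
      qed
      moreover have "proj_nbhd u N"
        unfolding proj_nbhd_def N_def using e(1) K(1) by (intro exI[of _ k] exI[of _ "\<epsilon> / (2 * K)"]) auto
      ultimately show "\<exists>V. proj_nbhd u V \<and> (\<forall>v\<in>V. (\<lambda>i. x i + v i) \<in> U)" by blast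
    qed (use r(3) in blast)
  qed
  show "?O U" if N: "?N U"
  proof (subst openin_subopen, intro ballI)
    fix x assume x: "x \<in> U"
    obtain k \<epsilon> where e: "\<epsilon> > 0"
      "\<forall>v\<in>{v \<in> proj_space u. \<forall>i. cmod (v i) * u k i \<le> \<epsilon>}. (\<lambda>i. x i + v i) \<in> U"
      using N x unfolding proj_nbhd_def by blast
    have xE: "x \<in> proj_space u" using N x by blast
    obtain r where r: "0 < r" "\<And>i. ennreal (u k i) \<le> ?w r i"
      using rep by (rule wnorm_proj_step) blast
    \<comment> \<open>A ball for the weighted supremum and not for \<open>wnorm\<close>, which has
      no triangle inequality when \<open>p < 1\<close>. The gap between \<open>\<eta>\<close> and
      \<open>\<epsilon>\<close> leaves room for a smaller ball around every point, so
      \<open>V\<close> is open in the step.\<close>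
    define V where "V = {y \<in> ell p (?w r). \<exists>\<eta>\<ge>0. \<eta> < \<epsilon> \<and> (\<forall>i. ennreal (cmod (y i - x i)) * ?w r i \<le> ennreal \<eta>)}"
    have "openin (ell_top p (?w r)) V"
      unfolding ell_top_def topology_inverse'[OF istopology_ell_top]
    proof (intro conjI ballI)
      fix y assume "y \<in> V"
      then obtain \<eta> where h: "0 \<le> \<eta>" "\<eta> < \<epsilon>" "\<And>i. ennreal (cmod (y i - x i)) * ?w r i \<le> ennreal \<eta>"
        unfolding V_def by blast
      define \<delta> where "\<delta> = (\<epsilon> - \<eta>) / 2"
      have d: "\<delta> > 0" "\<eta> + \<delta> < \<epsilon>" using h by (auto simp: \<delta>_def field_simps)
      have "z \<in> V" if z: "z \<in> ell p (?w r)" "wnorm p (?w r) (\<lambda>i. z i - y i) < ennreal \<delta>" for z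
      proof -
        have "ennreal (cmod (z i - x i)) * ?w r i \<le> ennreal (\<eta> + \<delta>)" for i
        proof -
          have "cmod (z i - x i) \<le> cmod (y i - x i) + cmod (z i - y i)"
            using norm_triangle_ineq[of "y i - x i" "z i - y i"] by simp
          then have "ennreal (cmod (z i - x i)) * ?w r i
              \<le> ennreal (cmod (y i - x i) + cmod (z i - y i)) * ?w r i"
            by (intro mult_right_mono ennreal_leI) auto
          also have "\<dots> = ennreal (cmod (y i - x i)) * ?w r i + ennreal (cmod (z i - y i)) * ?w r i"
            by (simp add: distrib_right)
          also have "\<dots> \<le> ennreal \<eta> + ennreal \<delta>"
            using wnorm_ge_coordinate[OF p, of "\<lambda>i. z i - y i" i "?w r"] z(2) h(3)[of i]
            by (intro add_mono) auto
          finally show ?thesis using h(1) d(1) by simp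
        qed
        then show ?thesis using z(1) d h(1) by (auto simp: V_def intro!: exI[of _ "\<eta> + \<delta>"])
      qed
      then show "\<exists>\<epsilon>>0. \<forall>z\<in>ell p (?w r). wnorm p (?w r) (\<lambda>i. z i - y i) < ennreal \<epsilon> \<longrightarrow> z \<in> V"
        using d(1) by blast
    qed (auto simp: V_def)
    then have "?O (proj_space u \<inter> V)"
      unfolding gen using r(1) by (intro generate_topology_on.Basis) blast
    moreover have "x \<in> proj_space u \<inter> V"
      using xE Inter_ell_eq_proj_space[OF assms] r(1) e(1) by (auto simp: V_def intro!: exI[of _ 0])
    moreover have "proj_space u \<inter> V \<subseteq> U"
    proof
      fix y assume y: "y \<in> proj_space u \<inter> V"
      then obtain \<eta> where h: "0 \<le> \<eta>" "\<eta> < \<epsilon>" "\<And>i. ennreal (cmod (y i - x i)) * ?w r i \<le> ennreal \<eta>"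
        unfolding V_def by blast
      have "cmod (y i - x i) * u k i \<le> \<epsilon>" for i
        using proj_stepD[OF r(2) h(3,1)] h(2) by (meson less_imp_le order_trans)
      then have "(\<lambda>i. x i + (y i - x i)) \<in> U" using diff[OF xE] y by (intro e(2)[rule_format]) auto
      then show "y \<in> U" by simp
    qed
    ultimately show "\<exists>S. ?O S \<and> x \<in> S \<and> S \<subseteq> U" by blast
  qed
qed

lemma proj_space_lin_space:
  assumes "represents \<omega> u" "0 < p"
  shows "lin_space (projlim p (\<lambda>r i. 1 / \<omega> r i)) (proj_space u) (proj_nbhd u)"
proof
  fix U show "openin (projlim p (\<lambda>r i. 1 / \<omega> r i)) U \<longleftrightarrow> U \<subseteq> proj_space u \<and>
      (\<forall>x\<in>U. \<exists>V. proj_nbhd u V \<and> (\<forall>v\<in>V. (\<lambda>i. x i + v i) \<in> U))"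
    by (rule openin_projlim_iff[OF assms])
next
  show "\<exists>V. proj_nbhd u V" unfolding proj_nbhd_def using zero_less_one by blast
next
  fix V assume "proj_nbhd u V"
  then obtain k \<epsilon> where V: "\<epsilon> > 0" "V = {x \<in> proj_space u. \<forall>i. cmod (x i) * u k i \<le> \<epsilon>}"
    unfolding proj_nbhd_def by blast
  define W where "W = {x \<in> proj_space u. \<forall>i. cmod (x i) * u k i \<le> \<epsilon> / 2}"
  have "proj_nbhd u W"
    unfolding proj_nbhd_def W_def using V(1) by (intro exI[of _ k] exI[of _ "\<epsilon> / 2"]) auto
  moreover have "(\<lambda>i. x i + y i) \<in> V" if xy: "x \<in> W" "y \<in> W" for x y
  proof -
    have "cmod (x i + y i) * u k i \<le> \<epsilon>" for i
    proof -
      have "cmod (x i + y i) * u k i \<le> (cmod (x i) + cmod (y i)) * u k i"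
        by (intro mult_right_mono norm_triangle_ineq nonneg)
      moreover have "cmod (x i) * u k i \<le> \<epsilon> / 2" "cmod (y i) * u k i \<le> \<epsilon> / 2"
        using xy by (auto simp: W_def)
      ultimately show ?thesis by (simp add: distrib_right)
    qed
    then show ?thesis
      using lin_comb_proj_space[of x y 1 1] xy by (auto simp: V(2) W_def lin_comb_def)
  qed
  ultimately show "\<exists>W. proj_nbhd u W \<and> (\<forall>x\<in>W. \<forall>y\<in>W. (\<lambda>i. x i + y i) \<in> V)" by blast
  show "(\<lambda>_. 0) \<in> V" using V zero_proj_space by auto
qed (auto simp: proj_nbhd_def intro: lin_comb_proj_space zero_proj_space)

end

section \<open>Matrices of continuous linear maps\<close>

definition unit_seq :: "'i \<Rightarrow> 'i \<Rightarrow> complex"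
  where "unit_seq i = (\<lambda>k. if k = i then 1 else 0)"

definition mat_op :: "('j \<times> 'i \<Rightarrow> complex) \<Rightarrow> ('i \<Rightarrow> complex) \<Rightarrow> 'j \<Rightarrow> complex"
  where "mat_op c x = (\<lambda>j. \<Sum>\<^sub>\<infinity>i. c (j, i) * x i)"

definition tail_seq :: "'i set \<Rightarrow> ('i \<Rightarrow> complex) \<Rightarrow> 'i \<Rightarrow> complex"
  where "tail_seq F x = (\<lambda>i. if i \<in> F then 0 else x i)"

definition matrix_of :: "(('i \<Rightarrow> complex) \<Rightarrow> ('j \<Rightarrow> complex)) \<Rightarrow> 'j \<times> 'i \<Rightarrow> complex"
  where "matrix_of T = (\<lambda>(j, i). T (unit_seq i) j)"

lemma mat_op_unit: "mat_op c (unit_seq i) j = c (j, i)"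
proof -
  have "mat_op c (unit_seq i) j = (\<Sum>\<^sub>\<infinity>k\<in>{i}. c (j, k) * unit_seq i k)"
    unfolding mat_op_def by (rule infsum_cong_neutral) (auto simp: unit_seq_def)
  then show ?thesis by (simp add: unit_seq_def)
qed

lemma mat_op_bound:
  assumes "l summable_on UNIV" "\<And>i. cmod (c (j, i) * x i) \<le> B * l i"
  shows "(\<lambda>i. c (j, i) * x i) summable_on UNIV"
    and "cmod (mat_op c x j) \<le> B * (\<Sum>\<^sub>\<infinity>i. l i)"
proof -
  have s: "(\<lambda>i. B * l i) summable_on UNIV" by (intro summable_on_cmult_right assms)
  have a: "(\<lambda>i. cmod (c (j, i) * x i)) summable_on UNIV"
    by (rule summable_on_comparison_test[OF s]) (use assms in auto)
  show "(\<lambda>i. c (j, i) * x i) summable_on UNIV"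
    using a by (rule abs_summable_summable)
  have "cmod (mat_op c x j) \<le> (\<Sum>\<^sub>\<infinity>i. cmod (c (j, i) * x i))"
    unfolding mat_op_def using a by (rule norm_infsum_bound)
  also have "\<dots> \<le> (\<Sum>\<^sub>\<infinity>i. B * l i)" by (rule infsum_mono[OF a s]) (use assms in auto)
  finally show "cmod (mat_op c x j) \<le> B * (\<Sum>\<^sub>\<infinity>i. l i)"
    by (simp add: infsum_cmult_right' del: norm_mult)
qed

lemma linear_on_mat_op:
  assumes summable: "\<And>x j. x \<in> E \<Longrightarrow> (\<lambda>i. c (j, i) * x i) summable_on UNIV"
  shows "linear_on E (mat_op c)"
  unfolding linear_on_def
proof (intro ballI allI)
  fix x y a b assume x: "x \<in> E" and y: "y \<in> E"
  show "mat_op c (lin_comb a x b y) = lin_comb a (mat_op c x) b (mat_op c y)"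
  proof
    fix j
    have "mat_op c (lin_comb a x b y) j = (\<Sum>\<^sub>\<infinity>i. a * (c (j, i) * x i) + b * (c (j, i) * y i))"
      unfolding mat_op_def lin_comb_def by (simp add: algebra_simps)
    also have "\<dots> = lin_comb a (mat_op c x) b (mat_op c y) j"
      unfolding mat_op_def lin_comb_def
      by (subst infsum_add)
         (auto intro!: summable_on_cmult_right summable x y simp: infsum_cmult_right')
    finally show "mat_op c (lin_comb a x b y) j = lin_comb a (mat_op c x) b (mat_op c y) j" .
  qed
qed

text \<open>Applied to the nuclearity factor: off a finite set of indices it is as small as desired,
  which makes tails small.\<close>

lemma summable_on_finite_superlevel:
  fixes l :: "'i \<Rightarrow> real"
  assumes "l summable_on UNIV" "\<And>i. 0 \<le> l i" "0 < \<delta>"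
  shows "finite {i. \<delta> < l i}"
proof (rule ccontr)
  assume "infinite {i. \<delta> < l i}"
  moreover obtain n :: nat where n: "(\<Sum>\<^sub>\<infinity>i. l i) < real n * \<delta>"
    using reals_Archimedean3[OF assms(3)] by blast
  ultimately obtain F where F: "finite F" "card F = n" "F \<subseteq> {i. \<delta> < l i}"
    using infinite_arbitrarily_large by blast
  have "real n * \<delta> = (\<Sum>i\<in>F. \<delta>)" using F by simp
  also have "\<dots> \<le> (\<Sum>i\<in>F. l i)" using F by (intro sum_mono) auto
  also have "\<dots> \<le> (\<Sum>\<^sub>\<infinity>i. l i)" using F assms by (intro finite_sum_le_infsum) auto
  finally show False using n by simp
qed

text \<open>The interface between the estimates and the kernel theorem. \<open>unit_mem\<close>,
  \<open>tail_small\<close> and \<open>coordinate_small\<close> make finite sequences dense and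
  separate the points of the target, which gives uniqueness; \<open>lin_comb_S\<close> to
  \<open>bounded\<close> say that the matrices in \<open>S\<close> form a vector space and act
  continuously; \<open>matrix_mem\<close> is the converse.\<close>

locale kernel_class =
  X1: lin_space X1 E1 N1 + X2: lin_space X2 E2 N2
  for X1 :: "('i \<Rightarrow> complex) topology" and E1 N1
    and X2 :: "('j \<Rightarrow> complex) topology" and E2 N2 +
  fixes S :: "('j \<times> 'i \<Rightarrow> complex) set"
  assumes unit_mem: "unit_seq i \<in> E1"
    and tail_small: "x \<in> E1 \<Longrightarrow> N1 V \<Longrightarrow> \<exists>F. finite F \<and> (\<forall>G. F \<subseteq> G \<longrightarrow> tail_seq G x \<in> V)"
    and coordinate_small: "0 < \<epsilon> \<Longrightarrow> \<exists>W. N2 W \<and> (\<forall>y\<in>W. cmod (y j) < \<epsilon>)"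
    and lin_comb_S: "c \<in> S \<Longrightarrow> d \<in> S \<Longrightarrow> lin_comb a c b d \<in> S"
    and summable: "c \<in> S \<Longrightarrow> x \<in> E1 \<Longrightarrow> (\<lambda>i. c (j, i) * x i) summable_on UNIV"
    and range: "c \<in> S \<Longrightarrow> x \<in> E1 \<Longrightarrow> mat_op c x \<in> E2"
    and bounded: "c \<in> S \<Longrightarrow> N2 W \<Longrightarrow> \<exists>V. N1 V \<and> mat_op c ` V \<subseteq> W"
    and matrix_mem: "linear_on E1 T \<Longrightarrow> T ` E1 \<subseteq> E2 \<Longrightarrow>
      (\<And>W. N2 W \<Longrightarrow> \<exists>V. N1 V \<and> T ` V \<subseteq> W) \<Longrightarrow> matrix_of T \<in> S"
begin

lemma linear_mat_op: "c \<in> S \<Longrightarrow> linear_on E1 (mat_op c)"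
  by (intro linear_on_mat_op summable)

lemma mat_op_lin_comb:
  assumes "c \<in> S" "d \<in> S" "x \<in> E1"
  shows "mat_op (lin_comb a c b d) x = lin_comb a (mat_op c x) b (mat_op d x)"
proof
  fix j
  have "mat_op (lin_comb a c b d) x j = (\<Sum>\<^sub>\<infinity>i. a * (c (j, i) * x i) + b * (d (j, i) * x i))"
    unfolding mat_op_def lin_comb_def by (simp add: algebra_simps)
  also have "\<dots> = lin_comb a (mat_op c x) b (mat_op d x) j"
    unfolding mat_op_def lin_comb_def
    by (subst infsum_add)
       (auto intro!: summable_on_cmult_right summable assms simp: infsum_cmult_right')
  finally show "mat_op (lin_comb a c b d) x j = lin_comb a (mat_op c x) b (mat_op d x) j" .
qed

lemma continuous_mat_op: "c \<in> S \<Longrightarrow> continuous_map X1 X2 (mat_op c)"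
  by (subst continuous_linear_iff[OF X1.lin_space_axioms X2.lin_space_axioms linear_mat_op])
     (auto intro: range bounded)

lemma matrix_of_mem:
  assumes "linear_on E1 T" "continuous_map X1 X2 T"
  shows "matrix_of T \<in> S"
  using assms continuous_linear_iff[OF X1.lin_space_axioms X2.lin_space_axioms assms(1)]
  by (intro matrix_mem) auto

text \<open>A vector is a finite combination of unit vectors, on which the maps agree, plus a tail,
  which both maps send into a neighbourhood with small \<open>j\<close>-th coordinate.\<close>

lemma eq_from_units:
  assumes A: "linear_on E1 A" "continuous_map X1 X2 A"
    and B: "linear_on E1 B" "continuous_map X1 X2 B"
    and eq: "\<And>i. A (unit_seq i) = B (unit_seq i)" and x: "x \<in> E1"
  shows "A x = B x"
proof
  fix j
  note iff = continuous_linear_iff[OF X1.lin_space_axioms X2.lin_space_axioms]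
  have trunc: "(\<lambda>i. if i \<in> F then x i else 0) \<in> E1 \<and>
      A (\<lambda>i. if i \<in> F then x i else 0) = B (\<lambda>i. if i \<in> F then x i else 0)" if "finite F" for F
    using that
  proof induction
    case empty
    then show ?case
      using X1.zero_mem linear_on_zero[OF A(1) X1.zero_mem] linear_on_zero[OF B(1) X1.zero_mem] by simp
  next
    case (insert k F)
    let ?t = "\<lambda>i. if i \<in> F then x i else 0"
    have t: "(\<lambda>i. if i \<in> insert k F then x i else 0) = lin_comb 1 ?t (x k) (unit_seq k)"
      using insert(2) by (auto simp: lin_comb_def unit_seq_def)
    show ?case
      unfolding t using insert(3) X1.lin_comb_mem[OF _ unit_mem]
        linear_onD[OF A(1) _ unit_mem] linear_onD[OF B(1) _ unit_mem] eq by auto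
  qed
  have "cmod (A x j - B x j) \<le> \<epsilon>" if e: "\<epsilon> > 0" for \<epsilon>
  proof -
    obtain W where W: "N2 W" "\<forall>y\<in>W. cmod (y j) < \<epsilon> / 2"
      using coordinate_small[of "\<epsilon> / 2" j] e by auto
    obtain V where V: "N1 V" "A ` V \<subseteq> W" using A(2) W(1) iff[OF A(1)] by blast
    obtain V' where V': "N1 V'" "B ` V' \<subseteq> W" using B(2) W(1) iff[OF B(1)] by blast
    obtain F where F: "finite F" "\<And>G. F \<subseteq> G \<Longrightarrow> tail_seq G x \<in> V" using tail_small[OF x V(1)] by blast
    obtain F' where F': "finite F'" "\<And>G. F' \<subseteq> G \<Longrightarrow> tail_seq G x \<in> V'" using tail_small[OF x V'(1)] by blast
    \<comment> \<open>The tail must be small for two different neighbourhoods.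
      \<open>tail_small\<close> holds for every larger index set, so the union serves both.\<close>
    define G where "G = F \<union> F'"
    let ?t = "\<lambda>i. if i \<in> G then x i else 0"
    have G: "finite G" "tail_seq G x \<in> V" "tail_seq G x \<in> V'"
      using F F' by (auto simp: G_def)
    have tail: "tail_seq G x = (\<lambda>i. x i - ?t i)" by (auto simp: tail_seq_def)
    have "A (tail_seq G x) j = A x j - A ?t j" "B (tail_seq G x) j = B x j - B ?t j"
      unfolding tail using trunc[OF G(1)] linear_on_diff[OF A(1) x] linear_on_diff[OF B(1) x] by simp_all
    then have "A x j - B x j = A (tail_seq G x) j - B (tail_seq G x) j"
      using trunc[OF G(1)] by simp
    moreover have "cmod (A (tail_seq G x) j) < \<epsilon> / 2" "cmod (B (tail_seq G x) j) < \<epsilon> / 2"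
      using W(2) V(2) V'(2) G by blast+
    ultimately show ?thesis
      using norm_triangle_ineq4[of "A (tail_seq G x) j" "B (tail_seq G x) j"] by simp
  qed
  then have "cmod (A x j - B x j) \<le> 0" by (rule field_le_epsilon) simp
  then show "A x j = B x j" by simp
qed

end

section \<open>Transport to power series\<close>

lemma lin_comb_coeff_e: "coeff_e (lin_comb a F b G) = lin_comb a (coeff_e F) b (coeff_e G)"
  by (auto simp: coeff_e_def lin_comb_def algebra_simps)

lemma lin_comb_series_e: "series_e (lin_comb a x b y) = lin_comb a (series_e x) b (series_e y)"
  by (auto simp: series_e_eq lin_comb_def add_divide_distrib)

lemma lin_comb_coeff_K: "coeff_K (lin_comb a K b L) = lin_comb a (coeff_K K) b (coeff_K L)"
  by (auto simp: coeff_K_def lin_comb_def algebra_simps)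

lemma inj_coeff_K: "coeff_K K = coeff_K L \<Longrightarrow> K = L"
  by (auto simp: coeff_K_def fun_eq_iff mfact_nz)

lemma surj_coeff_K: "\<exists>K. coeff_K K = c"
proof
  show "coeff_K (\<lambda>(j, i). c (j, i) / complex_of_real (sqrt (mfact j) * sqrt (mfact i))) = c"
    by (auto simp: coeff_K_def fun_eq_iff mfact_nz)
qed

lemma T_op_eq: "T_op K F = series_e (mat_op (coeff_K K) (coeff_e F))"
  by (simp add: T_op_def mat_op_def)

lemma topspace_pullback_coeff_e:
  "topspace (pullback_topology UNIV coeff_e X) = {F. coeff_e F \<in> topspace X}"
  by (auto simp: topspace_pullback_topology)

lemma continuous_map_coeff_e: "continuous_map (pullback_topology UNIV coeff_e X) X coeff_e"
  using continuous_map_pullback[of X X id UNIV coeff_e] by simp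

lemma continuous_map_series_e: "continuous_map X (pullback_topology UNIV coeff_e X) series_e"
proof (rule continuous_map_pullback')
  have "coeff_e \<circ> series_e = id" by (simp add: fun_eq_iff coeff_e_series_e)
  then show "continuous_map X X (coeff_e \<circ> series_e)" by (metis continuous_map_id)
qed simp

lemma continuous_map_pullback_coeff_e_iff:
  "continuous_map (pullback_topology UNIV coeff_e X1) (pullback_topology UNIV coeff_e X2) T \<longleftrightarrow>
    continuous_map X1 X2 (coeff_e \<circ> T \<circ> series_e)" (is "?L \<longleftrightarrow> ?R")
proof
  assume ?L
  then show ?R
    by (blast intro: continuous_map_compose continuous_map_coeff_e continuous_map_series_e)
next
  assume ?R
  then have "continuous_map (pullback_topology UNIV coeff_e X1) (pullback_topology UNIV coeff_e X2)
      (series_e \<circ> (coeff_e \<circ> T \<circ> series_e) \<circ> coeff_e)"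
    by (blast intro: continuous_map_compose continuous_map_coeff_e continuous_map_series_e)
  then show ?L by (simp add: o_def series_e_coeff_e)
qed

lemma CL_pullback_iff:
  fixes X1 :: "(('d1::finite) midx \<Rightarrow> complex) topology" and X2 :: "(('d2::finite) midx \<Rightarrow> complex) topology"
  assumes "topspace X1 = E1"
  shows "T \<in> CL (pullback_topology UNIV coeff_e X1) (pullback_topology UNIV coeff_e X2) \<longleftrightarrow>
    T \<in> extensional {F. coeff_e F \<in> E1} \<and>
    linear_on E1 (coeff_e \<circ> T \<circ> series_e) \<and> continuous_map X1 X2 (coeff_e \<circ> T \<circ> series_e)"
proof -
  have "(\<forall>x\<in>{F. coeff_e F \<in> E1}. \<forall>y\<in>{F. coeff_e F \<in> E1}. \<forall>a b.
          T (lin_comb a x b y) = lin_comb a (T x) b (T y)) \<longleftrightarrow>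
      linear_on E1 (coeff_e \<circ> T \<circ> series_e)"
    unfolding linear_on_def
  proof (intro iffI ballI allI)
    fix x y a b assume "x \<in> E1" "y \<in> E1" and
      T: "\<forall>x\<in>{F. coeff_e F \<in> E1}. \<forall>y\<in>{F. coeff_e F \<in> E1}. \<forall>a b.
          T (lin_comb a x b y) = lin_comb a (T x) b (T y)"
    then show "(coeff_e \<circ> T \<circ> series_e) (lin_comb a x b y) =
        lin_comb a ((coeff_e \<circ> T \<circ> series_e) x) b ((coeff_e \<circ> T \<circ> series_e) y)"
      by (simp add: lin_comb_series_e lin_comb_coeff_e coeff_e_series_e)
  next
    fix F G a b
    assume FG: "F \<in> {F. coeff_e F \<in> E1}" "G \<in> {F. coeff_e F \<in> E1}" and
      T: "\<forall>x\<in>E1. \<forall>y\<in>E1. \<forall>a b. (coeff_e \<circ> T \<circ> series_e) (lin_comb a x b y) =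
        lin_comb a ((coeff_e \<circ> T \<circ> series_e) x) b ((coeff_e \<circ> T \<circ> series_e) y)"
    then have "(coeff_e \<circ> T \<circ> series_e) (lin_comb a (coeff_e F) b (coeff_e G)) =
        lin_comb a ((coeff_e \<circ> T \<circ> series_e) (coeff_e F)) b ((coeff_e \<circ> T \<circ> series_e) (coeff_e G))"
      by blast
    then have "coeff_e (T (lin_comb a F b G)) = coeff_e (lin_comb a (T F) b (T G))"
      by (simp add: lin_comb_series_e series_e_coeff_e lin_comb_coeff_e)
    then show "T (lin_comb a F b G) = lin_comb a (T F) b (T G)"
      by (metis series_e_coeff_e)
  qed
  then show ?thesis
    unfolding CL_def topspace_pullback_coeff_e assms continuous_map_pullback_coeff_e_iff by blast
qed


text \<open>\<open>T_op\<close> is the same sum on the whole domain as on polynomials and converges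
  there by \<open>summable\<close>. Its restriction \<open>R K\<close> is therefore itself the
  continuous extension, and the \<open>THE\<close> in \<open>T_ext\<close> can be evaluated.
  \<open>polynomials\<close> ties every extension to \<open>T_op\<close> on unit vectors, hence
  everywhere.\<close>

lemma kernel_iso_pullback:
  fixes X1 :: "(('d1::finite) midx \<Rightarrow> complex) topology" and X2 :: "(('d2::finite) midx \<Rightarrow> complex) topology"
  defines "V1 \<equiv> pullback_topology UNIV coeff_e X1" and "V2 \<equiv> pullback_topology UNIV coeff_e X2"
  assumes kc: "kernel_class X1 E1 N1 X2 E2 N2 S"
    and polynomials: "\<And>i :: 'd1 midx. series_e (unit_seq i) \<in> topspace (A_s p (Num 0))"
  shows "kernel_iso p {K. coeff_K K \<in> S} V1 V2"
proof -
  interpret kernel_class X1 E1 N1 X2 E2 N2 S by fact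
  note CL_iff = CL_pullback_iff[OF X1.topspace_eq]
  have top: "topspace V1 = {F. coeff_e F \<in> E1}"
    by (simp add: V1_def topspace_pullback_coeff_e X1.topspace_eq)
  have unit: "series_e (unit_seq i) \<in> topspace V1" for i
    by (simp add: top coeff_e_series_e unit_mem)
  \<comment> \<open>\<open>restrict\<close> supplies the value \<open>undefined\<close> outside the
    domain, as membership in \<open>CL\<close> demands.\<close>
  define R where "R K = restrict (T_op K) (topspace V1)" for K :: "('d2, 'd1) kernel"
  have R_mat: "(coeff_e \<circ> R K \<circ> series_e) x = mat_op (coeff_K K) x" if "x \<in> E1" for K x
    using that by (simp add: R_def top coeff_e_series_e T_op_eq)
  have R_CL: "R K \<in> CL V1 V2" if K: "coeff_K K \<in> S" for K
    unfolding V1_def V2_def CL_iff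
  proof (intro conjI)
    show "R K \<in> extensional {F. coeff_e F \<in> E1}" by (simp add: R_def top)
    show "linear_on E1 (coeff_e \<circ> R K \<circ> series_e)"
      using linear_mat_op[OF K] R_mat[of _ K] X1.lin_comb_mem by (simp add: linear_on_def)
    show "continuous_map X1 X2 (coeff_e \<circ> R K \<circ> series_e)"
      by (rule continuous_map_eq[OF continuous_mat_op[OF K]]) (simp add: R_mat[unfolded o_apply] X1.topspace_eq)
  qed
  have R_ext: "is_ext p V1 V2 K (R K)" if "coeff_K K \<in> S" for K
    using R_CL[OF that] by (simp add: is_ext_def R_def)
  have CL_eq: "T = T'"
    if "T \<in> CL V1 V2" "T' \<in> CL V1 V2" "\<And>i. T (series_e (unit_seq i)) = T' (series_e (unit_seq i))"
    for T T'
  proof (rule extensionalityI)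
    show "T \<in> extensional (topspace V1)" "T' \<in> extensional (topspace V1)"
      using that by (auto simp: CL_def)
    fix F assume F: "F \<in> topspace V1"
    have "(coeff_e \<circ> T \<circ> series_e) (coeff_e F) = (coeff_e \<circ> T' \<circ> series_e) (coeff_e F)"
    proof (rule eq_from_units)
      show "linear_on E1 (coeff_e \<circ> T \<circ> series_e)" "continuous_map X1 X2 (coeff_e \<circ> T \<circ> series_e)"
        "linear_on E1 (coeff_e \<circ> T' \<circ> series_e)" "continuous_map X1 X2 (coeff_e \<circ> T' \<circ> series_e)"
        using that(1,2) unfolding V1_def V2_def CL_iff by simp_all
      show "(coeff_e \<circ> T \<circ> series_e) (unit_seq i) = (coeff_e \<circ> T' \<circ> series_e) (unit_seq i)" for i
        using that(3)[of i] by simp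
      show "coeff_e F \<in> E1" using F by (simp add: top)
    qed
    then have "series_e (coeff_e (T F)) = series_e (coeff_e (T' F))"
      by (simp only: o_apply series_e_coeff_e)
    then show "T F = T' F" by (simp only: series_e_coeff_e)
  qed
  have ext_unit: "T (series_e (unit_seq i)) = T_op K (series_e (unit_seq i))" if "is_ext p V1 V2 K T" for T K i
    using that unit[of i] polynomials[of i] unfolding is_ext_def by blast
  have ext_unique: "T = R K" if "coeff_K K \<in> S" "is_ext p V1 V2 K T" for T K
    using that R_ext[OF that(1)] ext_unit[of K] by (intro CL_eq) (auto simp: is_ext_def)
  have T_ext: "T_ext p V1 V2 K = R K" if "coeff_K K \<in> S" for K
    unfolding T_ext_def by (rule the_equality) (rule R_ext[OF that], rule ext_unique[OF that])
  show ?thesis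
    unfolding kernel_iso_def
  proof (intro conjI ballI allI)
    fix K assume "K \<in> {K. coeff_K K \<in> S}"
    then show "\<exists>!T. is_ext p V1 V2 K T" using R_ext[of K] ext_unique[of K] by blast
  next
    fix K L a b assume KL: "K \<in> {K. coeff_K K \<in> S}" "L \<in> {K. coeff_K K \<in> S}"
    then show mem: "lin_comb a K b L \<in> {K. coeff_K K \<in> S}"
      by (simp add: lin_comb_coeff_K lin_comb_S)
    fix F assume F: "F \<in> topspace V1"
    show "T_ext p V1 V2 (lin_comb a K b L) F = lin_comb a (T_ext p V1 V2 K F) b (T_ext p V1 V2 L F)"
      using KL mem F
      by (simp add: T_ext R_def T_op_eq lin_comb_coeff_K mat_op_lin_comb lin_comb_series_e top)
  next
    show "bij_betw (T_ext p V1 V2) {K. coeff_K K \<in> S} (CL V1 V2)"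
      unfolding bij_betw_def
    proof (intro conjI equalityI subsetI inj_onI)
      fix K L assume KL: "K \<in> {K. coeff_K K \<in> S}" "L \<in> {K. coeff_K K \<in> S}"
        and "T_ext p V1 V2 K = T_ext p V1 V2 L"
      then have "R K = R L" by (simp add: T_ext)
      then have "mat_op (coeff_K K) (unit_seq i) = mat_op (coeff_K L) (unit_seq i)" for i
        using R_mat[OF unit_mem[of i], of K] R_mat[OF unit_mem[of i], of L] by simp
      then have "coeff_K K = coeff_K L" by (simp add: mat_op_unit fun_eq_iff)
      then show "K = L" by (rule inj_coeff_K)
    next
      fix T assume "T \<in> T_ext p V1 V2 ` {K. coeff_K K \<in> S}"
      then show "T \<in> CL V1 V2" using T_ext R_CL by force
    next
      fix T assume T: "T \<in> CL V1 V2"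
      \<comment> \<open>The only possible coefficients: column \<open>i\<close> is the image of the
        \<open>i\<close>-th unit vector.\<close>
      define c where "c = matrix_of (coeff_e \<circ> T \<circ> series_e)"
      have c: "c \<in> S"
        using T unfolding V1_def V2_def CL_iff c_def by (intro matrix_of_mem) auto
      obtain K where K: "coeff_K K = c" using surj_coeff_K by blast
      have "R K = T"
      proof (rule CL_eq)
        fix i
        have "mat_op c (unit_seq i) = coeff_e (T (series_e (unit_seq i)))"
          by (simp add: fun_eq_iff mat_op_unit c_def matrix_of_def)
        then show "R K (series_e (unit_seq i)) = T (series_e (unit_seq i))"
          using unit by (simp add: R_def T_op_eq K coeff_e_series_e series_e_coeff_e)
        show "R K \<in> CL V1 V2" using K c by (intro R_CL) simp
      qed (rule T)
      then show "T \<in> T_ext p V1 V2 ` {K. coeff_K K \<in> S}"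
        using K c T_ext[of K] by (intro image_eqI[of _ _ K]) auto
    qed
  qed
qed

section \<open>The four kernel spaces\<close>

context weight_family
begin

lemma nuclear_summable:
  obtains l where "\<And>i. 0 \<le> l i" "l summable_on UNIV" "\<And>i. u k i \<le> l i * u (Suc k) i"
proof -
  obtain l where l: "\<forall>i. 0 \<le> l i" "(\<lambda>i. l i powr 1) summable_on UNIV" "\<forall>i. u k i \<le> l i * u (Suc k) i"
    using nuclear[of 1 k] by auto
  then show ?thesis using that[of l] by simp
qed

lemma unit_seq_ind_space: "unit_seq i \<in> ind_space u"
proof -
  obtain k where k: "u k i > 0" using ex_pos by blast
  have "cmod (unit_seq i m) \<le> 1 / u k i * u k m" for m
    using k nonneg by (auto simp: unit_seq_def)
  then show ?thesis unfolding ind_space_def by blast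
qed

lemma unit_seq_proj_space: "unit_seq i \<in> proj_space u"
  unfolding proj_space_def
proof (intro CollectI allI)
  fix k
  have "cmod (unit_seq i m) * u k m \<le> u k i" for m
    using nonneg by (auto simp: unit_seq_def)
  then show "\<exists>C. \<forall>m. cmod (unit_seq i m) * u k m \<le> C" by blast
qed

text \<open>The step from \<open>k\<close> to \<open>Suc k\<close> gains the factor
  \<open>l\<close>, which exceeds a positive threshold at finitely many indices only; the rest of
  \<open>x\<close> is small in the step \<open>Suc k\<close>.\<close>

lemma ind_tail_small:
  assumes "x \<in> ind_space u" "ind_nbhd u V"
  shows "\<exists>F. finite F \<and> (\<forall>G. F \<subseteq> G \<longrightarrow> tail_seq G x \<in> V)"
proof -
  obtain k C where C: "0 \<le> C" "\<And>i. cmod (x i) \<le> C * u k i"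
    using assms(1) by (rule ind_space_nonnegE) blast
  obtain l where l: "\<And>i. 0 \<le> l i" "l summable_on UNIV" "\<And>i. u k i \<le> l i * u (Suc k) i"
    by (rule nuclear_summable) blast
  obtain \<epsilon> where e: "\<epsilon> > 0" "\<And>x. (\<forall>i. cmod (x i) \<le> \<epsilon> * u (Suc k) i) \<Longrightarrow> x \<in> V"
    using assms(2) unfolding ind_nbhd_def by blast
  \<comment> \<open>\<open>C + 1\<close> in place of \<open>C\<close> avoids a division by
    zero.\<close>
  define F where "F = {i. \<epsilon> / (C + 1) < l i}"
  have "finite F" unfolding F_def using e(1) C(1) l by (intro summable_on_finite_superlevel) auto
  moreover have "tail_seq G x \<in> V" if G: "F \<subseteq> G" for G
  proof (intro e(2) allI)
    fix i
    show "cmod (tail_seq G x i) \<le> \<epsilon> * u (Suc k) i"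
    proof (cases "i \<in> G")
      case True
      then show ?thesis using e(1) nonneg by (simp add: tail_seq_def)
    next
      case False
      then have "l i \<le> \<epsilon> / (C + 1)" using G unfolding F_def by (metis (mono_tags) mem_Collect_eq not_le subsetD)
      then have "(C + 1) * l i \<le> \<epsilon>" using C(1) by (simp add: field_simps)
      then have Cl: "C * l i \<le> \<epsilon>" using l(1)[of i] by (simp add: algebra_simps)
      have "cmod (x i) \<le> C * (l i * u (Suc k) i)"
        by (rule order_trans[OF C(2)]) (intro mult_left_mono l C)
      also have "\<dots> \<le> \<epsilon> * u (Suc k) i"
        using mult_right_mono[OF Cl nonneg] by (simp add: mult.assoc)
      finally show ?thesis using False by (simp add: tail_seq_def)
    qed
  qed
  ultimately show ?thesis by blast
qed

text \<open>Dual to \<open>ind_tail_small\<close>: the bound of \<open>x\<close> at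
  \<open>u (Suc k)\<close>, together with the factor \<open>l\<close>, makes the tail small at
  \<open>u k\<close>.\<close>

lemma proj_tail_small:
  assumes "x \<in> proj_space u" "proj_nbhd u V"
  shows "\<exists>F. finite F \<and> (\<forall>G. F \<subseteq> G \<longrightarrow> tail_seq G x \<in> V)"
proof -
  obtain k \<epsilon> where V: "\<epsilon> > 0" "V = {x \<in> proj_space u. \<forall>i. cmod (x i) * u k i \<le> \<epsilon>}"
    using assms(2) unfolding proj_nbhd_def by blast
  obtain l where l: "\<And>i. 0 \<le> l i" "l summable_on UNIV" "\<And>i. u k i \<le> l i * u (Suc k) i"
    by (rule nuclear_summable) blast
  obtain C where C: "0 \<le> C" "\<And>i. cmod (x i) * u (Suc k) i \<le> C"
    using assms(1) by (rule proj_spaceE) blast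
  define F where "F = {i. \<epsilon> / (C + 1) < l i}"
  have "finite F" unfolding F_def using V(1) C(1) l by (intro summable_on_finite_superlevel) auto
  moreover have "tail_seq G x \<in> V" if G: "F \<subseteq> G" for G
  proof -
    have "cmod (tail_seq G x i) * u k i \<le> \<epsilon>" for i
    proof (cases "i \<in> G")
      case True
      then show ?thesis using V(1) by (simp add: tail_seq_def)
    next
      case False
      then have "l i \<le> \<epsilon> / (C + 1)" using G unfolding F_def by (metis (mono_tags) mem_Collect_eq not_le subsetD)
      then have "(C + 1) * l i \<le> \<epsilon>" using C(1) by (simp add: field_simps)
      then have Cl: "C * l i \<le> \<epsilon>" using l(1)[of i] by (simp add: algebra_simps)
      have "cmod (x i) * u k i \<le> cmod (x i) * (l i * u (Suc k) i)"
        by (intro mult_left_mono l) simp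
      also have "\<dots> = cmod (x i) * u (Suc k) i * l i" by simp
      also have "\<dots> \<le> C * l i" by (intro mult_right_mono C l)
      finally show ?thesis using False Cl by (simp add: tail_seq_def)
    qed
    moreover have "tail_seq G x \<in> proj_space u"
      unfolding proj_space_def
    proof (intro CollectI allI)
      fix m
      obtain D where D: "0 \<le> D" "\<And>i. cmod (x i) * u m i \<le> D"
        using assms(1) by (rule proj_spaceE) blast
      then have "\<forall>i. cmod (tail_seq G x i) * u m i \<le> D" by (simp add: tail_seq_def)
      then show "\<exists>D. \<forall>i. cmod (tail_seq G x i) * u m i \<le> D" by blast
    qed
    ultimately show ?thesis by (simp add: V(2))
  qed
  ultimately show ?thesis by blast
qed

text \<open>The strip where one coordinate is small is absolutely convex, and on each step this
  coordinate is bounded by a multiple of \<open>u k j\<close>; so it contains a ball of every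
  step.\<close>

lemma ind_coordinate_small:
  assumes "0 < \<epsilon>"
  shows "\<exists>W. ind_nbhd u W \<and> (\<forall>y\<in>W. cmod (y j) < \<epsilon>)"
proof (intro exI conjI ballI)
  define W where "W = {y \<in> ind_space u. cmod (y j) < \<epsilon>}"
  show "cmod (y j) < \<epsilon>" if "y \<in> W" for y using that by (simp add: W_def)
  show "ind_nbhd u W"
    unfolding ind_nbhd_def abs_convex_def
  proof (intro conjI ballI allI impI)
    fix x y a b assume xy: "x \<in> W" "y \<in> W" and ab: "cmod a + cmod b \<le> 1"
    have "(\<lambda>i. a * x i + b * y i) \<in> ind_space u"
      using lin_comb_ind_space xy by (auto simp: W_def lin_comb_def)
    moreover have "cmod (a * x j + b * y j) < \<epsilon>"
    proof -
      define t where "t = max (cmod (x j)) (cmod (y j))"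
      have "cmod (a * x j + b * y j) \<le> cmod a * cmod (x j) + cmod b * cmod (y j)"
        by (rule order_trans[OF norm_triangle_ineq]) (simp add: norm_mult)
      also have "\<dots> \<le> cmod a * t + cmod b * t"
        by (intro add_mono mult_left_mono) (auto simp: t_def)
      also have "\<dots> = (cmod a + cmod b) * t" by (simp add: distrib_right)
      also have "\<dots> \<le> 1 * t"
        using ab by (intro mult_right_mono) (auto simp: t_def le_max_iff_disj)
      also have "\<dots> < \<epsilon>" using xy by (auto simp: t_def W_def)
      finally show ?thesis .
    qed
    ultimately show "(\<lambda>i. a * x i + b * y i) \<in> W" by (simp add: W_def)
  next
    fix k
    \<comment> \<open>The added 1 allows \<open>u k j = 0\<close> and makes the resulting inequality
      strict.\<close>
    define d where "d = \<epsilon> / (u k j + 1)"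
    have d: "d > 0" "d * u k j < \<epsilon>"
      using assms nonneg[of k j] by (auto simp: d_def field_simps add_nonneg_pos)
    have "x \<in> W" if x: "\<forall>i. cmod (x i) \<le> d * u k i" for x
      using le_less_trans[OF x[rule_format, of j] d(2)] x by (auto simp: W_def ind_space_def)
    then show "\<exists>\<epsilon>>0. \<forall>x. (\<forall>i. cmod (x i) \<le> \<epsilon> * u k i) \<longrightarrow> x \<in> W" using d(1) by blast
  qed (auto simp: W_def)
qed

lemma proj_coordinate_small:
  assumes "0 < \<epsilon>"
  shows "\<exists>W. proj_nbhd u W \<and> (\<forall>y\<in>W. cmod (y j) < \<epsilon>)"
proof -
  obtain k where k: "u k j > 0" using ex_pos by blast
  define W where "W = {y \<in> proj_space u. \<forall>i. cmod (y i) * u k i \<le> \<epsilon> * u k j / 2}"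
  have "proj_nbhd u W"
    unfolding proj_nbhd_def W_def using assms k by (intro exI[of _ k] exI[of _ "\<epsilon> * u k j / 2"]) auto
  moreover have "cmod (y j) < \<epsilon>" if "y \<in> W" for y
  proof -
    have "cmod (y j) * u k j \<le> \<epsilon> / 2 * u k j" using that by (simp add: W_def)
    then have "cmod (y j) \<le> \<epsilon> / 2" using k by simp
    then show ?thesis using assms by simp
  qed
  ultimately show ?thesis by blast
qed

text \<open>The neighbourhood bounds, for each \<open>n\<close>, one coordinate at which \<open>y n\<close> exceeds \<open>u n\<close>.\<close>

lemma ind_nbhd_avoiding:
  assumes "\<And>n. \<not> (\<forall>j. cmod (y n j) \<le> u n j)"
  obtains V where "ind_nbhd u V" "\<And>n. y n \<notin> V"
proof -
  obtain j where j: "\<And>n. u n (j n) < cmod (y n (j n))"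
    using assms unfolding not_all not_le by metis
  define V where "V = {x \<in> ind_space u. \<forall>n. cmod (x (j n)) < cmod (y n (j n))}"
  have "ind_nbhd u V"
    unfolding ind_nbhd_def abs_convex_def
  proof (intro conjI ballI allI impI)
    fix x z a b assume xz: "x \<in> V" "z \<in> V" and ab: "cmod a + cmod b \<le> 1"
    have "(\<lambda>i. a * x i + b * z i) \<in> ind_space u"
      using lin_comb_ind_space xz by (auto simp: V_def lin_comb_def)
    moreover have "cmod (a * x (j n) + b * z (j n)) < cmod (y n (j n))" for n
    proof -
      define t where "t = max (cmod (x (j n))) (cmod (z (j n)))"
      have "cmod (a * x (j n) + b * z (j n)) \<le> cmod a * cmod (x (j n)) + cmod b * cmod (z (j n))"
        by (rule order_trans[OF norm_triangle_ineq]) (simp add: norm_mult)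
      also have "\<dots> \<le> cmod a * t + cmod b * t"
        by (intro add_mono mult_left_mono) (auto simp: t_def)
      also have "\<dots> = (cmod a + cmod b) * t" by (simp add: distrib_right)
      also have "\<dots> \<le> 1 * t"
        using ab by (intro mult_right_mono) (auto simp: t_def le_max_iff_disj)
      also have "\<dots> < cmod (y n (j n))" using xz by (auto simp: t_def V_def)
      finally show ?thesis .
    qed
    ultimately show "(\<lambda>i. a * x i + b * z i) \<in> V" by (simp add: V_def)
  next
    fix k
    define e where "e n = cmod (y n (j n)) / (u k (j n) + 1)" for n
    \<comment> \<open>Only the finitely many \<open>n < k\<close> restrict the radius. For
      \<open>n \<ge> k\<close> monotonicity gives \<open>u k \<le> u n\<close>, and
      \<open>y n\<close> already exceeds \<open>u n\<close> at \<open>j n\<close>, so the inserted 1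
      is enough for them.\<close>
    define d where "d = Min (insert 1 (e ` {..<k}))"
    have y_pos: "0 < cmod (y n (j n))" for n using le_less_trans[OF nonneg j] .
    have u1: "0 < u k i + 1" for i using nonneg[of k i] by linarith
    have d: "d > 0" "d \<le> 1" "\<And>n. n < k \<Longrightarrow> d \<le> e n"
      using y_pos u1 by (auto simp: d_def e_def)
    have small: "d * u k (j n) < cmod (y n (j n))" for n
    proof (cases "n < k")
      case True
      have "d * u k (j n) \<le> e n * u k (j n)"
        using d(3)[OF True] nonneg by (rule mult_right_mono)
      also have "\<dots> < cmod (y n (j n))"
        using y_pos[of n] u1[of "j n"] by (simp add: e_def field_simps)
      finally show ?thesis .
    next
      case False
      have "d * u k (j n) \<le> 1 * u k (j n)" using d(2) nonneg by (rule mult_right_mono)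
      also have "\<dots> \<le> u n (j n)" using mono[of k n] False by simp
      also have "\<dots> < cmod (y n (j n))" by (rule j)
      finally show ?thesis .
    qed
    have "x \<in> V" if x: "\<forall>i. cmod (x i) \<le> d * u k i" for x
      using x small by (auto simp: V_def ind_space_def intro: le_less_trans)
    then show "\<exists>\<epsilon>>0. \<forall>x. (\<forall>i. cmod (x i) \<le> \<epsilon> * u k i) \<longrightarrow> x \<in> V" using d(1) by blast
  qed (auto simp: V_def)
  moreover have "y n \<notin> V" for n by (auto simp: V_def)
  ultimately show ?thesis using that by blast
qed

end

text \<open>In these names the first word is the kind of limit of the domain, with weights
  \<open>u\<close>, and the second that of the target, with weights \<open>v\<close>. The common
  \<open>k\<close> in this class and the next is no restriction, as both families increase.\<close>

definition kernels_proj_ind :: "(nat \<Rightarrow> 'j \<Rightarrow> real) \<Rightarrow> (nat \<Rightarrow> 'i \<Rightarrow> real) \<Rightarrow> ('j \<times> 'i \<Rightarrow> complex) set"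
  where "kernels_proj_ind v u = ind_space (\<lambda>k (j, i). v k j * u k i)"

definition kernels_ind_proj :: "(nat \<Rightarrow> 'j \<Rightarrow> real) \<Rightarrow> (nat \<Rightarrow> 'i \<Rightarrow> real) \<Rightarrow> ('j \<times> 'i \<Rightarrow> complex) set"
  where "kernels_ind_proj v u = proj_space (\<lambda>k (j, i). v k j * u k i)"

text \<open>Absorbing the weight \<open>u l\<close> into \<open>c\<close> and using weights that
  ignore \<open>i\<close> turns the inner part of the nested quantifiers into an
  \<open>ind_space\<close>, so that closure under linear combinations is inherited.\<close>

definition kernels_ind_ind :: "(nat \<Rightarrow> 'j \<Rightarrow> real) \<Rightarrow> (nat \<Rightarrow> 'i \<Rightarrow> real) \<Rightarrow> ('j \<times> 'i \<Rightarrow> complex) set"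
  where "kernels_ind_ind v u =
    {c. \<forall>l. (\<lambda>(j, i). c (j, i) * of_real (u l i)) \<in> ind_space (\<lambda>k (j, i). v k j)}"

definition kernels_proj_proj :: "(nat \<Rightarrow> 'j \<Rightarrow> real) \<Rightarrow> (nat \<Rightarrow> 'i \<Rightarrow> real) \<Rightarrow> ('j \<times> 'i \<Rightarrow> complex) set"
  where "kernels_proj_proj v u =
    {c. \<forall>k. (\<lambda>(j, i). c (j, i) * of_real (v k j)) \<in> ind_space (\<lambda>l (j, i). u l i)}"

text \<open>For \<open>w = 0\<close> the row may fail to be summable; the estimate survives because
  \<open>mat_op\<close> is multiplied by \<open>w\<close>. This is why summability is claimed for
  positive \<open>w\<close> only.\<close>

lemma row_estimate:
  assumes "l summable_on UNIV" "\<And>i. 0 \<le> l i" "0 \<le> B" "0 \<le> w"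
    and le: "\<And>i. cmod (c (j, i)) * cmod (x i) * w \<le> B * l i"
  shows "cmod (mat_op c x j) * w \<le> B * (\<Sum>\<^sub>\<infinity>i. l i)"
    and "0 < w \<Longrightarrow> (\<lambda>i. c (j, i) * x i) summable_on UNIV"
proof -
  have B: "cmod (c (j, i) * x i) \<le> B / w * l i" if "0 < w" for i
    using le[of i] that by (simp add: norm_mult field_simps)
  show "(\<lambda>i. c (j, i) * x i) summable_on UNIV" if "0 < w"
    using mat_op_bound(1)[OF assms(1) B[OF that]] .
  have "0 \<le> (\<Sum>\<^sub>\<infinity>i. l i)" using assms(2) by (intro infsum_nonneg) auto
  then show "cmod (mat_op c x j) * w \<le> B * (\<Sum>\<^sub>\<infinity>i. l i)"
    using mat_op_bound(2)[OF assms(1), of c j x "B / w"] B assms(3,4)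
    by (cases "w = 0") (auto simp: field_simps)
qed

text \<open>Reads off a matrix entry of size \<open>z\<close> by testing multiples \<open>a\<close>
  of a unit vector with seminorm \<open>s\<close>. If \<open>s = 0\<close>, all multiples are
  allowed and force \<open>z \<le> 0\<close>; otherwise \<open>a = t / s\<close> is the largest
  admissible one.\<close>

lemma scaling_bound:
  fixes s t z w :: real
  assumes "0 \<le> s" "0 < t" "\<And>a. 0 < a \<Longrightarrow> a * s \<le> t \<Longrightarrow> a * z \<le> w"
  shows "z * t \<le> w * s"
proof (cases "s = 0")
  case True
  have "z \<le> 0"
  proof (rule ccontr)
    assume "\<not> z \<le> 0"
    \<comment> \<open>This multiple produces the value \<open>abs w + 1\<close>, which exceeds
      \<open>w\<close>.\<close>
    then have "(\<bar>w\<bar> + 1) / z * z \<le> w" using assms True by (intro assms(3)) auto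
    then show False using \<open>\<not> z \<le> 0\<close> by simp
  qed
  then show ?thesis using True assms(2) by (simp add: mult_nonpos_nonneg)
next
  case False
  then have "t / s * z \<le> w" using assms(1,2) by (intro assms(3)) auto
  then show ?thesis using False assms(1) by (simp add: field_simps)
qed

lemma scaled_radius: "0 \<le> B \<Longrightarrow> 0 < \<epsilon> \<Longrightarrow> 0 < \<epsilon> / (B + 1) \<and> B * (\<epsilon> / (B + 1)) \<le> (\<epsilon>::real)"
  by (simp add: field_simps add_nonneg_pos)

locale weight_pair = V: weight_family v + U: weight_family u
  for v :: "nat \<Rightarrow> 'j \<Rightarrow> real" and u :: "nat \<Rightarrow> 'i \<Rightarrow> real"
begin

sublocale VU: increasing_weights "\<lambda>k (j, i). v k j * u k i"
  by standard (auto intro: mult_mono mult_nonneg_nonneg V.incr U.incr V.nonneg U.nonneg)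

text \<open>The weights of this family and of the next ignore one index and so need not be nuclear;
  this is why \<open>increasing_weights\<close> is separated from
  \<open>weight_family\<close>.\<close>

sublocale V_const: increasing_weights "\<lambda>k (j, i :: 'i). v k j"
  by standard (auto intro: V.incr V.nonneg)

sublocale U_const: increasing_weights "\<lambda>k (j :: 'j, i). u k i"
  by standard (auto intro: U.incr U.nonneg)

lemma lin_comb_kernels_ind_ind:
  "c \<in> kernels_ind_ind v u \<Longrightarrow> d \<in> kernels_ind_ind v u \<Longrightarrow> lin_comb a c b d \<in> kernels_ind_ind v u"
  unfolding kernels_ind_ind_def
proof (intro CollectI allI, elim CollectE)
  fix l
  assume "\<forall>l. (\<lambda>(j, i). c (j, i) * of_real (u l i)) \<in> ind_space (\<lambda>k (j, i). v k j)"
    "\<forall>l. (\<lambda>(j, i). d (j, i) * of_real (u l i)) \<in> ind_space (\<lambda>k (j, i). v k j)"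
  then have "lin_comb a (\<lambda>(j, i). c (j, i) * of_real (u l i)) b (\<lambda>(j, i). d (j, i) * of_real (u l i))
      \<in> ind_space (\<lambda>k (j, i). v k j)"
    by (intro V_const.lin_comb_ind_space) auto
  also have "lin_comb a (\<lambda>(j, i). c (j, i) * of_real (u l i)) b (\<lambda>(j, i). d (j, i) * of_real (u l i))
      = (\<lambda>(j, i). lin_comb a c b d (j, i) * of_real (u l i))"
    by (auto simp: lin_comb_def algebra_simps)
  finally show "(\<lambda>(j, i). lin_comb a c b d (j, i) * of_real (u l i)) \<in> ind_space (\<lambda>k (j, i). v k j)" .
qed

lemma lin_comb_kernels_proj_proj:
  "c \<in> kernels_proj_proj v u \<Longrightarrow> d \<in> kernels_proj_proj v u \<Longrightarrow> lin_comb a c b d \<in> kernels_proj_proj v u"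
  unfolding kernels_proj_proj_def
proof (intro CollectI allI, elim CollectE)
  fix k
  assume "\<forall>k. (\<lambda>(j, i). c (j, i) * of_real (v k j)) \<in> ind_space (\<lambda>l (j, i). u l i)"
    "\<forall>k. (\<lambda>(j, i). d (j, i) * of_real (v k j)) \<in> ind_space (\<lambda>l (j, i). u l i)"
  then have "lin_comb a (\<lambda>(j, i). c (j, i) * of_real (v k j)) b (\<lambda>(j, i). d (j, i) * of_real (v k j))
      \<in> ind_space (\<lambda>l (j, i). u l i)"
    by (intro U_const.lin_comb_ind_space) auto
  also have "lin_comb a (\<lambda>(j, i). c (j, i) * of_real (v k j)) b (\<lambda>(j, i). d (j, i) * of_real (v k j))
      = (\<lambda>(j, i). lin_comb a c b d (j, i) * of_real (v k j))"
    by (auto simp: lin_comb_def algebra_simps)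
  finally show "(\<lambda>(j, i). lin_comb a c b d (j, i) * of_real (v k j)) \<in> ind_space (\<lambda>l (j, i). u l i)" .
qed

lemma kernels_ind_indE:
  assumes "c \<in> kernels_ind_ind v u"
  obtains k C where "0 \<le> C" "\<And>j i. cmod (c (j, i)) * u l i \<le> C * v k j"
proof -
  have "(\<lambda>(j, i). c (j, i) * of_real (u l i)) \<in> ind_space (\<lambda>k (j, i). v k j)"
    using assms by (simp add: kernels_ind_ind_def)
  then obtain k C where C: "0 \<le> C"
      "\<And>p. cmod ((\<lambda>(j, i). c (j, i) * of_real (u l i)) p) \<le> C * (\<lambda>(j, i). v k j) p"
    by (rule V_const.ind_space_nonnegE) blast
  have "cmod (c (j, i)) * u l i \<le> C * v k j" for j i
    using C(2)[of "(j, i)"] U.nonneg by (simp add: norm_mult)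
  then show ?thesis using that C(1) by blast
qed

lemma kernels_ind_indI:
  assumes "\<And>l. \<exists>k C. \<forall>j i. cmod (c (j, i)) * u l i \<le> C * v k j"
  shows "c \<in> kernels_ind_ind v u"
  using assms U.nonneg by (simp add: kernels_ind_ind_def ind_space_def norm_mult)

lemma kernels_proj_projE:
  assumes "c \<in> kernels_proj_proj v u"
  obtains l C where "0 \<le> C" "\<And>j i. cmod (c (j, i)) * v k j \<le> C * u l i"
proof -
  have "(\<lambda>(j, i). c (j, i) * of_real (v k j)) \<in> ind_space (\<lambda>l (j, i). u l i)"
    using assms by (simp add: kernels_proj_proj_def)
  then obtain l C where C: "0 \<le> C"
      "\<And>p. cmod ((\<lambda>(j, i). c (j, i) * of_real (v k j)) p) \<le> C * (\<lambda>(j, i). u l i) p"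
    by (rule U_const.ind_space_nonnegE) blast
  have "cmod (c (j, i)) * v k j \<le> C * u l i" for j i
    using C(2)[of "(j, i)"] V.nonneg by (simp add: norm_mult)
  then show ?thesis using that C(1) by blast
qed

lemma kernels_proj_projI:
  assumes "\<And>k. \<exists>l C. \<forall>j i. cmod (c (j, i)) * v k j \<le> C * u l i"
  shows "c \<in> kernels_proj_proj v u"
  using assms V.nonneg by (simp add: kernels_proj_proj_def ind_space_def norm_mult)

lemma kernels_proj_indE:
  assumes "c \<in> kernels_proj_ind v u"
  obtains k C where "0 \<le> C" "\<And>j i. cmod (c (j, i)) \<le> C * (v k j * u k i)"
proof -
  obtain k C where "0 \<le> C" "\<And>p. cmod (c p) \<le> C * (\<lambda>(j, i). v k j * u k i) p"
    using assms unfolding kernels_proj_ind_def by (rule VU.ind_space_nonnegE) blast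
  then show ?thesis using that[of C k] by fastforce
qed

lemma kernels_proj_indI:
  assumes "\<And>j i. cmod (c (j, i)) \<le> C * (v k j * u k i)"
  shows "c \<in> kernels_proj_ind v u"
  using assms unfolding kernels_proj_ind_def ind_space_def
  by (intro CollectI exI[of _ k] exI[of _ C]) auto

lemma kernels_ind_projE:
  assumes "c \<in> kernels_ind_proj v u"
  obtains C where "0 \<le> C" "\<And>j i. cmod (c (j, i)) * (v k j * u l i) \<le> C"
proof -
  define m where "m = max k l"
  obtain C where C: "0 \<le> C" "\<And>p. cmod (c p) * (\<lambda>(j, i). v m j * u m i) p \<le> C"
    using assms unfolding kernels_ind_proj_def by (rule VU.proj_spaceE) blast
  have "cmod (c (j, i)) * (v k j * u l i) \<le> C" for j i
  proof -
    have "cmod (c (j, i)) * (v k j * u l i) \<le> cmod (c (j, i)) * (v m j * u m i)"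
      by (intro mult_left_mono mult_mono V.mono U.mono V.nonneg U.nonneg) (auto simp: m_def)
    then show ?thesis using C(2)[of "(j, i)"] by simp
  qed
  then show ?thesis using that C(1) by blast
qed

lemma kernels_ind_projI:
  assumes "\<And>k. \<exists>C. \<forall>j i. cmod (c (j, i)) * (v k j * u k i) \<le> C"
  shows "c \<in> kernels_ind_proj v u"
  using assms unfolding kernels_ind_proj_def proj_space_def by simp

text \<open>Nuclearity of \<open>u\<close> pays for the sum over \<open>i\<close>. The constants do
  not depend on \<open>x\<close>, \<open>M\<close> or \<open>j\<close>, so the bound yields both the
  range and the continuity of \<open>mat_op c\<close>. In this and the next three estimates, which
  steps are given and which are found mirrors the nested limits of the matrix class.\<close>

lemma proj_ind_estimate:
  assumes "c \<in> kernels_proj_ind v u"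
  obtains k m B where "0 \<le> B"
    "\<And>x M j. 0 \<le> M \<Longrightarrow> (\<And>i. cmod (x i) * u m i \<le> M) \<Longrightarrow>
      (\<lambda>i. c (j, i) * x i) summable_on UNIV \<and> cmod (mat_op c x j) \<le> B * M * v k j"
proof -
  obtain k C where C: "0 \<le> C" "\<And>j i. cmod (c (j, i)) \<le> C * (v k j * u k i)"
    using assms by (rule kernels_proj_indE) blast
  obtain l where l: "\<And>i. 0 \<le> l i" "l summable_on UNIV" "\<And>i. u k i \<le> l i * u (Suc k) i"
    by (rule U.nuclear_summable) blast
  define L where "L = (\<Sum>\<^sub>\<infinity>i. l i)"
  have L: "0 \<le> L" unfolding L_def using l(1) by (intro infsum_nonneg) auto
  show ?thesis
  proof (rule that[of "C * L" "Suc k" k])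
    show "0 \<le> C * L" using C(1) L by simp
    fix x :: "'i \<Rightarrow> complex" and M :: real and j
    assume M: "0 \<le> M" and x: "\<And>i. cmod (x i) * u (Suc k) i \<le> M"
    have "cmod (c (j, i)) * cmod (x i) * 1 \<le> (C * M * v k j) * l i" for i
    proof -
      have "cmod (c (j, i)) * cmod (x i) \<le> C * (v k j * u k i) * cmod (x i)"
        by (intro mult_right_mono C) simp
      also have "\<dots> \<le> C * (v k j * (l i * u (Suc k) i)) * cmod (x i)"
        by (intro mult_right_mono mult_left_mono C l V.nonneg) simp
      also have "\<dots> = (C * v k j * l i) * (cmod (x i) * u (Suc k) i)" by (simp add: mult_ac)
      also have "\<dots> \<le> (C * v k j * l i) * M"
        by (intro mult_left_mono x mult_nonneg_nonneg C l V.nonneg)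
      finally show ?thesis by (simp add: mult_ac)
    qed
    note * = row_estimate[OF l(2,1) _ _ this]
    have "0 \<le> C * M * v k j" using C(1) M V.nonneg by simp
    then show "(\<lambda>i. c (j, i) * x i) summable_on UNIV \<and> cmod (mat_op c x j) \<le> C * L * M * v k j"
      using * by (simp add: L_def mult_ac)
  qed
qed

text \<open>The step \<open>m\<close> of the vector is prescribed and \<open>k\<close> depends on
  it: each step of the domain is sent into some step of the target.\<close>

lemma ind_ind_estimate:
  assumes "c \<in> kernels_ind_ind v u"
  obtains k B where "0 \<le> B"
    "\<And>x M j. 0 \<le> M \<Longrightarrow> (\<And>i. cmod (x i) \<le> M * u m i) \<Longrightarrow>
      (\<lambda>i. c (j, i) * x i) summable_on UNIV \<and> cmod (mat_op c x j) \<le> B * M * v k j"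
proof -
  obtain k C where C: "0 \<le> C" "\<And>j i. cmod (c (j, i)) * u (Suc m) i \<le> C * v k j"
    using assms by (rule kernels_ind_indE) blast
  obtain l where l: "\<And>i. 0 \<le> l i" "l summable_on UNIV" "\<And>i. u m i \<le> l i * u (Suc m) i"
    by (rule U.nuclear_summable) blast
  define L where "L = (\<Sum>\<^sub>\<infinity>i. l i)"
  have L: "0 \<le> L" unfolding L_def using l(1) by (intro infsum_nonneg) auto
  show ?thesis
  proof (rule that[of "C * L" k])
    show "0 \<le> C * L" using C(1) L by simp
    fix x :: "'i \<Rightarrow> complex" and M :: real and j
    assume M: "0 \<le> M" and x: "\<And>i. cmod (x i) \<le> M * u m i"
    have "cmod (c (j, i)) * cmod (x i) * 1 \<le> (C * M * v k j) * l i" for i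
    proof -
      have "cmod (x i) \<le> M * (l i * u (Suc m) i)"
        by (rule order_trans[OF x]) (intro mult_left_mono l M)
      then have "cmod (c (j, i)) * cmod (x i) \<le> cmod (c (j, i)) * (M * (l i * u (Suc m) i))"
        by (rule mult_left_mono) simp
      also have "\<dots> = (M * l i) * (cmod (c (j, i)) * u (Suc m) i)" by (simp add: mult_ac)
      also have "\<dots> \<le> (M * l i) * (C * v k j)"
        by (intro mult_left_mono C mult_nonneg_nonneg M l)
      finally show ?thesis by (simp add: mult_ac)
    qed
    note * = row_estimate[OF l(2,1) _ _ this]
    have "0 \<le> C * M * v k j" using C(1) M V.nonneg by simp
    then show "(\<lambda>i. c (j, i) * x i) summable_on UNIV \<and> cmod (mat_op c x j) \<le> C * L * M * v k j"
      using * by (simp add: L_def mult_ac)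
  qed
qed

text \<open>Here \<open>k\<close>, the seminorm of the target, is prescribed and the seminorm
  \<open>m\<close> of the domain depends on it.\<close>

lemma proj_proj_estimate:
  assumes "c \<in> kernels_proj_proj v u"
  obtains m B where "0 \<le> B"
    "\<And>x M j. 0 \<le> M \<Longrightarrow> (\<And>i. cmod (x i) * u m i \<le> M) \<Longrightarrow>
      (0 < v k j \<longrightarrow> (\<lambda>i. c (j, i) * x i) summable_on UNIV) \<and> cmod (mat_op c x j) * v k j \<le> B * M"
proof -
  obtain m C where C: "0 \<le> C" "\<And>j i. cmod (c (j, i)) * v k j \<le> C * u m i"
    using assms by (rule kernels_proj_projE) blast
  obtain l where l: "\<And>i. 0 \<le> l i" "l summable_on UNIV" "\<And>i. u m i \<le> l i * u (Suc m) i"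
    by (rule U.nuclear_summable) blast
  define L where "L = (\<Sum>\<^sub>\<infinity>i. l i)"
  have L: "0 \<le> L" unfolding L_def using l(1) by (intro infsum_nonneg) auto
  show ?thesis
  proof (rule that[of "C * L" "Suc m"])
    show "0 \<le> C * L" using C(1) L by simp
    fix x :: "'i \<Rightarrow> complex" and M :: real and j
    assume M: "0 \<le> M" and x: "\<And>i. cmod (x i) * u (Suc m) i \<le> M"
    have "cmod (c (j, i)) * cmod (x i) * v k j \<le> (C * M) * l i" for i
    proof -
      have "cmod (c (j, i)) * cmod (x i) * v k j = (cmod (c (j, i)) * v k j) * cmod (x i)" by simp
      also have "\<dots> \<le> C * u m i * cmod (x i)" by (intro mult_right_mono C) simp
      also have "\<dots> \<le> C * (l i * u (Suc m) i) * cmod (x i)"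
        by (intro mult_right_mono mult_left_mono C l) simp
      also have "\<dots> = (C * l i) * (cmod (x i) * u (Suc m) i)" by (simp add: mult_ac)
      also have "\<dots> \<le> (C * l i) * M" by (intro mult_left_mono x mult_nonneg_nonneg C l)
      finally show ?thesis by (simp add: mult_ac)
    qed
    from row_estimate[OF l(2,1) _ V.nonneg this]
    show "(0 < v k j \<longrightarrow> (\<lambda>i. c (j, i) * x i) summable_on UNIV) \<and>
        cmod (mat_op c x j) * v k j \<le> C * L * M"
      using C(1) M by (simp add: L_def mult_ac)
  qed
qed

text \<open>Both the step \<open>m\<close> of the domain and the seminorm \<open>k\<close> of the
  target are prescribed; only the constant is found.\<close>

lemma ind_proj_estimate:
  assumes "c \<in> kernels_ind_proj v u"
  obtains B where "0 \<le> B"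
    "\<And>x M j. 0 \<le> M \<Longrightarrow> (\<And>i. cmod (x i) \<le> M * u m i) \<Longrightarrow>
      (0 < v k j \<longrightarrow> (\<lambda>i. c (j, i) * x i) summable_on UNIV) \<and> cmod (mat_op c x j) * v k j \<le> B * M"
proof -
  obtain C where C: "0 \<le> C" "\<And>j i. cmod (c (j, i)) * (v k j * u (Suc m) i) \<le> C"
    using assms by (rule kernels_ind_projE) blast
  obtain l where l: "\<And>i. 0 \<le> l i" "l summable_on UNIV" "\<And>i. u m i \<le> l i * u (Suc m) i"
    by (rule U.nuclear_summable) blast
  define L where "L = (\<Sum>\<^sub>\<infinity>i. l i)"
  have L: "0 \<le> L" unfolding L_def using l(1) by (intro infsum_nonneg) auto
  show ?thesis
  proof (rule that[of "C * L"])
    show "0 \<le> C * L" using C(1) L by simp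
    fix x :: "'i \<Rightarrow> complex" and M :: real and j
    assume M: "0 \<le> M" and x: "\<And>i. cmod (x i) \<le> M * u m i"
    have "cmod (c (j, i)) * cmod (x i) * v k j \<le> (C * M) * l i" for i
    proof -
      have "cmod (x i) \<le> M * (l i * u (Suc m) i)"
        by (rule order_trans[OF x]) (intro mult_left_mono l M)
      then have "cmod (c (j, i)) * cmod (x i) * v k j \<le> cmod (c (j, i)) * (M * (l i * u (Suc m) i)) * v k j"
        by (intro mult_right_mono mult_left_mono V.nonneg) simp_all
      also have "\<dots> = (M * l i) * (cmod (c (j, i)) * (v k j * u (Suc m) i))" by (simp add: mult_ac)
      also have "\<dots> \<le> (M * l i) * C" by (intro mult_left_mono C mult_nonneg_nonneg M l)
      finally show ?thesis by (simp add: mult_ac)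
    qed
    from row_estimate[OF l(2,1) _ V.nonneg this]
    show "(0 < v k j \<longrightarrow> (\<lambda>i. c (j, i) * x i) summable_on UNIV) \<and>
        cmod (mat_op c x j) * v k j \<le> C * L * M"
      using C(1) M by (simp add: L_def mult_ac)
  qed
qed

end

text \<open>The universal property of the locally convex inductive limit: a linear map has to be
  tested on each step only, because absolute convexity of \<open>W\<close> passes to the
  preimage.\<close>

lemma (in weight_family) ind_nbhd_preimage:
  assumes T: "linear_on (ind_space u) T" and W: "abs_convex W"
    and ball: "\<And>k. \<exists>\<epsilon>>0. \<forall>x. (\<forall>i. cmod (x i) \<le> \<epsilon> * u k i) \<longrightarrow> T x \<in> W"
  shows "ind_nbhd u {x \<in> ind_space u. T x \<in> W}"
  unfolding ind_nbhd_def
proof (intro conjI allI)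
  show "abs_convex {x \<in> ind_space u. T x \<in> W}"
    unfolding abs_convex_def
  proof (intro ballI allI impI)
    fix x y a b
    assume xy: "x \<in> {x \<in> ind_space u. T x \<in> W}" "y \<in> {x \<in> ind_space u. T x \<in> W}"
      and ab: "cmod a + cmod b \<le> 1"
    have "T (lin_comb a x b y) = lin_comb a (T x) b (T y)"
      using T xy by (intro linear_onD) auto
    also have "\<dots> \<in> W" unfolding lin_comb_def using xy ab by (intro abs_convexD[OF W]) auto
    finally show "(\<lambda>i. a * x i + b * y i) \<in> {x \<in> ind_space u. T x \<in> W}"
      using lin_comb_ind_space[of x y a b] xy by (simp add: lin_comb_def)
  qed
  fix k
  obtain \<epsilon> where "\<epsilon> > 0" "\<forall>x. (\<forall>i. cmod (x i) \<le> \<epsilon> * u k i) \<longrightarrow> T x \<in> W" using ball by blast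
  then show "\<exists>\<epsilon>>0. \<forall>x. (\<forall>i. cmod (x i) \<le> \<epsilon> * u k i) \<longrightarrow> x \<in> {x \<in> ind_space u. T x \<in> W}"
    by (intro exI[of _ \<epsilon>]) (auto simp: ind_space_def)
qed auto

lemma (in increasing_weights) abs_convex_proj_ball:
  "abs_convex {y \<in> proj_space u. \<forall>i. cmod (y i) * u k i \<le> \<epsilon>}"
  unfolding abs_convex_def
proof (intro ballI allI impI)
  fix x y a b
  assume xy: "x \<in> {y \<in> proj_space u. \<forall>i. cmod (y i) * u k i \<le> \<epsilon>}"
    "y \<in> {y \<in> proj_space u. \<forall>i. cmod (y i) * u k i \<le> \<epsilon>}" and ab: "cmod a + cmod b \<le> 1"
  have "cmod (a * x i + b * y i) * u k i \<le> \<epsilon>" for i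
  proof -
    \<comment> \<open>The sign of \<open>\<epsilon>\<close> follows from the presence of
      \<open>x\<close> in the ball.\<close>
    have e: "0 \<le> \<epsilon>"
      using xy(1) mult_nonneg_nonneg[OF norm_ge_zero[of "x i"] nonneg[of k i]]
      by (auto intro: order_trans)
    have "cmod (a * x i + b * y i) * u k i \<le> (cmod a * cmod (x i) + cmod b * cmod (y i)) * u k i"
      by (intro mult_right_mono nonneg order_trans[OF norm_triangle_ineq]) (simp add: norm_mult)
    also have "\<dots> = cmod a * (cmod (x i) * u k i) + cmod b * (cmod (y i) * u k i)"
      by (simp add: algebra_simps)
    also have "\<dots> \<le> cmod a * \<epsilon> + cmod b * \<epsilon>"
      using xy by (intro add_mono mult_left_mono) auto
    also have "\<dots> = (cmod a + cmod b) * \<epsilon>" by (simp add: algebra_simps)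
    also have "\<dots> \<le> 1 * \<epsilon>" using ab e by (rule mult_right_mono)
    finally show ?thesis by simp
  qed
  then show "(\<lambda>i. a * x i + b * y i) \<in> {y \<in> proj_space u. \<forall>i. cmod (y i) * u k i \<le> \<epsilon>}"
    using lin_comb_proj_space[of x y a b] xy by (simp add: lin_comb_def)
qed

lemma scaled_unit_seq_le:
  assumes "0 \<le> a" "a = b i" "\<And>m. 0 \<le> b m"
  shows "cmod (of_real a * unit_seq i m) \<le> b m"
  using assms by (auto simp: unit_seq_def)

section \<open>Continuous linear maps and the four matrix classes\<close>

context weight_pair
begin

text \<open>The substance is \<open>matrix_mem\<close>: a continuous map from a projective into an
  inductive limit sends some neighbourhood of zero into a single step. Multiples of unit vectors in
  that neighbourhood then give the matrix bound.\<close>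

lemma kernel_class_proj_ind:
  assumes X1: "lin_space X1 (proj_space u) (proj_nbhd u)" and X2: "lin_space X2 (ind_space v) (ind_nbhd v)"
  shows "kernel_class X1 (proj_space u) (proj_nbhd u) X2 (ind_space v) (ind_nbhd v) (kernels_proj_ind v u)"
proof (intro kernel_class.intro X1 X2, unfold_locales)
  show "unit_seq i \<in> proj_space u" for i by (rule U.unit_seq_proj_space)
  show "\<exists>F. finite F \<and> (\<forall>G. F \<subseteq> G \<longrightarrow> tail_seq G x \<in> V)" if "x \<in> proj_space u" "proj_nbhd u V" for x V
    using that by (rule U.proj_tail_small)
  show "\<exists>W. ind_nbhd v W \<and> (\<forall>y\<in>W. cmod (y j) < \<epsilon>)" if "0 < \<epsilon>" for \<epsilon> j
    using that by (rule V.ind_coordinate_small)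
  show "lin_comb a c b d \<in> kernels_proj_ind v u"
    if "c \<in> kernels_proj_ind v u" "d \<in> kernels_proj_ind v u" for a b c d
    using that unfolding kernels_proj_ind_def by (rule VU.lin_comb_ind_space)
next
  fix c x j assume c: "c \<in> kernels_proj_ind v u" and x: "x \<in> proj_space u"
  obtain k m B where B: "0 \<le> B" "\<And>x M j. 0 \<le> M \<Longrightarrow> (\<And>i. cmod (x i) * u m i \<le> M) \<Longrightarrow>
      (\<lambda>i. c (j, i) * x i) summable_on UNIV \<and> cmod (mat_op c x j) \<le> B * M * v k j"
    using c by (rule proj_ind_estimate) blast
  obtain M where M: "0 \<le> M" "\<And>i. cmod (x i) * u m i \<le> M" using x by (rule U.proj_spaceE) blast
  show "(\<lambda>i. c (j, i) * x i) summable_on UNIV" using B(2)[OF M] by blast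
  show "mat_op c x \<in> ind_space v" using B(2)[OF M] unfolding ind_space_def by blast
next
  fix c W assume c: "c \<in> kernels_proj_ind v u" and W: "ind_nbhd v W"
  obtain k m B where B: "0 \<le> B" "\<And>x M j. 0 \<le> M \<Longrightarrow> (\<And>i. cmod (x i) * u m i \<le> M) \<Longrightarrow>
      (\<lambda>i. c (j, i) * x i) summable_on UNIV \<and> cmod (mat_op c x j) \<le> B * M * v k j"
    using c by (rule proj_ind_estimate) blast
  obtain \<epsilon> where e: "\<epsilon> > 0" "\<And>y. (\<forall>j. cmod (y j) \<le> \<epsilon> * v k j) \<Longrightarrow> y \<in> W"
    using W unfolding ind_nbhd_def by blast
  define \<delta> where "\<delta> = \<epsilon> / (B + 1)"
  have d: "0 < \<delta>" "B * \<delta> \<le> \<epsilon>" using scaled_radius[OF B(1) e(1)] by (auto simp: \<delta>_def)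
  show "\<exists>V. proj_nbhd u V \<and> mat_op c ` V \<subseteq> W"
  proof (intro exI conjI image_subsetI)
    show "proj_nbhd u {x \<in> proj_space u. \<forall>i. cmod (x i) * u m i \<le> \<delta>}"
      unfolding proj_nbhd_def using d(1) by blast
    fix x assume x: "x \<in> {x \<in> proj_space u. \<forall>i. cmod (x i) * u m i \<le> \<delta>}"
    have "cmod (mat_op c x j) \<le> \<epsilon> * v k j" for j
    proof -
      have "cmod (mat_op c x j) \<le> B * \<delta> * v k j" using B(2)[of \<delta> x j] d(1) x by simp
      also have "\<dots> \<le> \<epsilon> * v k j" by (intro mult_right_mono d V.nonneg)
      finally show ?thesis .
    qed
    then show "mat_op c x \<in> W" using e(2) by blast
  qed
next
  fix T assume T: "linear_on (proj_space u) T"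
    and bd: "\<And>W. ind_nbhd v W \<Longrightarrow> \<exists>V. proj_nbhd u V \<and> T ` V \<subseteq> W"
  \<comment> \<open>Radius and both weights carry the same index \<open>n\<close>: a counterexample
    for every \<open>n\<close> yields a sequence that tends to zero in the domain while the
    \<open>n\<close>-th image violates the bound by \<open>v n\<close>, contrary to
    \<open>ind_nbhd_avoiding\<close>.\<close>
  have "\<exists>n. \<forall>x\<in>proj_space u. (\<forall>i. cmod (x i) * u n i \<le> 1 / real (Suc n)) \<longrightarrow> (\<forall>j. cmod (T x j) \<le> v n j)"
  proof (rule ccontr)
    assume "\<not> ?thesis"
    then obtain x where x: "\<And>n. x n \<in> proj_space u" "\<And>n i. cmod (x n i) * u n i \<le> 1 / real (Suc n)"
        "\<And>n. \<not> (\<forall>j. cmod (T (x n) j) \<le> v n j)"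
      by metis
    obtain W where W: "ind_nbhd v W" "\<And>n. T (x n) \<notin> W"
      using V.ind_nbhd_avoiding[of "\<lambda>n. T (x n)"] x(3) by blast
    obtain V where V: "proj_nbhd u V" "T ` V \<subseteq> W" using bd[OF W(1)] by blast
    obtain m \<epsilon> where e: "\<epsilon> > 0" "V = {x \<in> proj_space u. \<forall>i. cmod (x i) * u m i \<le> \<epsilon>}"
      using V(1) unfolding proj_nbhd_def by blast
    obtain n0 where n0: "1 / real (Suc n0) < \<epsilon>" using nat_approx_posE[OF e(1)] by blast
    \<comment> \<open>\<open>m\<close> makes the weight large enough, \<open>n0\<close> the radius
      small enough.\<close>
    define n where "n = max m n0"
    have "cmod (x n i) * u m i \<le> \<epsilon>" for i
    proof -
      have "cmod (x n i) * u m i \<le> cmod (x n i) * u n i"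
        by (intro mult_left_mono U.mono) (auto simp: n_def)
      also have "\<dots> \<le> 1 / real (Suc n)" by (rule x)
      also have "\<dots> \<le> 1 / real (Suc n0)" by (intro divide_left_mono) (auto simp: n_def)
      finally show ?thesis using n0 by simp
    qed
    then have "x n \<in> V" using x(1) by (simp add: e(2))
    then show False using V(2) W(2) by blast
  qed
  then obtain n where n: "\<And>x j. x \<in> proj_space u \<Longrightarrow> (\<And>i. cmod (x i) * u n i \<le> 1 / real (Suc n)) \<Longrightarrow>
      cmod (T x j) \<le> v n j" by blast
  show "matrix_of T \<in> kernels_proj_ind v u"
  proof (rule kernels_proj_indI[of _ "real (Suc n)" n])
    fix j i
    \<comment> \<open>\<open>u n i\<close> may be 0, and then every multiple of the unit vector is
      admissible; \<open>scaling_bound\<close> covers both cases.\<close>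
    have "cmod (T (unit_seq i) j) * (1 / real (Suc n)) \<le> v n j * u n i"
    proof (rule scaling_bound)
      fix a assume a: "0 < a" "a * u n i \<le> 1 / real (Suc n)"
      have "cmod (T (\<lambda>m. of_real a * unit_seq i m) j) \<le> v n j"
        using a U.unit_seq_proj_space[of i] U.lin_comb_proj_space[of "unit_seq i" "unit_seq i" "of_real a" 0]
        by (intro n) (auto simp: unit_seq_def lin_comb_def)
      then show "a * cmod (T (unit_seq i) j) \<le> v n j"
        using a(1) linear_on_scale[OF T U.unit_seq_proj_space[of i], of "of_real a"] by (simp add: norm_mult)
    qed (auto intro: U.nonneg)
    then show "cmod (matrix_of T (j, i)) \<le> real (Suc n) * (v n j * u n i)"
      by (simp add: matrix_of_def field_simps)
  qed
qed

text \<open>The contradiction argument is run inside one step \<open>u l\<close> of the domain,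
  whose balls of radius \<open>1 / Suc n\<close> shrink into every neighbourhood. The step
  \<open>k\<close> of the target may depend on \<open>l\<close>.\<close>

lemma kernel_class_ind_ind:
  assumes X1: "lin_space X1 (ind_space u) (ind_nbhd u)" and X2: "lin_space X2 (ind_space v) (ind_nbhd v)"
  shows "kernel_class X1 (ind_space u) (ind_nbhd u) X2 (ind_space v) (ind_nbhd v) (kernels_ind_ind v u)"
proof -
  have summable: "(\<lambda>i. c (j, i) * x i) summable_on UNIV"
    and range: "mat_op c x \<in> ind_space v"
    if c: "c \<in> kernels_ind_ind v u" and x: "x \<in> ind_space u" for c x j
  proof -
    obtain m M where M: "0 \<le> M" "\<And>i. cmod (x i) \<le> M * u m i"
      using x by (rule U.ind_space_nonnegE) blast
    obtain k B where B: "0 \<le> B" "\<And>x M j. 0 \<le> M \<Longrightarrow> (\<And>i. cmod (x i) \<le> M * u m i) \<Longrightarrow>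
        (\<lambda>i. c (j, i) * x i) summable_on UNIV \<and> cmod (mat_op c x j) \<le> B * M * v k j"
      using c by (rule ind_ind_estimate) blast
    show "(\<lambda>i. c (j, i) * x i) summable_on UNIV" using B(2)[OF M] by blast
    show "mat_op c x \<in> ind_space v" using B(2)[OF M] unfolding ind_space_def by blast
  qed
  show ?thesis
  proof (intro kernel_class.intro X1 X2, unfold_locales)
    show "unit_seq i \<in> ind_space u" for i by (rule U.unit_seq_ind_space)
    show "\<exists>F. finite F \<and> (\<forall>G. F \<subseteq> G \<longrightarrow> tail_seq G x \<in> V)" if "x \<in> ind_space u" "ind_nbhd u V" for x V
      using that by (rule U.ind_tail_small)
    show "\<exists>W. ind_nbhd v W \<and> (\<forall>y\<in>W. cmod (y j) < \<epsilon>)" if "0 < \<epsilon>" for \<epsilon> j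
      using that by (rule V.ind_coordinate_small)
    show "lin_comb a c b d \<in> kernels_ind_ind v u"
      if "c \<in> kernels_ind_ind v u" "d \<in> kernels_ind_ind v u" for a b c d
      using that by (rule lin_comb_kernels_ind_ind)
    show "(\<lambda>i. c (j, i) * x i) summable_on UNIV" "mat_op c x \<in> ind_space v"
      if "c \<in> kernels_ind_ind v u" "x \<in> ind_space u" for c x j
      using that by (rule summable, rule range)
  next
    fix c W assume c: "c \<in> kernels_ind_ind v u" and W: "ind_nbhd v W"
    have lin: "linear_on (ind_space u) (mat_op c)"
      by (intro linear_on_mat_op summable c)
    have "ind_nbhd u {x \<in> ind_space u. mat_op c x \<in> W}"
    proof (rule U.ind_nbhd_preimage[OF lin])
      show "abs_convex W" using W by (simp add: ind_nbhd_def)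
      fix m
      obtain k B where B: "0 \<le> B" "\<And>x M j. 0 \<le> M \<Longrightarrow> (\<And>i. cmod (x i) \<le> M * u m i) \<Longrightarrow>
          (\<lambda>i. c (j, i) * x i) summable_on UNIV \<and> cmod (mat_op c x j) \<le> B * M * v k j"
        using c by (rule ind_ind_estimate) blast
      obtain \<epsilon> where e: "\<epsilon> > 0" "\<And>y. (\<forall>j. cmod (y j) \<le> \<epsilon> * v k j) \<Longrightarrow> y \<in> W"
        using W unfolding ind_nbhd_def by blast
      define \<delta> where "\<delta> = \<epsilon> / (B + 1)"
      have d: "0 < \<delta>" "B * \<delta> \<le> \<epsilon>" using scaled_radius[OF B(1) e(1)] by (auto simp: \<delta>_def)
      have "mat_op c x \<in> W" if x: "\<forall>i. cmod (x i) \<le> \<delta> * u m i" for x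
      proof (intro e(2) allI)
        fix j
        have "cmod (mat_op c x j) \<le> B * \<delta> * v k j" using B(2)[of \<delta> x j] d(1) x by simp
        also have "\<dots> \<le> \<epsilon> * v k j" by (intro mult_right_mono d V.nonneg)
        finally show "cmod (mat_op c x j) \<le> \<epsilon> * v k j" .
      qed
      then show "\<exists>\<epsilon>>0. \<forall>x. (\<forall>i. cmod (x i) \<le> \<epsilon> * u m i) \<longrightarrow> mat_op c x \<in> W" using d(1) by blast
    qed
    then show "\<exists>V. ind_nbhd u V \<and> mat_op c ` V \<subseteq> W" by blast
  next
    fix T assume T: "linear_on (ind_space u) T"
      and bd: "\<And>W. ind_nbhd v W \<Longrightarrow> \<exists>V. ind_nbhd u V \<and> T ` V \<subseteq> W"
    show "matrix_of T \<in> kernels_ind_ind v u"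
    proof (rule kernels_ind_indI)
      fix l
      have "\<exists>n. \<forall>x. (\<forall>i. cmod (x i) \<le> 1 / real (Suc n) * u l i) \<longrightarrow> (\<forall>j. cmod (T x j) \<le> v n j)"
      proof (rule ccontr)
        assume "\<not> ?thesis"
        then obtain x where x: "\<And>n i. cmod (x n i) \<le> 1 / real (Suc n) * u l i"
            "\<And>n. \<not> (\<forall>j. cmod (T (x n) j) \<le> v n j)"
          by metis
        obtain W where W: "ind_nbhd v W" "\<And>n. T (x n) \<notin> W"
          using V.ind_nbhd_avoiding[of "\<lambda>n. T (x n)"] x(2) by blast
        obtain V where V: "ind_nbhd u V" "T ` V \<subseteq> W" using bd[OF W(1)] by blast
        obtain \<epsilon> where e: "\<epsilon> > 0" "\<And>x. (\<forall>i. cmod (x i) \<le> \<epsilon> * u l i) \<Longrightarrow> x \<in> V"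
          using V(1) unfolding ind_nbhd_def by blast
        obtain n where n: "1 / real (Suc n) < \<epsilon>" using nat_approx_posE[OF e(1)] by blast
        have "cmod (x n i) \<le> \<epsilon> * u l i" for i
          by (rule order_trans[OF x(1)]) (use n U.nonneg in \<open>intro mult_right_mono; simp\<close>)
        then have "x n \<in> V" using e(2) by blast
        then show False using V(2) W(2) by blast
      qed
      then obtain n where n: "\<And>x j. (\<And>i. cmod (x i) \<le> 1 / real (Suc n) * u l i) \<Longrightarrow> cmod (T x j) \<le> v n j"
        by blast
      have "cmod (matrix_of T (j, i)) * u l i \<le> real (Suc n) * v n j" for j i
      proof -
        \<comment> \<open>The largest multiple of the unit vector in the ball. It may be 0, and then
          the claimed bound is trivial.\<close>
        define a where "a = 1 / real (Suc n) * u l i"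
        have a: "0 \<le> a" using U.nonneg by (simp add: a_def)
        have "cmod (T (\<lambda>m. of_real a * unit_seq i m) j) \<le> v n j"
          using scaled_unit_seq_le[of a "\<lambda>m. 1 / real (Suc n) * u l m" i] a U.nonneg
          by (intro n) (simp add: a_def)
        then have "a * cmod (T (unit_seq i) j) \<le> v n j"
          using a linear_on_scale[OF T U.unit_seq_ind_space[of i], of "of_real a"] by (simp add: norm_mult)
        then show ?thesis by (simp add: a_def matrix_of_def field_simps)
      qed
      then show "\<exists>k C. \<forall>j i. cmod (matrix_of T (j, i)) * u l i \<le> C * v k j" by blast
    qed
  qed
qed

text \<open>A projective target is described by single seminorms, so the matrix bound comes directly
  from the preimage of one seminorm ball, without the passage to a sequence.\<close>

lemma kernel_class_proj_proj:
  assumes X1: "lin_space X1 (proj_space u) (proj_nbhd u)" and X2: "lin_space X2 (proj_space v) (proj_nbhd v)"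
  shows "kernel_class X1 (proj_space u) (proj_nbhd u) X2 (proj_space v) (proj_nbhd v) (kernels_proj_proj v u)"
proof -
  have range: "mat_op c x \<in> proj_space v"
    if c: "c \<in> kernels_proj_proj v u" and x: "x \<in> proj_space u" for c x
    unfolding proj_space_def
  proof (intro CollectI allI)
    fix k
    obtain m B where B: "0 \<le> B" "\<And>x M j. 0 \<le> M \<Longrightarrow> (\<And>i. cmod (x i) * u m i \<le> M) \<Longrightarrow>
        (0 < v k j \<longrightarrow> (\<lambda>i. c (j, i) * x i) summable_on UNIV) \<and> cmod (mat_op c x j) * v k j \<le> B * M"
      using c by (rule proj_proj_estimate) blast
    obtain M where M: "0 \<le> M" "\<And>i. cmod (x i) * u m i \<le> M" using x by (rule U.proj_spaceE) blast
    show "\<exists>C. \<forall>j. cmod (mat_op c x j) * v k j \<le> C" using B(2)[OF M] by blast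
  qed
  show ?thesis
  proof (intro kernel_class.intro X1 X2, unfold_locales)
    show "unit_seq i \<in> proj_space u" for i by (rule U.unit_seq_proj_space)
    show "\<exists>F. finite F \<and> (\<forall>G. F \<subseteq> G \<longrightarrow> tail_seq G x \<in> V)" if "x \<in> proj_space u" "proj_nbhd u V" for x V
      using that by (rule U.proj_tail_small)
    show "\<exists>W. proj_nbhd v W \<and> (\<forall>y\<in>W. cmod (y j) < \<epsilon>)" if "0 < \<epsilon>" for \<epsilon> j
      using that by (rule V.proj_coordinate_small)
    show "lin_comb a c b d \<in> kernels_proj_proj v u"
      if "c \<in> kernels_proj_proj v u" "d \<in> kernels_proj_proj v u" for a b c d
      using that by (rule lin_comb_kernels_proj_proj)
    show "mat_op c x \<in> proj_space v" if "c \<in> kernels_proj_proj v u" "x \<in> proj_space u" for c x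
      using that by (rule range)
  next
    fix c x j assume c: "c \<in> kernels_proj_proj v u" and x: "x \<in> proj_space u"
    \<comment> \<open>An estimate weighted by \<open>v k j\<close> says nothing about the
      summability of row \<open>j\<close> when that weight is 0, so a step with positive weight is
      chosen first.\<close>
    obtain k where k: "v k j > 0" using V.ex_pos by blast
    obtain m B where B: "0 \<le> B" "\<And>x M j. 0 \<le> M \<Longrightarrow> (\<And>i. cmod (x i) * u m i \<le> M) \<Longrightarrow>
        (0 < v k j \<longrightarrow> (\<lambda>i. c (j, i) * x i) summable_on UNIV) \<and> cmod (mat_op c x j) * v k j \<le> B * M"
      using c by (rule proj_proj_estimate) blast
    obtain M where M: "0 \<le> M" "\<And>i. cmod (x i) * u m i \<le> M" using x by (rule U.proj_spaceE) blast
    show "(\<lambda>i. c (j, i) * x i) summable_on UNIV" using B(2)[OF M, of j] k by blast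
  next
    fix c W assume c: "c \<in> kernels_proj_proj v u" and "proj_nbhd v W"
    then obtain k \<epsilon> where e: "\<epsilon> > 0" "W = {y \<in> proj_space v. \<forall>j. cmod (y j) * v k j \<le> \<epsilon>}"
      unfolding proj_nbhd_def by blast
    obtain m B where B: "0 \<le> B" "\<And>x M j. 0 \<le> M \<Longrightarrow> (\<And>i. cmod (x i) * u m i \<le> M) \<Longrightarrow>
        (0 < v k j \<longrightarrow> (\<lambda>i. c (j, i) * x i) summable_on UNIV) \<and> cmod (mat_op c x j) * v k j \<le> B * M"
      using c by (rule proj_proj_estimate) blast
    define \<delta> where "\<delta> = \<epsilon> / (B + 1)"
    have d: "0 < \<delta>" "B * \<delta> \<le> \<epsilon>" using scaled_radius[OF B(1) e(1)] by (auto simp: \<delta>_def)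
    show "\<exists>V. proj_nbhd u V \<and> mat_op c ` V \<subseteq> W"
    proof (intro exI conjI image_subsetI)
      show "proj_nbhd u {x \<in> proj_space u. \<forall>i. cmod (x i) * u m i \<le> \<delta>}"
        unfolding proj_nbhd_def using d(1) by blast
      fix x assume x: "x \<in> {x \<in> proj_space u. \<forall>i. cmod (x i) * u m i \<le> \<delta>}"
      have "cmod (mat_op c x j) * v k j \<le> \<epsilon>" for j
        using B(2)[of \<delta> x j] d x by auto
      then show "mat_op c x \<in> W" using range[OF c] x by (simp add: e(2))
    qed
  next
    fix T assume T: "linear_on (proj_space u) T"
      and bd: "\<And>W. proj_nbhd v W \<Longrightarrow> \<exists>V. proj_nbhd u V \<and> T ` V \<subseteq> W"
    show "matrix_of T \<in> kernels_proj_proj v u"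
    proof (rule kernels_proj_projI)
      fix k
      have "proj_nbhd v {y \<in> proj_space v. \<forall>j. cmod (y j) * v k j \<le> 1}"
        unfolding proj_nbhd_def using zero_less_one by blast
      then obtain V where V: "proj_nbhd u V" "T ` V \<subseteq> {y \<in> proj_space v. \<forall>j. cmod (y j) * v k j \<le> 1}"
        using bd by blast
      then obtain m \<epsilon> where e: "\<epsilon> > 0" "V = {x \<in> proj_space u. \<forall>i. cmod (x i) * u m i \<le> \<epsilon>}"
        unfolding proj_nbhd_def by blast
      have n: "cmod (T x j) * v k j \<le> 1" if "x \<in> proj_space u" "\<And>i. cmod (x i) * u m i \<le> \<epsilon>" for x j
        using V(2) that unfolding e(2) by blast
      have "cmod (matrix_of T (j, i)) * v k j \<le> 1 / \<epsilon> * u m i" for j i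
      proof -
        have "cmod (T (unit_seq i) j) * v k j * \<epsilon> \<le> 1 * u m i"
        proof (rule scaling_bound)
          fix a assume a: "0 < a" "a * u m i \<le> \<epsilon>"
          have "cmod (T (\<lambda>m. of_real a * unit_seq i m) j) * v k j \<le> 1"
            using a e(1) U.unit_seq_proj_space[of i] U.lin_comb_proj_space[of "unit_seq i" "unit_seq i" "of_real a" 0]
            by (intro n) (auto simp: unit_seq_def lin_comb_def)
          then show "a * (cmod (T (unit_seq i) j) * v k j) \<le> 1"
            using a(1) linear_on_scale[OF T U.unit_seq_proj_space[of i], of "of_real a"]
            by (simp add: norm_mult mult.assoc)
        qed (auto intro: U.nonneg e)
        then show ?thesis using e(1) by (simp add: matrix_of_def field_simps)
      qed
      then show "\<exists>l C. \<forall>j i. cmod (matrix_of T (j, i)) * v k j \<le> C * u l i" by blast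
    qed
  qed
qed

text \<open>Every step of the domain is tested against every seminorm of the target; equal indices
  suffice for the matrix class because both families increase. Neighbourhoods in the domain are
  produced as preimages of seminorm balls.\<close>

lemma kernel_class_ind_proj:
  assumes X1: "lin_space X1 (ind_space u) (ind_nbhd u)" and X2: "lin_space X2 (proj_space v) (proj_nbhd v)"
  shows "kernel_class X1 (ind_space u) (ind_nbhd u) X2 (proj_space v) (proj_nbhd v) (kernels_ind_proj v u)"
proof -
  have range: "mat_op c x \<in> proj_space v"
    if c: "c \<in> kernels_ind_proj v u" and x: "x \<in> ind_space u" for c x
    unfolding proj_space_def
  proof (intro CollectI allI)
    fix k
    obtain m M where M: "0 \<le> M" "\<And>i. cmod (x i) \<le> M * u m i"
      using x by (rule U.ind_space_nonnegE) blast
    obtain B where B: "0 \<le> B" "\<And>x M j. 0 \<le> M \<Longrightarrow> (\<And>i. cmod (x i) \<le> M * u m i) \<Longrightarrow>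
        (0 < v k j \<longrightarrow> (\<lambda>i. c (j, i) * x i) summable_on UNIV) \<and> cmod (mat_op c x j) * v k j \<le> B * M"
      using c by (rule ind_proj_estimate) blast
    show "\<exists>C. \<forall>j. cmod (mat_op c x j) * v k j \<le> C" using B(2)[OF M] by blast
  qed
  have summable: "(\<lambda>i. c (j, i) * x i) summable_on UNIV"
    if c: "c \<in> kernels_ind_proj v u" and x: "x \<in> ind_space u" for c x j
  proof -
    obtain k where k: "v k j > 0" using V.ex_pos by blast
    obtain m M where M: "0 \<le> M" "\<And>i. cmod (x i) \<le> M * u m i"
      using x by (rule U.ind_space_nonnegE) blast
    obtain B where B: "0 \<le> B" "\<And>x M j. 0 \<le> M \<Longrightarrow> (\<And>i. cmod (x i) \<le> M * u m i) \<Longrightarrow>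
        (0 < v k j \<longrightarrow> (\<lambda>i. c (j, i) * x i) summable_on UNIV) \<and> cmod (mat_op c x j) * v k j \<le> B * M"
      using c by (rule ind_proj_estimate) blast
    show ?thesis using B(2)[OF M, of j] k by blast
  qed
  show ?thesis
  proof (intro kernel_class.intro X1 X2, unfold_locales)
    show "unit_seq i \<in> ind_space u" for i by (rule U.unit_seq_ind_space)
    show "\<exists>F. finite F \<and> (\<forall>G. F \<subseteq> G \<longrightarrow> tail_seq G x \<in> V)" if "x \<in> ind_space u" "ind_nbhd u V" for x V
      using that by (rule U.ind_tail_small)
    show "\<exists>W. proj_nbhd v W \<and> (\<forall>y\<in>W. cmod (y j) < \<epsilon>)" if "0 < \<epsilon>" for \<epsilon> j
      using that by (rule V.proj_coordinate_small)
    show "lin_comb a c b d \<in> kernels_ind_proj v u"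
      if "c \<in> kernels_ind_proj v u" "d \<in> kernels_ind_proj v u" for a b c d
      using that unfolding kernels_ind_proj_def by (rule VU.lin_comb_proj_space)
    show "(\<lambda>i. c (j, i) * x i) summable_on UNIV" "mat_op c x \<in> proj_space v"
      if "c \<in> kernels_ind_proj v u" "x \<in> ind_space u" for c x j
      using that by (rule summable, rule range)
  next
    fix c W assume c: "c \<in> kernels_ind_proj v u" and "proj_nbhd v W"
    then obtain k \<epsilon> where e: "\<epsilon> > 0" "W = {y \<in> proj_space v. \<forall>j. cmod (y j) * v k j \<le> \<epsilon>}"
      unfolding proj_nbhd_def by blast
    have lin: "linear_on (ind_space u) (mat_op c)"
      by (intro linear_on_mat_op summable c)
    have "ind_nbhd u {x \<in> ind_space u. mat_op c x \<in> W}"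
    proof (rule U.ind_nbhd_preimage[OF lin])
      show "abs_convex W" unfolding e(2) by (rule V.abs_convex_proj_ball)
      fix m
      obtain B where B: "0 \<le> B" "\<And>x M j. 0 \<le> M \<Longrightarrow> (\<And>i. cmod (x i) \<le> M * u m i) \<Longrightarrow>
          (0 < v k j \<longrightarrow> (\<lambda>i. c (j, i) * x i) summable_on UNIV) \<and> cmod (mat_op c x j) * v k j \<le> B * M"
        using c by (rule ind_proj_estimate) blast
      define \<delta> where "\<delta> = \<epsilon> / (B + 1)"
      have d: "0 < \<delta>" "B * \<delta> \<le> \<epsilon>" using scaled_radius[OF B(1) e(1)] by (auto simp: \<delta>_def)
      have "mat_op c x \<in> W" if x: "\<forall>i. cmod (x i) \<le> \<delta> * u m i" for x
      proof -
        have "x \<in> ind_space u" using x unfolding ind_space_def by blast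
        moreover have "cmod (mat_op c x j) * v k j \<le> \<epsilon>" for j
          using B(2)[of \<delta> x j] d x by auto
        ultimately show ?thesis using range[OF c] by (simp add: e(2))
      qed
      then show "\<exists>\<epsilon>>0. \<forall>x. (\<forall>i. cmod (x i) \<le> \<epsilon> * u m i) \<longrightarrow> mat_op c x \<in> W" using d(1) by blast
    qed
    then show "\<exists>V. ind_nbhd u V \<and> mat_op c ` V \<subseteq> W" by blast
  next
    fix T assume T: "linear_on (ind_space u) T"
      and bd: "\<And>W. proj_nbhd v W \<Longrightarrow> \<exists>V. ind_nbhd u V \<and> T ` V \<subseteq> W"
    show "matrix_of T \<in> kernels_ind_proj v u"
    proof (rule kernels_ind_projI)
      fix k
      have "proj_nbhd v {y \<in> proj_space v. \<forall>j. cmod (y j) * v k j \<le> 1}"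
        unfolding proj_nbhd_def using zero_less_one by blast
      then obtain V where V: "ind_nbhd u V" "T ` V \<subseteq> {y \<in> proj_space v. \<forall>j. cmod (y j) * v k j \<le> 1}"
        using bd by blast
      then obtain \<epsilon> where e: "\<epsilon> > 0" "\<And>x. (\<forall>i. cmod (x i) \<le> \<epsilon> * u k i) \<Longrightarrow> x \<in> V"
        unfolding ind_nbhd_def by blast
      have "cmod (matrix_of T (j, i)) * (v k j * u k i) \<le> 1 / \<epsilon>" for j i
      proof -
        define a where "a = \<epsilon> * u k i"
        have a: "0 \<le> a" using U.nonneg e(1) by (simp add: a_def)
        have "(\<lambda>m. of_real a * unit_seq i m) \<in> V"
          using scaled_unit_seq_le[of a "\<lambda>m. \<epsilon> * u k m" i] a e(1) U.nonneg
          by (intro e(2)) (simp add: a_def)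
        then have "cmod (T (\<lambda>m. of_real a * unit_seq i m) j) * v k j \<le> 1" using V(2) by blast
        then have "a * (cmod (T (unit_seq i) j) * v k j) \<le> 1"
          using a linear_on_scale[OF T U.unit_seq_ind_space[of i], of "of_real a"]
          by (simp add: norm_mult mult.assoc)
        then show ?thesis using e(1) by (simp add: a_def matrix_of_def field_simps)
      qed
      then show "\<exists>C. \<forall>j i. cmod (matrix_of T (j, i)) * (v k j * u k i) \<le> C" by blast
    qed
  qed
qed

end

section \<open>The two-index sequence spaces as kernel spaces\<close>

lemma ell_bounded:
  assumes "c \<in> ell p w" "0 < p"
  obtains M where "0 \<le> M" "\<And>i. ennreal (cmod (c i)) * w i \<le> ennreal M"
proof
  show "ennreal (cmod (c i)) * w i \<le> ennreal (enn2real (wnorm p w c))" for i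
    using assms wnorm_ge_coordinate[OF assms(2), of c i w] by (simp add: ell_def less_top)
qed simp

context weight_pair
begin

definition dominated :: "real \<Rightarrow> ('j \<times> 'i \<Rightarrow> real) \<Rightarrow> ('j \<times> 'i \<Rightarrow> ennreal) \<Rightarrow> ('j \<times> 'i \<Rightarrow> complex) \<Rightarrow> bool"
  where "dominated M l w c \<longleftrightarrow> 0 \<le> M \<and> (\<forall>j i. ennreal (cmod (c (j, i))) * w (j, i) \<le> ennreal (M * l (j, i)))"

text \<open>Summability over pairs is a product of two one-index sums, so one factor from each
  family makes the two-index limits independent of \<open>p\<close>. The steps \<open>k\<close> and
  \<open>l\<close> are separate, as nested limits advance them separately.\<close>

lemma pair_nuclear:
  assumes "0 < p"
  obtains lv lu where "\<And>j. 0 \<le> lv j" "\<And>i. 0 \<le> lu i"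
    "\<And>j. v k j \<le> lv j * v (Suc k) j" "\<And>i. u l i \<le> lu i * u (Suc l) i"
    "\<And>M w c. dominated M (\<lambda>(j, i). lv j * lu i) w c \<Longrightarrow> c \<in> ell p w"
proof -
  let ?q = "summation_exponent p"
  obtain lv where lv: "\<forall>j. 0 \<le> lv j" "(\<lambda>j. lv j powr ?q) summable_on UNIV" "\<forall>j. v k j \<le> lv j * v (Suc k) j"
    using V.nuclear[OF summation_exponent_pos[OF assms]] by blast
  obtain lu where lu: "\<forall>i. 0 \<le> lu i" "(\<lambda>i. lu i powr ?q) summable_on UNIV" "\<forall>i. u l i \<le> lu i * u (Suc l) i"
    using U.nuclear[OF summation_exponent_pos[OF assms]] by blast
  have "(\<lambda>(j, i). (lv j powr ?q) * (lu i powr ?q)) summable_on UNIV \<times> UNIV"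
  proof (rule summable_on_SigmaI[where g = "\<lambda>j. (lv j powr ?q) * (\<Sum>\<^sub>\<infinity>i. lu i powr ?q)"])
    show "((\<lambda>i. case (j, i) of (j, i) \<Rightarrow> (lv j powr ?q) * (lu i powr ?q)) has_sum
        (lv j powr ?q) * (\<Sum>\<^sub>\<infinity>i. lu i powr ?q)) UNIV" for j
      using lu(2) by (auto intro!: has_sum_cmult_right)
    show "(\<lambda>j. (lv j powr ?q) * (\<Sum>\<^sub>\<infinity>i. lu i powr ?q)) summable_on UNIV"
      using lv(2) by (rule summable_on_cmult_left)
  qed auto
  also have "(\<lambda>(j, i). (lv j powr ?q) * (lu i powr ?q)) = (\<lambda>p. (\<lambda>(j, i). lv j * lu i) p powr ?q)"
    using lv(1) lu(1) by (auto simp: powr_mult)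
  finally have s: "(\<lambda>p. (\<lambda>(j, i). lv j * lu i) p powr ?q) summable_on UNIV" by simp
  have nn: "0 \<le> (\<lambda>(j, i). lv j * lu i) a" for a using lv(1) lu(1) by (auto split: prod.split)
  obtain K :: real where K: "K > 0"
    "\<And>M \<omega> c. 0 \<le> M \<Longrightarrow> (\<And>a. ennreal (cmod (c a)) * \<omega> a \<le> ennreal (M * (\<lambda>(j, i). lv j * lu i) a))
       \<Longrightarrow> wnorm p \<omega> c \<le> ennreal (M * K)"
    using wnorm_le_summable_majorant[OF assms nn s] by blast
  show ?thesis
  proof (rule that[of lv lu])
    fix M w c assume "dominated M (\<lambda>(j, i). lv j * lu i) w c"
    then have "wnorm p w c \<le> ennreal (M * K)"
      by (intro K(2)) (auto simp: dominated_def)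
    then show "c \<in> ell p w" by (auto simp: ell_def intro: le_less_trans)
  qed (use lv lu in auto)
qed

text \<open>The reciprocal of a real weight is never 0 in \<open>ennreal\<close>, so no product of 0
  and infinity arises and \<open>inverse\<close> is multiplicative even where a weight
  vanishes.\<close>

lemma ennreal_pair_inverse_le_iff:
  assumes "0 \<le> x" "0 \<le> M"
  shows "ennreal x * (inverse (ennreal (v k j)) * inverse (ennreal (u l i))) \<le> ennreal M
    \<longleftrightarrow> x \<le> M * (v k j * u l i)"
proof -
  have "inverse (ennreal (v k j)) * inverse (ennreal (u l i)) = inverse (ennreal (v k j * u l i))"
    using V.nonneg[of k j] U.nonneg[of l i]
    by (cases "v k j = 0"; cases "u l i = 0")
       (auto simp: inverse_ennreal ennreal_top_mult ennreal_mult_top simp flip: ennreal_mult)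
  then show ?thesis using assms V.nonneg U.nonneg by (simp add: ennreal_inverse_le_iff)
qed

lemma representsD1: "represents \<omega> w \<Longrightarrow> \<exists>r>0. \<forall>i. \<omega> r i \<le> inverse (ennreal (w k i))"
  unfolding represents_def by blast

lemma representsD2: "represents \<omega> w \<Longrightarrow> 0 < r \<Longrightarrow> \<exists>k. \<forall>i. inverse (ennreal (w k i)) \<le> \<omega> r i"
  unfolding represents_def by blast

lemma inverse_mono_V: "k \<le> m \<Longrightarrow> inverse (ennreal (v m j)) \<le> inverse (ennreal (v k j))"
  by (intro inverse_antimono_ennreal ennreal_leI V.mono)

lemma inverse_mono_U: "k \<le> m \<Longrightarrow> inverse (ennreal (u m i)) \<le> inverse (ennreal (u k i))"
  by (intro inverse_antimono_ennreal ennreal_leI U.mono)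

context
  fixes p :: ennreal and \<omega>2 :: "real \<Rightarrow> 'j \<Rightarrow> ennreal" and \<omega>1 :: "real \<Rightarrow> 'i \<Rightarrow> ennreal"
  assumes p: "0 < p" and rep2: "represents \<omega>2 v" and rep1: "represents \<omega>1 u"
begin

text \<open>The parameters \<open>r2\<close> and \<open>r1\<close> are independent, but
  \<open>v\<close> and \<open>u\<close> both increase, so the maximum of the two indices serves for
  both. In the other direction one step is given up in each factor for the sake of
  summability.\<close>

lemma ell_product_eq:
  "(\<Union>r2\<in>{0<..}. \<Union>r1\<in>{0<..}. ell p (\<lambda>(j, i). \<omega>2 r2 j * \<omega>1 r1 i)) = kernels_proj_ind v u"
proof (intro equalityI subsetI)
  fix c assume "c \<in> (\<Union>r2\<in>{0<..}. \<Union>r1\<in>{0<..}. ell p (\<lambda>(j, i). \<omega>2 r2 j * \<omega>1 r1 i))"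
  then obtain r2 r1 where r: "0 < r2" "0 < r1" "c \<in> ell p (\<lambda>(j, i). \<omega>2 r2 j * \<omega>1 r1 i)" by auto
  obtain k2 where k2: "\<And>j. inverse (ennreal (v k2 j)) \<le> \<omega>2 r2 j" using representsD2[OF rep2 r(1)] by blast
  obtain k1 where k1: "\<And>i. inverse (ennreal (u k1 i)) \<le> \<omega>1 r1 i" using representsD2[OF rep1 r(2)] by blast
  define k where "k = max k2 k1"
  obtain M where M: "0 \<le> M" "\<And>a. ennreal (cmod (c a)) * (\<lambda>(j, i). \<omega>2 r2 j * \<omega>1 r1 i) a \<le> ennreal M"
    using ell_bounded[OF r(3) p] by blast
  have "cmod (c (j, i)) \<le> M * (v k j * u k i)" for j i
  proof -
    have "inverse (ennreal (v k j)) * inverse (ennreal (u k i)) \<le> \<omega>2 r2 j * \<omega>1 r1 i"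
      by (intro mult_mono order_trans[OF inverse_mono_V k2] order_trans[OF inverse_mono_U k1])
         (auto simp: k_def)
    then have "ennreal (cmod (c (j, i))) * (inverse (ennreal (v k j)) * inverse (ennreal (u k i)))
        \<le> ennreal (cmod (c (j, i))) * (\<omega>2 r2 j * \<omega>1 r1 i)" by (intro mult_left_mono) auto
    also have "\<dots> \<le> ennreal M" using M(2)[of "(j, i)"] by simp
    finally show ?thesis using M(1) by (simp add: ennreal_pair_inverse_le_iff)
  qed
  then show "c \<in> kernels_proj_ind v u" by (rule kernels_proj_indI)
next
  fix c assume "c \<in> kernels_proj_ind v u"
  then obtain k C where C: "0 \<le> C" "\<And>j i. cmod (c (j, i)) \<le> C * (v k j * u k i)"
    by (rule kernels_proj_indE) blast
  obtain lv lu where l: "\<And>j. 0 \<le> lv j" "\<And>i. 0 \<le> lu i"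
    "\<And>j. v k j \<le> lv j * v (Suc k) j" "\<And>i. u k i \<le> lu i * u (Suc k) i"
    "\<And>M w c. dominated M (\<lambda>(j, i). lv j * lu i) w c \<Longrightarrow> c \<in> ell p w"
    using p by (rule pair_nuclear) blast
  obtain r2 where r2: "r2 > 0" "\<And>j. \<omega>2 r2 j \<le> inverse (ennreal (v (Suc k) j))"
    using representsD1[OF rep2] by blast
  obtain r1 where r1: "r1 > 0" "\<And>i. \<omega>1 r1 i \<le> inverse (ennreal (u (Suc k) i))"
    using representsD1[OF rep1] by blast
  have "dominated C (\<lambda>(j, i). lv j * lu i) (\<lambda>(j, i). \<omega>2 r2 j * \<omega>1 r1 i) c"
    unfolding dominated_def
  proof (intro conjI allI C(1), simp only: prod.case)
    fix j i
    have "C * (v k j * u k i) \<le> C * ((lv j * v (Suc k) j) * (lu i * u (Suc k) i))"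
      by (intro mult_left_mono mult_mono l C U.nonneg V.nonneg mult_nonneg_nonneg)
    then have "cmod (c (j, i)) \<le> (C * (lv j * lu i)) * (v (Suc k) j * u (Suc k) i)"
      using C(2)[of j i] by (simp add: mult_ac)
    then have "ennreal (cmod (c (j, i))) * (inverse (ennreal (v (Suc k) j)) * inverse (ennreal (u (Suc k) i)))
        \<le> ennreal (C * (lv j * lu i))"
      using C(1) l(1,2) by (subst ennreal_pair_inverse_le_iff) auto
    moreover have "ennreal (cmod (c (j, i))) * (\<omega>2 r2 j * \<omega>1 r1 i) \<le>
        ennreal (cmod (c (j, i))) * (inverse (ennreal (v (Suc k) j)) * inverse (ennreal (u (Suc k) i)))"
      by (intro mult_left_mono mult_mono r1 r2) auto
    ultimately show "ennreal (cmod (c (j, i))) * (\<omega>2 r2 j * \<omega>1 r1 i) \<le> ennreal (C * (lv j * lu i))"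
      by (rule order_trans[rotated])
  qed
  then show "c \<in> (\<Union>r2\<in>{0<..}. \<Union>r1\<in>{0<..}. ell p (\<lambda>(j, i). \<omega>2 r2 j * \<omega>1 r1 i))"
    using l(5) r1(1) r2(1) by blast
qed

text \<open>Dual to \<open>ell_product_eq\<close>. Weights are compared by inverting twice, which is
  harmless in \<open>ennreal\<close> also at 0 and infinity.\<close>

lemma ell_inverse_product_eq:
  "(\<Inter>r2\<in>{0<..}. \<Inter>r1\<in>{0<..}. ell p (\<lambda>(j, i). 1 / (\<omega>2 r2 j * \<omega>1 r1 i))) = kernels_ind_proj v u"
proof (intro equalityI subsetI)
  fix c assume c: "c \<in> (\<Inter>r2\<in>{0<..}. \<Inter>r1\<in>{0<..}. ell p (\<lambda>(j, i). 1 / (\<omega>2 r2 j * \<omega>1 r1 i)))"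
  show "c \<in> kernels_ind_proj v u"
  proof (rule kernels_ind_projI)
    fix k
    obtain r2 where r2: "r2 > 0" "\<And>j. \<omega>2 r2 j \<le> inverse (ennreal (v k j))"
      using representsD1[OF rep2] by blast
    obtain r1 where r1: "r1 > 0" "\<And>i. \<omega>1 r1 i \<le> inverse (ennreal (u k i))"
      using representsD1[OF rep1] by blast
    have "c \<in> ell p (\<lambda>(j, i). 1 / (\<omega>2 r2 j * \<omega>1 r1 i))" using c r1(1) r2(1) by blast
    then obtain M where M: "0 \<le> M"
        "\<And>a. ennreal (cmod (c a)) * (\<lambda>(j, i). 1 / (\<omega>2 r2 j * \<omega>1 r1 i)) a \<le> ennreal M"
      using ell_bounded p by blast
    have "cmod (c (j, i)) * (v k j * u k i) \<le> M" for j i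
    proof -
      have "\<omega>2 r2 j * \<omega>1 r1 i \<le> inverse (ennreal (v k j)) * inverse (ennreal (u k i))"
        by (intro mult_mono r1 r2) auto
      also have "\<dots> \<le> inverse (ennreal (v k j * u k i))"
        using ennreal_pair_inverse_le_iff[of 1 1 k j k i] V.nonneg[of k j] U.nonneg[of k i]
        by (cases "v k j = 0"; cases "u k i = 0") (auto simp: inverse_ennreal simp flip: ennreal_mult)
      finally have "inverse (inverse (ennreal (v k j * u k i))) \<le> inverse (\<omega>2 r2 j * \<omega>1 r1 i)"
        by (rule inverse_antimono_ennreal)
      then have "ennreal (cmod (c (j, i))) * ennreal (v k j * u k i)
          \<le> ennreal (cmod (c (j, i))) * (1 / (\<omega>2 r2 j * \<omega>1 r1 i))"
        by (intro mult_left_mono) (simp_all add: ennreal_inverse_inverse divide_ennreal_def)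
      also have "\<dots> \<le> ennreal M" using M(2)[of "(j, i)"] by simp
      finally show ?thesis using M(1) V.nonneg U.nonneg by (simp flip: ennreal_mult)
    qed
    then show "\<exists>C. \<forall>j i. cmod (c (j, i)) * (v k j * u k i) \<le> C" by blast
  qed
next
  fix c assume c: "c \<in> kernels_ind_proj v u"
  have "c \<in> ell p (\<lambda>(j, i). 1 / (\<omega>2 r2 j * \<omega>1 r1 i))" if r: "0 < r2" "0 < r1" for r2 r1
  proof -
    obtain k2 where k2: "\<And>j. inverse (ennreal (v k2 j)) \<le> \<omega>2 r2 j" using representsD2[OF rep2 r(1)] by blast
    obtain k1 where k1: "\<And>i. inverse (ennreal (u k1 i)) \<le> \<omega>1 r1 i" using representsD2[OF rep1 r(2)] by blast
    obtain lv lu where l: "\<And>j. 0 \<le> lv j" "\<And>i. 0 \<le> lu i"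
      "\<And>j. v k2 j \<le> lv j * v (Suc k2) j" "\<And>i. u k1 i \<le> lu i * u (Suc k1) i"
      "\<And>M w c. dominated M (\<lambda>(j, i). lv j * lu i) w c \<Longrightarrow> c \<in> ell p w"
      using p by (rule pair_nuclear) blast
    obtain C where C: "0 \<le> C" "\<And>j i. cmod (c (j, i)) * (v (Suc k2) j * u (Suc k1) i) \<le> C"
      using c by (rule kernels_ind_projE) blast
    have "dominated C (\<lambda>(j, i). lv j * lu i) (\<lambda>(j, i). 1 / (\<omega>2 r2 j * \<omega>1 r1 i)) c"
      unfolding dominated_def
    proof (intro conjI allI C(1), simp only: prod.case)
      fix j i
      have "inverse (ennreal (v k2 j * u k1 i)) \<le> inverse (ennreal (v k2 j)) * inverse (ennreal (u k1 i))"
        using V.nonneg[of k2 j] U.nonneg[of k1 i]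
        by (cases "v k2 j = 0"; cases "u k1 i = 0")
           (auto simp: inverse_ennreal ennreal_top_mult ennreal_mult_top simp flip: ennreal_mult)
      also have "\<dots> \<le> \<omega>2 r2 j * \<omega>1 r1 i" by (intro mult_mono k1 k2) auto
      finally have "inverse (\<omega>2 r2 j * \<omega>1 r1 i) \<le> inverse (inverse (ennreal (v k2 j * u k1 i)))"
        by (rule inverse_antimono_ennreal)
      then have "ennreal (cmod (c (j, i))) * (1 / (\<omega>2 r2 j * \<omega>1 r1 i))
          \<le> ennreal (cmod (c (j, i))) * ennreal (v k2 j * u k1 i)"
        by (intro mult_left_mono) (simp_all add: ennreal_inverse_inverse divide_ennreal_def)
      also have "\<dots> = ennreal (cmod (c (j, i)) * (v k2 j * u k1 i))"
        using V.nonneg U.nonneg by (simp add: ennreal_mult)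
      also have "\<dots> \<le> ennreal (C * (lv j * lu i))"
      proof (rule ennreal_leI)
        have "cmod (c (j, i)) * (v k2 j * u k1 i) \<le>
            cmod (c (j, i)) * ((lv j * v (Suc k2) j) * (lu i * u (Suc k1) i))"
          by (intro mult_left_mono mult_mono l C U.nonneg V.nonneg mult_nonneg_nonneg norm_ge_zero)
        also have "\<dots> = (lv j * lu i) * (cmod (c (j, i)) * (v (Suc k2) j * u (Suc k1) i))"
          by (simp add: mult_ac)
        also have "\<dots> \<le> (lv j * lu i) * C" by (intro mult_left_mono C mult_nonneg_nonneg l)
        finally show "cmod (c (j, i)) * (v k2 j * u k1 i) \<le> C * (lv j * lu i)" by (simp add: mult_ac)
      qed
      finally show "ennreal (cmod (c (j, i))) * (1 / (\<omega>2 r2 j * \<omega>1 r1 i)) \<le> ennreal (C * (lv j * lu i))" .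
    qed
    then show ?thesis by (rule l(5))
  qed
  then show "c \<in> (\<Inter>r2\<in>{0<..}. \<Inter>r1\<in>{0<..}. ell p (\<lambda>(j, i). 1 / (\<omega>2 r2 j * \<omega>1 r1 i)))" by blast
qed

text \<open>The outer intersection over \<open>r1\<close> becomes the quantifier over
  \<open>l\<close>, the inner union over \<open>r2\<close> the choice of \<open>k\<close>. For the
  return direction the bound is taken at \<open>Suc l\<close> and the target weight is advanced to
  \<open>Suc k\<close>, so that both summable factors appear.\<close>

lemma ell_quotient_eq:
  "(\<Inter>r1\<in>{0<..}. \<Union>r2\<in>{0<..}. ell p (\<lambda>(j, i). \<omega>2 r2 j / \<omega>1 r1 i)) = kernels_ind_ind v u"
proof (intro equalityI subsetI)
  fix c assume c: "c \<in> (\<Inter>r1\<in>{0<..}. \<Union>r2\<in>{0<..}. ell p (\<lambda>(j, i). \<omega>2 r2 j / \<omega>1 r1 i))"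
  show "c \<in> kernels_ind_ind v u"
  proof (rule kernels_ind_indI)
    fix l
    obtain r1 where r1: "r1 > 0" "\<And>i. \<omega>1 r1 i \<le> inverse (ennreal (u l i))"
      using representsD1[OF rep1] by blast
    obtain r2 where r2: "r2 > 0" "c \<in> ell p (\<lambda>(j, i). \<omega>2 r2 j / \<omega>1 r1 i)" using c r1(1) by blast
    obtain k where k: "\<And>j. inverse (ennreal (v k j)) \<le> \<omega>2 r2 j" using representsD2[OF rep2 r2(1)] by blast
    obtain M where M: "0 \<le> M" "\<And>a. ennreal (cmod (c a)) * (\<lambda>(j, i). \<omega>2 r2 j / \<omega>1 r1 i) a \<le> ennreal M"
      using ell_bounded[OF r2(2) p] by blast
    have "cmod (c (j, i)) * u l i \<le> M * v k j" for j i
    proof -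
      have "ennreal (u l i) \<le> inverse (\<omega>1 r1 i)"
        using inverse_antimono_ennreal[OF r1(2)[of i]] by (simp add: ennreal_inverse_inverse)
      then have "ennreal (cmod (c (j, i))) * (inverse (ennreal (v k j)) * ennreal (u l i))
          \<le> ennreal (cmod (c (j, i))) * (\<omega>2 r2 j / \<omega>1 r1 i)"
        unfolding divide_ennreal_def by (intro mult_left_mono mult_mono k) auto
      also have "\<dots> \<le> ennreal M" using M(2)[of "(j, i)"] by simp
      finally show ?thesis using M(1) V.nonneg U.nonneg by (simp add: ennreal_ratio_le_iff)
    qed
    then show "\<exists>k C. \<forall>j i. cmod (c (j, i)) * u l i \<le> C * v k j" by blast
  qed
next
  fix c assume c: "c \<in> kernels_ind_ind v u"
  have "\<exists>r2\<in>{0<..}. c \<in> ell p (\<lambda>(j, i). \<omega>2 r2 j / \<omega>1 r1 i)" if r: "0 < r1" for r1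
  proof -
    obtain l where l: "\<And>i. inverse (ennreal (u l i)) \<le> \<omega>1 r1 i" using representsD2[OF rep1 r] by blast
    obtain k C where C: "0 \<le> C" "\<And>j i. cmod (c (j, i)) * u (Suc l) i \<le> C * v k j"
      using c by (rule kernels_ind_indE) blast
    obtain lv lu where n: "\<And>j. 0 \<le> lv j" "\<And>i. 0 \<le> lu i"
      "\<And>j. v k j \<le> lv j * v (Suc k) j" "\<And>i. u l i \<le> lu i * u (Suc l) i"
      "\<And>M w c. dominated M (\<lambda>(j, i). lv j * lu i) w c \<Longrightarrow> c \<in> ell p w"
      using p by (rule pair_nuclear) blast
    obtain r2 where r2: "r2 > 0" "\<And>j. \<omega>2 r2 j \<le> inverse (ennreal (v (Suc k) j))"
      using representsD1[OF rep2] by blast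
    have "dominated C (\<lambda>(j, i). lv j * lu i) (\<lambda>(j, i). \<omega>2 r2 j / \<omega>1 r1 i) c"
      unfolding dominated_def
    proof (intro conjI allI C(1), simp only: prod.case)
      fix j i
      have "inverse (\<omega>1 r1 i) \<le> ennreal (u l i)"
        using inverse_antimono_ennreal[OF l[of i]] by (simp add: ennreal_inverse_inverse)
      then have "ennreal (cmod (c (j, i))) * (\<omega>2 r2 j / \<omega>1 r1 i)
          \<le> ennreal (cmod (c (j, i))) * (inverse (ennreal (v (Suc k) j)) * ennreal (u l i))"
        unfolding divide_ennreal_def by (intro mult_left_mono mult_mono r2) auto
      also have "\<dots> \<le> ennreal (C * (lv j * lu i))"
      proof (subst ennreal_ratio_le_iff)
        have "cmod (c (j, i)) * u l i \<le> cmod (c (j, i)) * (lu i * u (Suc l) i)"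
          by (intro mult_left_mono n) simp
        also have "\<dots> = lu i * (cmod (c (j, i)) * u (Suc l) i)" by (simp add: mult_ac)
        also have "\<dots> \<le> lu i * (C * v k j)" by (intro mult_left_mono C n)
        also have "\<dots> \<le> lu i * (C * (lv j * v (Suc k) j))" by (intro mult_left_mono C n)
        finally show "cmod (c (j, i)) * u l i \<le> C * (lv j * lu i) * v (Suc k) j" by (simp add: mult_ac)
      qed (use C(1) n V.nonneg U.nonneg in auto)
      finally show "ennreal (cmod (c (j, i))) * (\<omega>2 r2 j / \<omega>1 r1 i) \<le> ennreal (C * (lv j * lu i))" .
    qed
    then show ?thesis using n(5) r2(1) by auto
  qed
  then show "c \<in> (\<Inter>r1\<in>{0<..}. \<Union>r2\<in>{0<..}. ell p (\<lambda>(j, i). \<omega>2 r2 j / \<omega>1 r1 i))" by blast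
qed

text \<open>Mirror image of \<open>ell_quotient_eq\<close>: the outer parameter now belongs to the
  target.\<close>

lemma ell_quotient_star_eq:
  "(\<Inter>r2\<in>{0<..}. \<Union>r1\<in>{0<..}. ell p (\<lambda>(j, i). \<omega>1 r1 i / \<omega>2 r2 j)) = kernels_proj_proj v u"
proof (intro equalityI subsetI)
  fix c assume c: "c \<in> (\<Inter>r2\<in>{0<..}. \<Union>r1\<in>{0<..}. ell p (\<lambda>(j, i). \<omega>1 r1 i / \<omega>2 r2 j))"
  show "c \<in> kernels_proj_proj v u"
  proof (rule kernels_proj_projI)
    fix k
    obtain r2 where r2: "r2 > 0" "\<And>j. \<omega>2 r2 j \<le> inverse (ennreal (v k j))"
      using representsD1[OF rep2] by blast
    obtain r1 where r1: "r1 > 0" "c \<in> ell p (\<lambda>(j, i). \<omega>1 r1 i / \<omega>2 r2 j)" using c r2(1) by blast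
    obtain l where l: "\<And>i. inverse (ennreal (u l i)) \<le> \<omega>1 r1 i" using representsD2[OF rep1 r1(1)] by blast
    obtain M where M: "0 \<le> M" "\<And>a. ennreal (cmod (c a)) * (\<lambda>(j, i). \<omega>1 r1 i / \<omega>2 r2 j) a \<le> ennreal M"
      using ell_bounded[OF r1(2) p] by blast
    have "cmod (c (j, i)) * v k j \<le> M * u l i" for j i
    proof -
      have "ennreal (v k j) \<le> inverse (\<omega>2 r2 j)"
        using inverse_antimono_ennreal[OF r2(2)[of j]] by (simp add: ennreal_inverse_inverse)
      then have "ennreal (cmod (c (j, i))) * (inverse (ennreal (u l i)) * ennreal (v k j))
          \<le> ennreal (cmod (c (j, i))) * (\<omega>1 r1 i / \<omega>2 r2 j)"
        unfolding divide_ennreal_def by (intro mult_left_mono mult_mono l) auto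
      also have "\<dots> \<le> ennreal M" using M(2)[of "(j, i)"] by simp
      finally show ?thesis using M(1) V.nonneg U.nonneg by (simp add: ennreal_ratio_le_iff)
    qed
    then show "\<exists>l C. \<forall>j i. cmod (c (j, i)) * v k j \<le> C * u l i" by blast
  qed
next
  fix c assume c: "c \<in> kernels_proj_proj v u"
  have "\<exists>r1\<in>{0<..}. c \<in> ell p (\<lambda>(j, i). \<omega>1 r1 i / \<omega>2 r2 j)" if r: "0 < r2" for r2
  proof -
    obtain k where k: "\<And>j. inverse (ennreal (v k j)) \<le> \<omega>2 r2 j" using representsD2[OF rep2 r] by blast
    obtain l C where C: "0 \<le> C" "\<And>j i. cmod (c (j, i)) * v (Suc k) j \<le> C * u l i"
      using c by (rule kernels_proj_projE) blast
    obtain lv lu where n: "\<And>j. 0 \<le> lv j" "\<And>i. 0 \<le> lu i"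
      "\<And>j. v k j \<le> lv j * v (Suc k) j" "\<And>i. u l i \<le> lu i * u (Suc l) i"
      "\<And>M w c. dominated M (\<lambda>(j, i). lv j * lu i) w c \<Longrightarrow> c \<in> ell p w"
      using p by (rule pair_nuclear) blast
    obtain r1 where r1: "r1 > 0" "\<And>i. \<omega>1 r1 i \<le> inverse (ennreal (u (Suc l) i))"
      using representsD1[OF rep1] by blast
    have "dominated C (\<lambda>(j, i). lv j * lu i) (\<lambda>(j, i). \<omega>1 r1 i / \<omega>2 r2 j) c"
      unfolding dominated_def
    proof (intro conjI allI C(1), simp only: prod.case)
      fix j i
      have "inverse (\<omega>2 r2 j) \<le> ennreal (v k j)"
        using inverse_antimono_ennreal[OF k[of j]] by (simp add: ennreal_inverse_inverse)
      then have "ennreal (cmod (c (j, i))) * (\<omega>1 r1 i / \<omega>2 r2 j)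
          \<le> ennreal (cmod (c (j, i))) * (inverse (ennreal (u (Suc l) i)) * ennreal (v k j))"
        unfolding divide_ennreal_def by (intro mult_left_mono mult_mono r1) auto
      also have "\<dots> \<le> ennreal (C * (lv j * lu i))"
      proof (subst ennreal_ratio_le_iff)
        have "cmod (c (j, i)) * v k j \<le> cmod (c (j, i)) * (lv j * v (Suc k) j)"
          by (intro mult_left_mono n) simp
        also have "\<dots> = lv j * (cmod (c (j, i)) * v (Suc k) j)" by (simp add: mult_ac)
        also have "\<dots> \<le> lv j * (C * u l i)" by (intro mult_left_mono C n)
        also have "\<dots> \<le> lv j * (C * (lu i * u (Suc l) i))" by (intro mult_left_mono C n)
        finally show "cmod (c (j, i)) * v k j \<le> C * (lv j * lu i) * u (Suc l) i" by (simp add: mult_ac)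
      qed (use C(1) n V.nonneg U.nonneg in auto)
      finally show "ennreal (cmod (c (j, i))) * (\<omega>1 r1 i / \<omega>2 r2 j) \<le> ennreal (C * (lv j * lu i))" .
    qed
    then show ?thesis using n(5) r1(1) by auto
  qed
  then show "c \<in> (\<Inter>r2\<in>{0<..}. \<Union>r1\<in>{0<..}. ell p (\<lambda>(j, i). \<omega>1 r1 i / \<omega>2 r2 j))" by blast
qed

end

end

section \<open>Nuclearity of the weights\<close>

text \<open>\<open>(mabs \<alpha> + 1) ^ CARD('d)\<close> dominates the product of all
  \<open>\<alpha> i + 1\<close>. Raised to the power \<open>m * q \<ge> 2\<close>, it leaves a
  product of convergent one-dimensional series with exponent -2.\<close>

lemma summable_on_midx_powr:
  fixes m :: nat
  assumes "2 \<le> real m * q"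
  shows "(\<lambda>\<alpha> :: ('d::finite) midx. (1 / real (mabs \<alpha> + 1) ^ (CARD('d) * m)) powr q) summable_on UNIV"
proof -
  let ?f = "\<lambda>n :: nat. real (n + 1) powr (-2)"
  have "summable (\<lambda>n. real n powr (-2))" by (simp add: summable_real_powr_iff)
  then have "summable ?f" using summable_Suc_iff[of "\<lambda>n. real n powr (-2)"] by simp
  then have "Infinite_Set_Sum.abs_summable_on ?f UNIV" unfolding abs_summable_on_nat_iff' by simp
  then have "Infinite_Set_Sum.abs_summable_on (\<lambda>\<alpha> :: 'd midx. \<Prod>i\<in>UNIV. ?f (\<alpha> i)) (PiE UNIV (\<lambda>_. UNIV))"
    by (intro abs_summable_on_prod_PiE) auto
  then have s: "(\<lambda>\<alpha> :: 'd midx. \<Prod>i\<in>UNIV. ?f (\<alpha> i)) summable_on UNIV"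
    by (simp add: abs_summable_equivalent[symmetric] abs_prod)
  show ?thesis
  proof (rule summable_on_comparison_test[OF s])
    fix \<alpha> :: "'d midx"
    have "\<alpha> i \<le> mabs \<alpha>" for i
      unfolding mabs_def by (rule member_le_sum) auto
    then have "(\<Prod>i\<in>UNIV. real (\<alpha> i + 1)) \<le> (\<Prod>i\<in>(UNIV :: 'd set). real (mabs \<alpha> + 1))"
      by (intro prod_mono) (auto simp: add_mono)
    also have "\<dots> = real (mabs \<alpha> + 1) ^ CARD('d)" by simp
    finally have le: "(\<Prod>i\<in>UNIV. real (\<alpha> i + 1)) \<le> real (mabs \<alpha> + 1) ^ CARD('d)" .
    have ge1: "1 \<le> (\<Prod>i\<in>UNIV. real (\<alpha> i + 1))" by (intro prod_ge_1) auto
    have "(1 / real (mabs \<alpha> + 1) ^ (CARD('d) * m)) powr q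
        = (real (mabs \<alpha> + 1) ^ CARD('d)) powr (- (real m * q))"
    proof -
      define x where "x = real (mabs \<alpha> + 1)"
      have "(1 / x ^ (CARD('d) * m)) powr q = (x powr (- real (CARD('d) * m))) powr q"
        by (subst powr_minus, subst powr_realpow) (auto simp: x_def divide_inverse)
      also have "\<dots> = (x powr real CARD('d)) powr (- (real m * q))"
        by (simp add: powr_powr mult_ac)
      also have "x powr real CARD('d) = x ^ CARD('d)" by (rule powr_realpow) (simp add: x_def)
      finally show ?thesis by (simp only: x_def)
    qed
    also have "\<dots> \<le> (real (mabs \<alpha> + 1) ^ CARD('d)) powr (-2)"
      using assms le ge1 by (intro powr_mono) auto
    also have "\<dots> \<le> (\<Prod>i\<in>UNIV. real (\<alpha> i + 1)) powr (-2)"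
      using le ge1 by (intro powr_mono2') auto
    also have "\<dots> = (\<Prod>i\<in>UNIV. ?f (\<alpha> i))" by (rule prod_powr_distrib)
    finally show "(1 / real (mabs \<alpha> + 1) ^ (CARD('d) * m)) powr q \<le> (\<Prod>i\<in>UNIV. ?f (\<alpha> i))" .
  qed simp
qed

text \<open>Nuclearity for all exponents follows once each step gains every power of
  \<open>mabs \<alpha> + 1\<close>. The power \<open>CARD('d) * m\<close> with
  \<open>m * q \<ge> 2\<close> is the one that \<open>summable_on_midx_powr\<close> asks
  for.\<close>

lemma weight_familyI:
  fixes u :: "nat \<Rightarrow> ('d::finite) midx \<Rightarrow> real"
  assumes nonneg: "\<And>k \<alpha>. 0 \<le> u k \<alpha>" and incr: "\<And>k \<alpha>. u k \<alpha> \<le> u (Suc k) \<alpha>"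
    and ex_pos: "\<And>\<alpha>. \<exists>k. u k \<alpha> > 0"
    and rapid: "\<And>k N. \<exists>C. \<forall>\<alpha>. u k \<alpha> * real (mabs \<alpha> + 1) ^ N \<le> C * u (Suc k) \<alpha>"
  shows "weight_family u"
proof
  fix k and q :: real assume q: "0 < q"
  obtain m :: nat where m: "2 \<le> real m * q"
    using reals_Archimedean3[OF q] by (meson less_imp_le)
  define N where "N = CARD('d) * m"
  obtain C where C: "\<And>\<alpha>. u k \<alpha> * real (mabs \<alpha> + 1) ^ N \<le> C * u (Suc k) \<alpha>" using rapid by blast
  define l where "l \<alpha> = max C 0 * (1 / real (mabs \<alpha> + 1) ^ N)" for \<alpha> :: "'d midx"
  have "(\<lambda>\<alpha>. l \<alpha> powr q) summable_on UNIV"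
    unfolding l_def N_def using summable_on_midx_powr[OF m]
    by (subst powr_mult) (auto intro!: summable_on_cmult_right)
  moreover have "u k \<alpha> \<le> l \<alpha> * u (Suc k) \<alpha>" for \<alpha>
  proof -
    have "u k \<alpha> * real (mabs \<alpha> + 1) ^ N \<le> max C 0 * u (Suc k) \<alpha>"
      by (rule order_trans[OF C]) (intro mult_right_mono nonneg, simp)
    then have "u k \<alpha> \<le> max C 0 * u (Suc k) \<alpha> / real (mabs \<alpha> + 1) ^ N"
      by (subst pos_le_divide_eq) auto
    then show ?thesis by (simp add: l_def)
  qed
  moreover have "0 \<le> l \<alpha>" for \<alpha> by (simp add: l_def)
  ultimately show "\<exists>l. (\<forall>\<alpha>. 0 \<le> l \<alpha>) \<and> (\<lambda>\<alpha>. l \<alpha> powr q) summable_on UNIV \<and>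
      (\<forall>\<alpha>. u k \<alpha> \<le> l \<alpha> * u (Suc k) \<alpha>)" by blast
qed (fact nonneg incr ex_pos)+

lemma exp_decay_bounded:
  fixes \<delta> a :: real
  assumes "0 < \<delta>" "0 < a"
  shows "\<exists>C. \<forall>n::nat. exp (- \<delta> * real n powr a) * real (n + 1) ^ N \<le> C"
proof -
  have "((\<lambda>n::nat. exp (- \<delta> * real n powr a) * real (n + 1) ^ N) \<longlongrightarrow> 0) sequentially"
    using assms by real_asymp
  then have "Bseq (\<lambda>n::nat. exp (- \<delta> * real n powr a) * real (n + 1) ^ N)"
    by (intro convergent_imp_Bseq convergentI)
  then show ?thesis by (auto simp: Bseq_def)
qed

section \<open>The weights of the spaces\<close>

definition weight_real :: "real \<Rightarrow> flat_index \<Rightarrow> ('d::finite) midx \<Rightarrow> real"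
  where "weight_real r s \<alpha> = enn2real (weight r s \<alpha>)"

lemma weight_eq_weight_real:
  assumes "s \<in> R_flat_bar" "s \<noteq> Num 0" "0 < r"
  shows "weight r s \<alpha> = ennreal (weight_real r s \<alpha>)" "0 < weight_real r s \<alpha>"
  using assms mfact_pos[of \<alpha>]
  by (cases s; auto simp: weight_real_def R_flat_bar_def powr_gt_zero)+

lemma weight_real_mono:
  assumes "s \<in> R_flat_bar" "s \<noteq> Num 0" "0 < r" "r \<le> r'"
  shows "weight_real r s \<alpha> \<le> weight_real r' s \<alpha>"
  using weight_mono[OF assms(3,4,1,2), of \<alpha>] assms weight_eq_weight_real[OF assms(1,2), of _ \<alpha>]
  by (metis ennreal_le_iff less_imp_le order_less_le_trans)

text \<open>The quotient of the two weights is
  \<open>exp (- \<delta> * mabs \<alpha> powr a)\<close>: for \<open>Num t\<close> with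
  \<open>\<delta> = r' - r\<close> and \<open>a = 1 / (2 * t)\<close>, for \<open>Flat\<close> with
  \<open>\<delta> = ln (r' / r)\<close> and \<open>a = 1\<close>, as the factorials cancel. Such
  decay beats every polynomial.\<close>

lemma weight_real_rapid:
  assumes s: "s \<in> R_flat_bar" "s \<noteq> Num 0" and r: "0 < r" "r < r'"
  shows "\<exists>C. \<forall>\<alpha> :: ('d::finite) midx. weight_real r s \<alpha> * real (mabs \<alpha> + 1) ^ N \<le> C * weight_real r' s \<alpha>"
proof -
  obtain \<delta> a where d: "0 < \<delta>" "0 < a"
    and eq: "\<And>\<alpha> :: 'd midx. weight_real r s \<alpha> = exp (- \<delta> * real (mabs \<alpha>) powr a) * weight_real r' s \<alpha>"
  proof (cases s)
    case (Num t)
    then have t: "t > 0" using s by (auto simp: R_flat_bar_def)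
    have "weight_real r s \<alpha> = exp (- (r' - r) * real (mabs \<alpha>) powr (1 / (2 * t))) * weight_real r' s \<alpha>"
      for \<alpha> :: "'d midx"
      using t by (simp add: Num weight_real_def algebra_simps flip: exp_add)
    then show ?thesis using that[of "r' - r" "1 / (2 * t)"] r t by simp
  next
    case (Flat \<sigma>)
    have ratio: "r ^ n = exp (- ln (r' / r) * real n powr 1) * r' ^ n" for n
    proof -
      have "exp (- ln (r' / r) * real n) = (r / r') ^ n"
        using r by (simp add: exp_of_nat2_mult ln_div exp_diff)
      then show ?thesis using r by (simp add: power_divide)
    qed
    have "weight_real r s \<alpha> = exp (- ln (r' / r) * real (mabs \<alpha>) powr 1) * weight_real r' s \<alpha>"
      for \<alpha> :: "'d midx"
      using r ratio[of "mabs \<alpha>"] by (simp add: Flat weight_real_def)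
    then show ?thesis using that[of "ln (r' / r)" 1] r by simp
  qed
  obtain C where C: "\<And>n::nat. exp (- \<delta> * real n powr a) * real (n + 1) ^ N \<le> C"
    using exp_decay_bounded[OF d] by blast
  have "weight_real r s \<alpha> * real (mabs \<alpha> + 1) ^ N \<le> C * weight_real r' s \<alpha>" for \<alpha> :: "'d midx"
  proof -
    have "weight_real r s \<alpha> * real (mabs \<alpha> + 1) ^ N =
        (exp (- \<delta> * real (mabs \<alpha>) powr a) * real (mabs \<alpha> + 1) ^ N) * weight_real r' s \<alpha>"
      by (simp only: eq mult_ac)
    also have "\<dots> \<le> C * weight_real r' s \<alpha>"
      using C by (rule mult_right_mono) (simp add: weight_real_def)
    finally show ?thesis .
  qed
  then show ?thesis by blast
qed

text \<open>At index 0 the indicator is the reciprocal of the weight with \<open>r = k\<close>, read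
  with \<open>1 / infinity = 0\<close>; otherwise \<open>r = 1 / (k + 1)\<close> runs through a null
  sequence. Both choices increase with \<open>k\<close>.\<close>

definition ind_weights :: "flat_index \<Rightarrow> nat \<Rightarrow> ('d::finite) midx \<Rightarrow> real"
  where "ind_weights s k \<alpha> =
    (if s = Num 0 then of_bool (mabs \<alpha> \<le> k) else 1 / weight_real (1 / real (k + 1)) s \<alpha>)"

text \<open>In the spaces with subscript 0 the parameter tends to infinity and the weight itself
  plays the part of \<open>u\<close>: \<open>ell_0s\<close> is then the projective and
  \<open>ell_0s_star\<close> the inductive limit, opposite to \<open>ell_s\<close> and
  \<open>ell_s_star\<close>.\<close>

definition ind_weights0 :: "flat_index \<Rightarrow> nat \<Rightarrow> ('d::finite) midx \<Rightarrow> real"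
  where "ind_weights0 s k = weight_real (real (k + 1)) s"

lemma weight_family_ind_weights:
  assumes s: "s \<in> R_flat_bar"
  shows "weight_family (ind_weights s :: nat \<Rightarrow> ('d::finite) midx \<Rightarrow> real)"
proof (cases "s = Num 0")
  case True
  show ?thesis
  proof (rule weight_familyI)
    fix k N
    \<comment> \<open>Where the indicator is nonzero, \<open>mabs \<alpha> \<le> k\<close> bounds
      the polynomial.\<close>
    have "ind_weights s k \<alpha> * real (mabs \<alpha> + 1) ^ N \<le> real (k + 1) ^ N * ind_weights s (Suc k) \<alpha>"
      for \<alpha> :: "'d midx"
      using True by (auto simp: ind_weights_def intro: power_mono)
    then show "\<exists>C. \<forall>\<alpha> :: 'd midx. ind_weights s k \<alpha> * real (mabs \<alpha> + 1) ^ N \<le> C * ind_weights s (Suc k) \<alpha>"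
      by blast
  qed (use True in \<open>auto simp: ind_weights_def\<close>)
next
  case False
  have pos: "0 < weight_real (1 / real (k + 1)) s \<alpha>" for k and \<alpha> :: "'d midx"
    using s False by (intro weight_eq_weight_real(2)) auto
  show ?thesis
  proof (rule weight_familyI)
    fix k N
    have "1 / real (Suc k + 1) < 1 / real (k + 1)" by (simp add: field_simps)
    then obtain C where C: "\<And>\<alpha> :: 'd midx. weight_real (1 / real (Suc k + 1)) s \<alpha> * real (mabs \<alpha> + 1) ^ N
        \<le> C * weight_real (1 / real (k + 1)) s \<alpha>"
      using weight_real_rapid[OF s False, of "1 / real (Suc k + 1)" "1 / real (k + 1)" N] by auto
    have "ind_weights s k \<alpha> * real (mabs \<alpha> + 1) ^ N \<le> C * ind_weights s (Suc k) \<alpha>" for \<alpha> :: "'d midx"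
    proof -
      have "1 / x * y \<le> C * (1 / z)" if "0 < x" "0 < z" "z * y \<le> C * x" for x y z :: real
        using that by (simp add: field_simps)
      from this[OF pos[of k \<alpha>] pos[of "Suc k" \<alpha>] C] show ?thesis
        using False by (simp add: ind_weights_def)
    qed
    then show "\<exists>C. \<forall>\<alpha> :: 'd midx. ind_weights s k \<alpha> * real (mabs \<alpha> + 1) ^ N \<le> C * ind_weights s (Suc k) \<alpha>"
      by blast
  next
    fix k and \<alpha> :: "'d midx"
    have "weight_real (1 / real (Suc k + 1)) s \<alpha> \<le> weight_real (1 / real (k + 1)) s \<alpha>"
      using s False by (intro weight_real_mono) (auto simp: field_simps)
    then show "ind_weights s k \<alpha> \<le> ind_weights s (Suc k) \<alpha>"
      using False pos[of k \<alpha>] pos[of "Suc k" \<alpha>] by (simp add: ind_weights_def frac_le)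
  next
    fix \<alpha> :: "'d midx"
    show "\<exists>k. 0 < ind_weights s k \<alpha>" using False pos by (auto simp: ind_weights_def)
  qed (use False pos in \<open>auto simp: ind_weights_def intro: less_imp_le\<close>)
qed

lemma weight_family_ind_weights0:
  assumes s: "s \<in> R_flat_bar" "s \<noteq> Num 0"
  shows "weight_family (ind_weights0 s :: nat \<Rightarrow> ('d::finite) midx \<Rightarrow> real)"
proof (rule weight_familyI)
  have pos: "0 < ind_weights0 s k \<alpha>" for k and \<alpha> :: "'d midx"
    unfolding ind_weights0_def using s by (intro weight_eq_weight_real(2)) auto
  show "0 \<le> ind_weights0 s k \<alpha>" for k and \<alpha> :: "'d midx" using pos less_imp_le by blast
  show "\<exists>k. 0 < ind_weights0 s k \<alpha>" for \<alpha> :: "'d midx" using pos by blast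
  show "ind_weights0 s k \<alpha> \<le> ind_weights0 s (Suc k) \<alpha>" for k and \<alpha> :: "'d midx"
    unfolding ind_weights0_def using s by (intro weight_real_mono) auto
  show "\<exists>C. \<forall>\<alpha> :: 'd midx. ind_weights0 s k \<alpha> * real (mabs \<alpha> + 1) ^ N \<le> C * ind_weights0 s (Suc k) \<alpha>" for k N
    unfolding ind_weights0_def using s by (intro weight_real_rapid) auto
qed

lemma represents_weight:
  assumes s: "s \<in> R_flat_bar"
  shows "represents (\<lambda>r. weight r s) (ind_weights s :: nat \<Rightarrow> ('d::finite) midx \<Rightarrow> real)"
proof (cases "s = Num 0")
  case True
  have inv: "inverse (ennreal (ind_weights s k \<alpha>)) = (if mabs \<alpha> \<le> k then 1 else top)" for k and \<alpha> :: "'d midx"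
    using True by (simp add: ind_weights_def)
  show ?thesis
    unfolding represents_def inv
  proof (intro conjI allI impI)
    fix k
    show "\<exists>r>0. \<forall>\<alpha> :: 'd midx. weight r s \<alpha> \<le> (if mabs \<alpha> \<le> k then 1 else top)"
      \<comment> \<open>The choice \<open>r = k\<close> would fail at \<open>k = 0\<close>, since
        \<open>r\<close> must be positive.\<close>
      using True by (intro exI[of _ "real k + 1"]) auto
  next
    fix r :: real assume "0 < r"
    obtain k :: nat where "r \<le> real k" using real_arch_simple by blast
    then show "\<exists>k. \<forall>\<alpha> :: 'd midx. (if mabs \<alpha> \<le> k then 1 else top) \<le> weight r s \<alpha>"
      using True by (intro exI[of _ k]) auto
  qed
next
  case False
  have inv: "inverse (ennreal (ind_weights s k \<alpha>)) = weight (1 / real (k + 1)) s \<alpha>" for k and \<alpha> :: "'d midx"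
    using False weight_eq_weight_real[OF s False, of "1 / real (k + 1)" \<alpha>]
    by (simp add: ind_weights_def inverse_ennreal)
  show ?thesis
    unfolding represents_def inv
  proof (intro conjI allI impI)
    fix k
    show "\<exists>r>0. \<forall>\<alpha> :: 'd midx. weight r s \<alpha> \<le> weight (1 / real (k + 1)) s \<alpha>"
      by (intro exI[of _ "1 / real (k + 1)"]) auto
  next
    fix r :: real assume r: "0 < r"
    obtain k where "1 / real (Suc k) < r" using nat_approx_posE[OF r] by blast
    then show "\<exists>k. \<forall>\<alpha> :: 'd midx. weight (1 / real (k + 1)) s \<alpha> \<le> weight r s \<alpha>"
      using s False by (intro exI[of _ k] allI weight_mono) auto
  qed
qed

text \<open>The represented family consists of reciprocals, so its inductive limit is
  \<open>ell_0s_star\<close>; the weights of \<open>ell_0s\<close> reappear after one more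
  reciprocal.\<close>

lemma represents_weight0:
  assumes s: "s \<in> R_flat_bar" "s \<noteq> Num 0"
  shows "represents (\<lambda>r \<alpha>. 1 / weight r s \<alpha>) (ind_weights0 s :: nat \<Rightarrow> ('d::finite) midx \<Rightarrow> real)"
proof -
  have inv: "inverse (ennreal (ind_weights0 s k \<alpha>)) = 1 / weight (real (k + 1)) s \<alpha>" for k and \<alpha> :: "'d midx"
    using weight_eq_weight_real[OF s, of "real (k + 1)" \<alpha>]
    by (simp add: ind_weights0_def divide_ennreal_def)
  show ?thesis
    unfolding represents_def inv
  proof (intro conjI allI impI)
    fix k
    show "\<exists>r>0. \<forall>\<alpha> :: 'd midx. 1 / weight r s \<alpha> \<le> 1 / weight (real (k + 1)) s \<alpha>"
      by (intro exI[of _ "real (k + 1)"]) auto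
  next
    fix r :: real assume r: "0 < r"
    obtain k :: nat where k: "r \<le> real k" using real_arch_simple by blast
    have "1 / weight (real (k + 1)) s \<alpha> \<le> 1 / weight r s \<alpha>" for \<alpha> :: "'d midx"
      using inverse_antimono_ennreal[OF weight_mono[OF r _ s, of "real (k + 1)" \<alpha>]] k
      by (simp add: divide_ennreal_def)
    then show "\<exists>k. \<forall>\<alpha> :: 'd midx. 1 / weight (real (k + 1)) s \<alpha> \<le> 1 / weight r s \<alpha>" by blast
  qed
qed

lemma lin_space_ell_s:
  assumes "s \<in> R_flat_bar" "0 < p"
  shows "lin_space (ell_s p s) (ind_space (ind_weights s)) (ind_nbhd (ind_weights s))"
  unfolding ell_s_def
  by (rule weight_family.ind_space_lin_space[OF weight_family_ind_weights represents_weight]) fact+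

lemma lin_space_ell_s_star:
  assumes "s \<in> R_flat_bar" "0 < p"
  shows "lin_space (ell_s_star p s) (proj_space (ind_weights s)) (proj_nbhd (ind_weights s))"
  unfolding ell_s_star_def
  by (rule weight_family.proj_space_lin_space[OF weight_family_ind_weights represents_weight]) fact+

lemma ennreal_one_div_one_div: "1 / (1 / x) = (x :: ennreal)"
  by (simp add: divide_ennreal_def ennreal_inverse_inverse)

lemma lin_space_ell_0s:
  assumes "s \<in> R_flat_bar" "s \<noteq> Num 0" "0 < p"
  shows "lin_space (ell_0s p s) (proj_space (ind_weights0 s)) (proj_nbhd (ind_weights0 s))"
  using weight_family.proj_space_lin_space[OF weight_family_ind_weights0 represents_weight0, OF assms(1,2,1,2,3)]
  using assms(2) by (simp add: ell_0s_def ennreal_one_div_one_div)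

lemma lin_space_ell_0s_star:
  assumes "s \<in> R_flat_bar" "s \<noteq> Num 0" "0 < p"
  shows "lin_space (ell_0s_star p s) (ind_space (ind_weights0 s)) (ind_nbhd (ind_weights0 s))"
  using weight_family.ind_space_lin_space[OF weight_family_ind_weights0 represents_weight0, OF assms(1,2,1,2,3)]
  using assms(2) by (simp add: ell_0s_star_def)

text \<open>For the spaces with subscript 0 at index 0, which no weight family describes since they
  contain no unit vectors.\<close>

lemma lin_space_zero: "lin_space (discrete_topology {\<lambda>_. 0}) {\<lambda>_. 0} (\<lambda>V. V = {\<lambda>_. 0})"
  by standard (auto simp: lin_comb_def)

lemma unit_series_polynomial:
  assumes "0 < p"
  shows "series_e (unit_seq \<alpha>) \<in> topspace (A_s p (Num 0))"
proof -
  have s: "Num 0 \<in> R_flat_bar" by (simp add: R_flat_bar_def)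
  show ?thesis
    by (simp add: A_s_def topspace_pullback_coeff_e coeff_e_series_e
        lin_space.topspace_eq[OF lin_space_ell_s[OF s assms]]
        weight_family.unit_seq_ind_space[OF weight_family_ind_weights[OF s]])
qed

section \<open>The coefficient spaces of the eight kernel spaces\<close>

lemma weight_pair_ind_weights:
  assumes "s1 \<in> R_flat_bar" "s2 \<in> R_flat_bar"
  shows "weight_pair (ind_weights s2) (ind_weights s1)"
  using assms by (intro weight_pair.intro weight_family_ind_weights)

lemma ell_A_eq:
  assumes "0 < p" "s1 \<in> R_flat_bar" "s2 \<in> R_flat_bar"
  shows "ell_A p s2 s1 = kernels_proj_ind (ind_weights s2) (ind_weights s1)"
  unfolding ell_A_def w_prod_def
  by (rule weight_pair.ell_product_eq[OF weight_pair_ind_weights[OF assms(2,3)] assms(1)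
        represents_weight[OF assms(3)] represents_weight[OF assms(2)]])

lemma ell_A_star_eq:
  assumes "0 < p" "s1 \<in> R_flat_bar" "s2 \<in> R_flat_bar"
  shows "(ell_A_star p s2 s1 :: (('d2::finite) midx \<times> ('d1::finite) midx \<Rightarrow> complex) set) = kernels_ind_proj (ind_weights s2) (ind_weights s1)"
proof -
  have "(\<lambda>\<alpha> :: 'd2 midx \<times> 'd1 midx. 1 / w_prod s2 s1 r2 r1 \<alpha>) = (\<lambda>(\<alpha>2, \<alpha>1). 1 / (weight r2 s2 \<alpha>2 * weight r1 s1 \<alpha>1))" for r2 r1
    by (auto simp: w_prod_def)
  then show ?thesis
    unfolding ell_A_star_def
    by (simp only: weight_pair.ell_inverse_product_eq[OF weight_pair_ind_weights[OF assms(2,3)] assms(1)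
        represents_weight[OF assms(3)] represents_weight[OF assms(2)]])
qed

lemma ell_B_eq:
  assumes "0 < p" "s1 \<in> R_flat_bar" "s2 \<in> R_flat_bar"
  shows "ell_B p s2 s1 = kernels_ind_ind (ind_weights s2) (ind_weights s1)"
  unfolding ell_B_def w_quot_def
  by (rule weight_pair.ell_quotient_eq[OF weight_pair_ind_weights[OF assms(2,3)] assms(1)
        represents_weight[OF assms(3)] represents_weight[OF assms(2)]])

lemma ell_B_star_eq:
  assumes "0 < p" "s1 \<in> R_flat_bar" "s2 \<in> R_flat_bar"
  shows "ell_B_star p s2 s1 = kernels_proj_proj (ind_weights s2) (ind_weights s1)"
  unfolding ell_B_star_def w_quot_star_def
  by (rule weight_pair.ell_quotient_star_eq[OF weight_pair_ind_weights[OF assms(2,3)] assms(1)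
        represents_weight[OF assms(3)] represents_weight[OF assms(2)]])

text \<open>Away from index 0 all weights are positive reals, so the usual rules for fractions hold
  in \<open>ennreal\<close>; they translate reciprocal weights back into those of the
  definitions.\<close>

lemma weight_quotient_inverse:
  assumes "s1 \<in> R_flat_bar" "s1 \<noteq> Num 0" "0 < r1" "s2 \<in> R_flat_bar" "s2 \<noteq> Num 0" "0 < r2"
  shows "(1 / weight r1 s1 \<alpha>) / (1 / weight r2 s2 \<beta>) = weight r2 s2 \<beta> / weight r1 s1 \<alpha>"
    and "(1 / weight r1 s1 \<alpha>) * (1 / weight r2 s2 \<beta>) = 1 / (weight r1 s1 \<alpha> * weight r2 s2 \<beta>)"
proof -
  obtain x where x: "weight r1 s1 \<alpha> = ennreal x" "0 < x" using weight_eq_weight_real[OF assms(1-3)] by blast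
  obtain y where y: "weight r2 s2 \<beta> = ennreal y" "0 < y" using weight_eq_weight_real[OF assms(4-6)] by blast
  show "(1 / weight r1 s1 \<alpha>) / (1 / weight r2 s2 \<beta>) = weight r2 s2 \<beta> / weight r1 s1 \<alpha>"
    "(1 / weight r1 s1 \<alpha>) * (1 / weight r2 s2 \<beta>) = 1 / (weight r1 s1 \<alpha> * weight r2 s2 \<beta>)"
    unfolding x(1) y(1) using x(2) y(2)
    by (simp_all add: divide_ennreal_def inverse_ennreal field_simps flip: ennreal_mult ennreal_1)
qed

context
  fixes p :: ennreal and s1 s2 :: flat_index
  assumes p: "0 < p" and s: "s1 \<in> R_flat_bar" "s2 \<in> R_flat_bar" and nz: "s1 \<noteq> Num 0" "s2 \<noteq> Num 0"
begin

lemma weight_pair_ind_weights0: "weight_pair (ind_weights0 s2) (ind_weights0 s1)"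
  by (intro weight_pair.intro weight_family_ind_weights0 s nz)

text \<open>These kernels map the inductive limit \<open>ell_0s_star\<close> into the projective
  limit \<open>ell_0s\<close>. The single parameter of \<open>ell_A0\<close> replaces two by their
  maximum, as both weights increase with \<open>r\<close>.\<close>

lemma ell_A0_eq:
  "(ell_A0 p s2 s1 :: (('d2::finite) midx \<times> ('d1::finite) midx \<Rightarrow> complex) set) = kernels_ind_proj (ind_weights0 s2) (ind_weights0 s1)"
proof -
  have eq: "(\<lambda>(\<alpha>2 :: 'd2 midx, \<alpha>1 :: 'd1 midx). 1 / (1 / weight r2 s2 \<alpha>2 * (1 / weight r1 s1 \<alpha>1))) = w_prod s2 s1 r2 r1"
    if "0 < r2" "0 < r1" for r2 r1
    using s nz that by (auto simp: w_prod_def weight_quotient_inverse ennreal_one_div_one_div)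
  have mono: "ell p (w_prod s2 s1 (max r2 r1) (max r2 r1) :: 'd2 midx \<times> 'd1 midx \<Rightarrow> ennreal) \<subseteq> ell p (w_prod s2 s1 r2 r1)"
    if "0 < r2" "0 < r1" for r2 r1
    using s nz that unfolding w_prod_def
    by (intro ell_antimono) (auto simp del: weight.simps intro!: mult_mono weight_mono)
  have "kernels_ind_proj (ind_weights0 s2) (ind_weights0 s1)
      = ((\<Inter>r2\<in>{0<..}. \<Inter>r1\<in>{0<..}. ell p (w_prod s2 s1 r2 r1)) :: ('d2 midx \<times> 'd1 midx \<Rightarrow> complex) set)"
    unfolding weight_pair.ell_inverse_product_eq[OF weight_pair_ind_weights0 p
        represents_weight0[OF s(2) nz(2)] represents_weight0[OF s(1) nz(1)], symmetric]
    using eq by (intro INF_cong) auto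
  also have "\<dots> = (\<Inter>r\<in>{0<..}. ell p (w_prod s2 s1 r r))"
  proof (intro equalityI subsetI INT_I)
    fix r2 r1 :: real and x :: "'d2 midx \<times> 'd1 midx \<Rightarrow> complex" assume "x \<in> (\<Inter>r\<in>{0<..}. ell p (w_prod s2 s1 r r))" "r2 \<in> {0<..}" "r1 \<in> {0<..}"
    then show "x \<in> ell p (w_prod s2 s1 r2 r1)" using mono[of r2 r1] by auto
  qed auto
  finally show ?thesis using nz by (simp add: ell_A0_def)
qed

lemma ell_A0_star_eq:
  "(ell_A0_star p s2 s1 :: (('d2::finite) midx \<times> ('d1::finite) midx \<Rightarrow> complex) set) = kernels_proj_ind (ind_weights0 s2) (ind_weights0 s1)"
proof -
  have eq: "(\<lambda>(\<alpha>2 :: 'd2 midx, \<alpha>1 :: 'd1 midx). 1 / weight r2 s2 \<alpha>2 * (1 / weight r1 s1 \<alpha>1)) = (\<lambda>\<alpha>. 1 / w_prod s2 s1 r2 r1 \<alpha>)"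
    if "0 < r2" "0 < r1" for r2 r1
    using s nz that by (auto simp: w_prod_def weight_quotient_inverse)
  have mono: "ell p (\<lambda>\<alpha> :: 'd2 midx \<times> 'd1 midx. 1 / w_prod s2 s1 r2 r1 \<alpha>) \<subseteq> ell p (\<lambda>\<alpha>. 1 / w_prod s2 s1 (max r2 r1) (max r2 r1) \<alpha>)"
    if "0 < r2" "0 < r1" for r2 r1
    using s nz that unfolding w_prod_def divide_ennreal_def mult_1
    by (intro ell_antimono inverse_antimono_ennreal)
       (auto simp del: weight.simps intro!: mult_mono weight_mono)
  have "kernels_proj_ind (ind_weights0 s2) (ind_weights0 s1)
      = ((\<Union>r2\<in>{0<..}. \<Union>r1\<in>{0<..}. ell p (\<lambda>\<alpha>. 1 / w_prod s2 s1 r2 r1 \<alpha>)) :: ('d2 midx \<times> 'd1 midx \<Rightarrow> complex) set)"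
    unfolding weight_pair.ell_product_eq[OF weight_pair_ind_weights0 p
        represents_weight0[OF s(2) nz(2)] represents_weight0[OF s(1) nz(1)], symmetric]
    using eq by (intro SUP_cong) auto
  also have "\<dots> = (\<Union>r\<in>{0<..}. ell p (\<lambda>\<alpha>. 1 / w_prod s2 s1 r r \<alpha>))"
  proof (intro equalityI subsetI)
    fix x :: "'d2 midx \<times> 'd1 midx \<Rightarrow> complex" assume "x \<in> (\<Union>r2\<in>{0<..}. \<Union>r1\<in>{0<..}. ell p (\<lambda>\<alpha>. 1 / w_prod s2 s1 r2 r1 \<alpha>))"
    then obtain r2 r1 where r: "0 < r2" "0 < r1" "x \<in> ell p (\<lambda>\<alpha>. 1 / w_prod s2 s1 r2 r1 \<alpha>)" by auto
    have "x \<in> ell p (\<lambda>\<alpha>. 1 / w_prod s2 s1 (max r2 r1) (max r2 r1) \<alpha>)" by (rule subsetD[OF mono[OF r(1,2)] r(3)])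
    then show "x \<in> (\<Union>r\<in>{0<..}. ell p (\<lambda>\<alpha>. 1 / w_prod s2 s1 r r \<alpha>))"
      using r(1) by (intro UN_I[of "max r2 r1"]) auto
  qed auto
  finally show ?thesis using nz by (simp add: ell_A0_star_def)
qed

text \<open>With reciprocal weights the quotient becomes that of
  \<open>ell_quotient_star_eq\<close>, and the order of the limits agrees: intersection over the
  target, union over the domain.\<close>

lemma ell_B0_eq:
  "(ell_B0 p s2 s1 :: (('d2::finite) midx \<times> ('d1::finite) midx \<Rightarrow> complex) set) = kernels_proj_proj (ind_weights0 s2) (ind_weights0 s1)"
proof -
  have eq: "(\<lambda>(\<alpha>2 :: 'd2 midx, \<alpha>1 :: 'd1 midx). 1 / weight r1 s1 \<alpha>1 / (1 / weight r2 s2 \<alpha>2)) = w_quot s2 s1 r2 r1"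
    if "0 < r2" "0 < r1" for r2 r1
    using s nz that by (auto simp: w_quot_def weight_quotient_inverse)
  show ?thesis
    unfolding weight_pair.ell_quotient_star_eq[OF weight_pair_ind_weights0 p
        represents_weight0[OF s(2) nz(2)] represents_weight0[OF s(1) nz(1)], symmetric]
    using eq nz by (auto simp: ell_B0_def)
qed

lemma ell_B0_star_eq:
  "(ell_B0_star p s2 s1 :: (('d2::finite) midx \<times> ('d1::finite) midx \<Rightarrow> complex) set) = kernels_ind_ind (ind_weights0 s2) (ind_weights0 s1)"
proof -
  have eq: "(\<lambda>(\<alpha>2 :: 'd2 midx, \<alpha>1 :: 'd1 midx). 1 / weight r2 s2 \<alpha>2 / (1 / weight r1 s1 \<alpha>1)) = w_quot_star s2 s1 r2 r1"
    if "0 < r2" "0 < r1" for r2 r1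
    using s nz that by (auto simp: w_quot_star_def weight_quotient_inverse)
  show ?thesis
    unfolding weight_pair.ell_quotient_eq[OF weight_pair_ind_weights0 p
        represents_weight0[OF s(2) nz(2)] represents_weight0[OF s(1) nz(1)], symmetric]
    using eq nz by (auto simp: ell_B0_star_def)
qed

end

section \<open>The kernel theorem\<close>

lemma coeff_e_eq_zero_iff: "coeff_e F = (\<lambda>_. 0) \<longleftrightarrow> F = (\<lambda>_. 0)"
  by (auto simp: coeff_e_def fun_eq_iff mfact_nz)

lemma kernel_iso_zero:
  fixes X1 :: "(('d1::finite) midx \<Rightarrow> complex) topology" and X2 :: "(('d2::finite) midx \<Rightarrow> complex) topology"
  defines "V1 \<equiv> pullback_topology UNIV coeff_e X1" and "V2 \<equiv> pullback_topology UNIV coeff_e X2"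
  assumes X1: "lin_space X1 E1 N1" and X2: "lin_space X2 E2 N2"
    and zero: "E1 = {\<lambda>_. 0} \<or> E2 = {\<lambda>_. 0}"
  shows "kernel_iso p {K. coeff_K K \<in> {\<lambda>_. 0}} V1 V2"
proof -
  interpret X1: lin_space X1 E1 N1 by fact
  interpret X2: lin_space X2 E2 N2 by fact
  define Z :: "'d1 fser \<Rightarrow> 'd2 fser" where "Z = restrict (\<lambda>_ _. 0) (topspace V1)"
  have top: "topspace V1 = {F. coeff_e F \<in> E1}" "topspace V2 = {F. coeff_e F \<in> E2}"
    by (simp_all add: V1_def V2_def topspace_pullback_coeff_e X1.topspace_eq X2.topspace_eq)
  have zero_top: "(\<lambda>_. 0) \<in> topspace V1" "(\<lambda>_. 0) \<in> topspace V2"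
    using X1.zero_mem X2.zero_mem by (simp_all add: top coeff_e_eq_zero_iff[THEN iffD2])
  have Z: "Z \<in> CL V1 V2"
    unfolding CL_def
  proof (intro CollectI conjI ballI allI)
    show "Z \<in> extensional (topspace V1)" by (simp add: Z_def)
    have "continuous_map V1 V2 (\<lambda>_ _. 0)" using zero_top by simp
    then show "continuous_map V1 V2 Z" by (rule continuous_map_eq) (simp add: Z_def)
    fix x y a b assume "x \<in> topspace V1" "y \<in> topspace V1"
    then show "Z (lin_comb a x b y) = lin_comb a (Z x) b (Z y)"
      using X1.lin_comb_mem by (simp add: Z_def top lin_comb_coeff_e) (simp add: lin_comb_def)
  qed
  have CL_zero: "T = Z" if T: "T \<in> CL V1 V2" for T
  proof (rule extensionalityI)
    show "T \<in> extensional (topspace V1)" "Z \<in> extensional (topspace V1)"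
      using T Z by (auto simp: CL_def)
    fix F assume F: "F \<in> topspace V1"
    \<comment> \<open>Linearity with both coefficients 0 shows that \<open>T\<close> fixes zero,
      which is the only point of the domain in the first case below.\<close>
    have lin: "T (lin_comb 0 F 0 F) = lin_comb 0 (T F) 0 (T F)" using T F by (simp add: CL_def)
    have "T F = (\<lambda>_. 0)"
      using zero
    proof
      assume "E1 = {\<lambda>_. 0}"
      then have "F = (\<lambda>_. 0)" using F by (simp add: top coeff_e_eq_zero_iff)
      then show ?thesis using lin by (simp add: lin_comb_def)
    next
      assume E2: "E2 = {\<lambda>_. 0}"
      have "T F \<in> topspace V2" using T F by (auto simp: CL_def continuous_map_def)
      then show ?thesis using E2 by (simp add: top coeff_e_eq_zero_iff)
    qed
    then show "T F = Z F" using F by (simp add: Z_def)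
  qed
  have CL: "CL V1 V2 = {Z}" using Z CL_zero by blast
  have K: "{K. coeff_K K \<in> {\<lambda>_. 0}} = {(\<lambda>_. 0) :: ('d2, 'd1) kernel}"
    by (auto simp: coeff_K_def fun_eq_iff mfact_nz)
  have T_op: "T_op (\<lambda>_. 0) F = (\<lambda>_. 0)" for F :: "'d1 fser"
    by (simp add: T_op_def coeff_K_def series_e_eq fun_eq_iff case_prod_unfold)
  have ext: "is_ext p V1 V2 (\<lambda>_. 0) T \<longleftrightarrow> T = Z" for T
    by (auto simp: is_ext_def CL T_op) (simp add: Z_def)
  have T_ext: "T_ext p V1 V2 (\<lambda>_. 0) = Z" by (simp add: T_ext_def ext)
  have lc: "lin_comb a (\<lambda>_. 0) b (\<lambda>_. 0) = (\<lambda>_. 0)" for a b :: complex by (simp add: lin_comb_def)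
  show ?thesis
    unfolding kernel_iso_def K by (auto simp: ext T_ext lc CL Z_def)
qed

text \<open>Index 0 and the other indices have different neighbourhood bases; hiding them lets
  \<open>kernel_iso_zero\<close> apply when only one of the two indices is 0.\<close>

lemma lin_space_ell_0s_ex:
  assumes "s \<in> R_flat_bar" "0 < p"
  shows "\<exists>E N. lin_space (ell_0s p s) E N \<and> (s = Num 0 \<longrightarrow> E = {\<lambda>_. 0})"
proof (cases "s = Num 0")
  case True
  then show ?thesis using lin_space_zero by (auto simp: ell_0s_def)
next
  case False
  then show ?thesis using lin_space_ell_0s[OF assms(1) False assms(2)] by blast
qed

lemma lin_space_ell_0s_star_ex:
  assumes "s \<in> R_flat_bar" "0 < p"
  shows "\<exists>E N. lin_space (ell_0s_star p s) E N \<and> (s = Num 0 \<longrightarrow> E = {\<lambda>_. 0})"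
proof (cases "s = Num 0")
  case True
  then show ?thesis using lin_space_zero by (auto simp: ell_0s_star_def)
next
  case False
  then show ?thesis using lin_space_ell_0s_star[OF assms(1) False assms(2)] by blast
qed

theorem corollary2p6:
  fixes p :: ennreal and s1 s2 :: flat_index
  assumes "0 < p" and "s1 \<in> R_flat_bar" and "s2 \<in> R_flat_bar"
  shows "kernel_iso p (Ahat p s2 s1 :: ('d2::finite, 'd1::finite) kernel set) (A_s' p s1) (A_s p s2) \<and>
    kernel_iso p (Ahat' p s2 s1 :: ('d2, 'd1) kernel set) (A_s p s1) (A_s' p s2) \<and>
    kernel_iso p (Bhat p s2 s1 :: ('d2, 'd1) kernel set) (A_s p s1) (A_s p s2) \<and>
    kernel_iso p (Bhat_star p s2 s1 :: ('d2, 'd1) kernel set) (A_s' p s1) (A_s' p s2) \<and>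
    kernel_iso p (Ahat0 p s2 s1 :: ('d2, 'd1) kernel set) (A_0s' p s1) (A_0s p s2) \<and>
    kernel_iso p (Ahat0' p s2 s1 :: ('d2, 'd1) kernel set) (A_0s p s1) (A_0s' p s2) \<and>
    kernel_iso p (Bhat0 p s2 s1 :: ('d2, 'd1) kernel set) (A_0s p s1) (A_0s p s2) \<and>
    kernel_iso p (Bhat0_star p s2 s1 :: ('d2, 'd1) kernel set) (A_0s' p s1) (A_0s' p s2)"
proof -
  note iso = kernel_iso_pullback[OF _ unit_series_polynomial[OF assms(1)]]
  have pair: "weight_pair (ind_weights s2 :: _ \<Rightarrow> 'd2 midx \<Rightarrow> _) (ind_weights s1 :: _ \<Rightarrow> 'd1 midx \<Rightarrow> _)"
    using assms(2,3) by (rule weight_pair_ind_weights)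
  note ind = lin_space_ell_s[OF _ assms(1)] and proj = lin_space_ell_s_star[OF _ assms(1)]
  have plain: "kernel_iso p (Ahat p s2 s1 :: ('d2, 'd1) kernel set) (A_s' p s1) (A_s p s2)"
    "kernel_iso p (Ahat' p s2 s1 :: ('d2, 'd1) kernel set) (A_s p s1) (A_s' p s2)"
    "kernel_iso p (Bhat p s2 s1 :: ('d2, 'd1) kernel set) (A_s p s1) (A_s p s2)"
    "kernel_iso p (Bhat_star p s2 s1 :: ('d2, 'd1) kernel set) (A_s' p s1) (A_s' p s2)"
    unfolding Ahat_def Ahat'_def Bhat_def Bhat_star_def A_s_def[of p s1] A_s_def[of p s2] A_s'_def
      ell_A_eq[OF assms] ell_A_star_eq[OF assms] ell_B_eq[OF assms] ell_B_star_eq[OF assms]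
    by (rule iso[OF weight_pair.kernel_class_proj_ind[OF pair proj[OF assms(2)] ind[OF assms(3)]]],
        rule iso[OF weight_pair.kernel_class_ind_proj[OF pair ind[OF assms(2)] proj[OF assms(3)]]],
        rule iso[OF weight_pair.kernel_class_ind_ind[OF pair ind[OF assms(2)] ind[OF assms(3)]]],
        rule iso[OF weight_pair.kernel_class_proj_proj[OF pair proj[OF assms(2)] proj[OF assms(3)]]])
  have zero: "kernel_iso p (Ahat0 p s2 s1 :: ('d2, 'd1) kernel set) (A_0s' p s1) (A_0s p s2)"
    "kernel_iso p (Ahat0' p s2 s1 :: ('d2, 'd1) kernel set) (A_0s p s1) (A_0s' p s2)"
    "kernel_iso p (Bhat0 p s2 s1 :: ('d2, 'd1) kernel set) (A_0s p s1) (A_0s p s2)"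
    "kernel_iso p (Bhat0_star p s2 s1 :: ('d2, 'd1) kernel set) (A_0s' p s1) (A_0s' p s2)"
    if z: "s1 = Num 0 \<or> s2 = Num 0"
  proof -
    have sets: "Ahat0 p s2 s1 = {K. coeff_K K \<in> {\<lambda>_. 0}}" "Ahat0' p s2 s1 = {K. coeff_K K \<in> {\<lambda>_. 0}}"
      "Bhat0 p s2 s1 = {K. coeff_K K \<in> {\<lambda>_. 0}}" "Bhat0_star p s2 s1 = {K. coeff_K K \<in> {\<lambda>_. 0}}"
      using z by (auto simp: Ahat0_def Ahat0'_def Bhat0_def Bhat0_star_def ell_A0_def ell_A0_star_def
          ell_B0_def ell_B0_star_def)
    obtain E1 N1 where d: "lin_space (ell_0s p s1 :: ('d1 midx \<Rightarrow> complex) topology) E1 N1"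
        "s1 = Num 0 \<longrightarrow> E1 = {\<lambda>_. 0}"
      using lin_space_ell_0s_ex[OF assms(2,1)] by blast
    obtain E1' N1' where d': "lin_space (ell_0s_star p s1 :: ('d1 midx \<Rightarrow> complex) topology) E1' N1'"
        "s1 = Num 0 \<longrightarrow> E1' = {\<lambda>_. 0}"
      using lin_space_ell_0s_star_ex[OF assms(2,1)] by blast
    obtain E2 N2 where c: "lin_space (ell_0s p s2 :: ('d2 midx \<Rightarrow> complex) topology) E2 N2"
        "s2 = Num 0 \<longrightarrow> E2 = {\<lambda>_. 0}"
      using lin_space_ell_0s_ex[OF assms(3,1)] by blast
    obtain E2' N2' where c': "lin_space (ell_0s_star p s2 :: ('d2 midx \<Rightarrow> complex) topology) E2' N2'"
        "s2 = Num 0 \<longrightarrow> E2' = {\<lambda>_. 0}"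
      using lin_space_ell_0s_star_ex[OF assms(3,1)] by blast
    show "kernel_iso p (Ahat0 p s2 s1 :: ('d2, 'd1) kernel set) (A_0s' p s1) (A_0s p s2)"
      "kernel_iso p (Ahat0' p s2 s1 :: ('d2, 'd1) kernel set) (A_0s p s1) (A_0s' p s2)"
      "kernel_iso p (Bhat0 p s2 s1 :: ('d2, 'd1) kernel set) (A_0s p s1) (A_0s p s2)"
      "kernel_iso p (Bhat0_star p s2 s1 :: ('d2, 'd1) kernel set) (A_0s' p s1) (A_0s' p s2)"
      unfolding sets A_0s_def A_0s'_def
      using kernel_iso_zero[OF d'(1) c(1)] kernel_iso_zero[OF d(1) c'(1)]
        kernel_iso_zero[OF d(1) c(1)] kernel_iso_zero[OF d'(1) c'(1)] z d(2) d'(2) c(2) c'(2)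
      by blast+
  qed
  have nonzero: "kernel_iso p (Ahat0 p s2 s1 :: ('d2, 'd1) kernel set) (A_0s' p s1) (A_0s p s2)"
    "kernel_iso p (Ahat0' p s2 s1 :: ('d2, 'd1) kernel set) (A_0s p s1) (A_0s' p s2)"
    "kernel_iso p (Bhat0 p s2 s1 :: ('d2, 'd1) kernel set) (A_0s p s1) (A_0s p s2)"
    "kernel_iso p (Bhat0_star p s2 s1 :: ('d2, 'd1) kernel set) (A_0s' p s1) (A_0s' p s2)"
    if nz: "s1 \<noteq> Num 0" "s2 \<noteq> Num 0"
  proof -
    note pair = weight_pair_ind_weights0[OF assms nz]
    \<comment> \<open>Compared with \<open>plain\<close> the two kinds of limit have changed places:
      \<open>Ahat0\<close> goes with the class used there for \<open>Ahat'\<close>,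
      \<open>Bhat0\<close> with that of \<open>Bhat_star\<close>, and conversely.\<close>
    note ind = lin_space_ell_0s_star[OF _ _ assms(1)] and proj = lin_space_ell_0s[OF _ _ assms(1)]
    show "kernel_iso p (Ahat0 p s2 s1 :: ('d2, 'd1) kernel set) (A_0s' p s1) (A_0s p s2)"
      "kernel_iso p (Ahat0' p s2 s1 :: ('d2, 'd1) kernel set) (A_0s p s1) (A_0s' p s2)"
      "kernel_iso p (Bhat0 p s2 s1 :: ('d2, 'd1) kernel set) (A_0s p s1) (A_0s p s2)"
      "kernel_iso p (Bhat0_star p s2 s1 :: ('d2, 'd1) kernel set) (A_0s' p s1) (A_0s' p s2)"
      unfolding Ahat0_def Ahat0'_def Bhat0_def Bhat0_star_def A_0s_def A_0s'_def
        ell_A0_eq[OF assms nz] ell_A0_star_eq[OF assms nz] ell_B0_eq[OF assms nz] ell_B0_star_eq[OF assms nz]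
      by (rule iso[OF weight_pair.kernel_class_ind_proj[OF pair ind[OF assms(2) nz(1)] proj[OF assms(3) nz(2)]]],
          rule iso[OF weight_pair.kernel_class_proj_ind[OF pair proj[OF assms(2) nz(1)] ind[OF assms(3) nz(2)]]],
          rule iso[OF weight_pair.kernel_class_proj_proj[OF pair proj[OF assms(2) nz(1)] proj[OF assms(3) nz(2)]]],
          rule iso[OF weight_pair.kernel_class_ind_ind[OF pair ind[OF assms(2) nz(1)] ind[OF assms(3) nz(2)]]])
  qed
  show ?thesis using plain zero nonzero by blast
qed

end
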